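(* Let $\mu$ be a measure on $M_d(\mathbb{C})$ with $\int\|v\|^2\,\mathrm{d}\mu(v)<\infty$ and $\int v^*v\,\mathrm{d}\mu(v)=\mathrm{Id}_{\mathbb{C}^d}$, and assume that $\mu$ is purifying and ergodic. Let $(\hat x_n)_{n\ge 0}$ be the associated quantum trajectory and $\nu_{inv}$ the unique invariant probability measure of its transition kernel. Then for every initial probability measure $\nu$ on $(\mathrm{P}(\mathbb{C}^d),\mathcal{B})$ and every continuous function $g$ on $\mathrm{P}(\mathbb{C}^d)$, $$\lim_{n\to\infty}\frac1n\sum_{k=0}^{n-1}g(\hat x_k)=\mathbb{E}_{\nu_{inv}}(g)\qquad \mathbb{P}_\nu\text{-almost surely}.$$
   Context: Setting. Let $d\ge 1$ be an integer, $\mathrm{P}(\mathbb{C}^d)$ the complex projective space of $\mathbb{C}^d$ with Borel $\sigma$-algebra $\mathcal{B}$. For nonzero $x\in\mathbb{C}^d$, $\hat x$ is its class in $\mathrm{P}(\mathbb{C}^d)$; for $\hat x\in \mathrm{P}(\mathbb{C}^d)$, $x$ denotes an arbitrary norm-one representative. The metric on $\mathrm{P}(\mathbb{C}^d)$ is $d(\hat x,\hat y)=\sqrt{1-|\langle x,y\rangle|^2}$. For $v\in M_d(\mathbb{C})$ with $vx\neq 0$, $v\cdot\hat x$ is the class of $vx$. $\mu$ is a measure on the Borel sets of $M_d(\mathbb{C})$ with $\int\|v\|^2\mathrm{d}\mu(v)<\infty$ and $\int v^*v\,\mathrm{d}\mu(v)=\mathrm{Id}_{\mathbb{C}^d}$.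 Kernel. $\Pi(\hat x,S)=\int \mathbf{1}_S(v\cdot\hat x)\|vx\|^2\mathrm{d}\mu(v)$ for $S\in\mathcal{B}$ (the integrand is $0$ when $vx=0$), and $\Pi f(\hat x)=\int f(v\cdot\hat x)\|vx\|^2\mathrm{d}\mu(v)$. Process. $\Omega=M_d(\mathbb{C})^{\mathbb{N}}$, elements written $\omega=(v_1,v_2,\dots)$; $\mathcal{O}_n$ is the $\sigma$-algebra generated by the first $n$ coordinates and $\mathcal{O}$ the one generated by all coordinates; $V_i(\omega)=v_i$, $W_n=V_n\cdots V_1$, $W_0=\mathrm{Id}$. For a probability measure $\nu$ on $\mathrm{P}(\mathbb{C}^d)$, $\mathbb{P}_\nu$ is the unique probability measure on $(\mathrm{P}(\mathbb{C}^d)\times\Omega,\mathcal{B}\otimes\mathcal{O})$ with $\mathbb{P}_\nu(S\times O_n)=\int_{S\times O_n}\|W_n(\omega)x\|^2\,\mathrm{d}\nu(\hat x)\,\mathrm{d}\mu^{\otimes n}(\omega)$ for $S\in\mathcal{B}$, $O_n\in\mathcal{O}_n$. On it, $\hat x_n(\hat x,\omega)=W_n(\omega)\cdot\hat x$ when $W_n(\omega)x\ne0$ (which holds $\mathbb{P}_\nu$-a.s.), extended arbitrarily otherwise; $(\hat x_n)$ is a Markov chain with kernel $\Pi$ and initial law $\nu$, called the quantum trajectory. $\mathbb{E}_\nu$ is expectation under $\mathbb{P}_\nu$; in particular $\mathbb{E}_{\nu}(g)=\int g\,\mathrm{d}\nu$ for $g$ a function on $\mathrm{P}(\mathbb{C}^d)$.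 Assumptions. $\mu$ is purifying (assumption (Pur)) if every nonzero orthogonal projector $\pi$ such that for all $n\in\mathbb{N}$, $\pi v_1^*\cdots v_n^*v_n\cdots v_1\pi\propto\pi$ for $\mu^{\otimes n}$-almost all $(v_1,\dots,v_n)$, has rank one. $\mu$ is ergodic (assumption (Erg)) if there is a unique minimal subspace $E\ne\{0\}$ of $\mathbb{C}^d$ such that $vE\subset E$ for all $v\in\operatorname{supp}\mu$ (minimal among nonzero subspaces with this property). It is known that if $\mu$ is purifying and ergodic then $\Pi$ has a unique invariant probability measure $\nu_{inv}$. *)

theory Defs
  imports "HOL-Probability.Probability"
begin

section \<open>The complex projective space\<close>

text \<open>The library's \<open>inner\<close> on \<open>complex ^ 'n\<close> is the real inner product; this is the Hermitian one.\<close>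

definition cinner :: "complex ^ 'n \<Rightarrow> complex ^ 'n \<Rightarrow> complex" where
  "cinner x y = (\<Sum>i\<in>UNIV. cnj (x $ i) * y $ i)"

definition same_line :: "complex ^ 'n \<Rightarrow> complex ^ 'n \<Rightarrow> bool" where
  "same_line x y \<longleftrightarrow> x \<noteq> 0 \<and> y \<noteq> 0 \<and> (\<exists>c. y = c *s x)"

lemma same_line_sym: "same_line x y \<Longrightarrow> same_line y x"
  unfolding same_line_def
proof (elim conjE exE, intro conjI)
  fix c assume h: "x \<noteq> 0" "y \<noteq> 0" "y = c *s x"
  then have "c \<noteq> 0" by auto
  then have "x = inverse c *s y" using h by (simp add: vector_smult_assoc)
  then show "\<exists>c. x = c *s y" by blast
qed auto

lemma same_line_trans: "same_line x y \<Longrightarrow> same_line y z \<Longrightarrow> same_line x z"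
  unfolding same_line_def by (auto simp: vector_smult_assoc)

lemma part_equivp_same_line: "part_equivp (same_line :: complex ^ 'n \<Rightarrow> _)"
proof (rule part_equivpI)
  have "(axis undefined 1 :: complex ^ 'n) \<noteq> 0"
    by (simp add: axis_eq_0_iff)
  moreover have "(axis undefined 1 :: complex ^ 'n) = 1 *s axis undefined 1" by simp
  ultimately show "\<exists>x::complex ^ 'n. same_line x x" unfolding same_line_def by blast
  show "symp (same_line :: complex ^ 'n \<Rightarrow> _)" by (rule sympI) (rule same_line_sym)
  show "transp (same_line :: complex ^ 'n \<Rightarrow> _)" by (rule transpI) (rule same_line_trans)
qed

text \<open>\<open>proj x\<close> is the class of \<open>x\<close>; \<open>proj 0\<close> is an unspecified point.\<close>

quotient_type (overloaded) 'n cproj = "complex ^ ('n :: finite)" / partial: same_line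
  morphisms rep_cproj proj
  by (rule part_equivp_same_line)

lemma proj_eq_iff:
  assumes "x \<noteq> 0" "y \<noteq> 0"
  shows "proj x = proj y \<longleftrightarrow> (\<exists>c. y = c *s x)"
proof -
  have r: "same_line z z" if "z \<noteq> 0" for z :: "complex ^ 'n"
    using that unfolding same_line_def by (auto intro!: exI[of _ 1])
  have "proj x = proj y \<longleftrightarrow> same_line x y"
    using Quotient3_rel[OF Quotient3_cproj] r assms by metis
  then show ?thesis using assms by (simp add: same_line_def)
qed

definition unit_rep :: "('n :: finite) cproj \<Rightarrow> complex ^ 'n" where
  "unit_rep p = (SOME x. norm x = 1 \<and> proj x = p)"

lemma norm_vector_smult: "norm (c *s x) = cmod c * norm (x :: complex ^ 'n)"
  by (simp add: norm_vec_def L2_set_right_distrib norm_mult)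

lemma unit_rep: "norm (unit_rep p) = 1" "proj (unit_rep p) = p"
proof -
  obtain x where x: "same_line x x" "p = proj x"
    by (metis Quotient3_abs_rep[OF Quotient3_cproj] Quotient3_rep_reflp[OF Quotient3_cproj])
  then have x0: "x \<noteq> 0" by (simp add: same_line_def)
  let ?y = "complex_of_real (1 / norm x) *s x"
  have n: "norm ?y = 1" using x0 by (simp add: norm_vector_smult norm_divide)
  then have "?y \<noteq> 0" by force
  then have "proj ?y = p" using proj_eq_iff[OF x0] x(2) by metis
  with n have "\<exists>x. norm x = 1 \<and> proj x = p" by blast
  then have "norm (unit_rep p) = 1 \<and> proj (unit_rep p) = p"
    unfolding unit_rep_def by (rule someI_ex)
  then show "norm (unit_rep p) = 1" "proj (unit_rep p) = p" by auto
qed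

definition outer :: "complex ^ 'n \<Rightarrow> complex ^ 'n ^ 'n" where
  "outer x = (\<chi> i j. x $ i * cnj (x $ j))"

lemma cinner_smult_left: "cinner (c *s x) y = cnj c * cinner x y"
  by (simp add: cinner_def sum_distrib_left mult.assoc)

lemma cinner_smult_right: "cinner x (c *s y) = c * cinner x y"
  by (simp add: cinner_def sum_distrib_left algebra_simps)

lemma cinner_self: "cinner x x = of_real ((norm x)\<^sup>2)"
  by (simp add: cinner_def norm_vec_def L2_set_def real_sqrt_pow2 sum_nonneg
      complex_norm_square mult.commute del: of_real_power)

lemma inner_outer: "inner (outer x) (outer y) = (cmod (cinner x y))\<^sup>2"
proof -
  have "inner (outer x) (outer y)
      = Re (\<Sum>i\<in>UNIV. \<Sum>j\<in>UNIV. (cnj (x $ i) * y $ i) * cnj (cnj (x $ j) * y $ j))"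
    by (simp add: inner_vec_def outer_def inner_complex_def algebra_simps)
  also have "\<dots> = Re (cinner x y * cnj (cinner x y))"
    by (simp only: cinner_def cnj_sum sum_product)
  also have "\<dots> = (cmod (cinner x y))\<^sup>2"
    by (simp only: complex_norm_square[symmetric] Re_complex_of_real)
  finally show ?thesis .
qed

lemma norm_outer_diff:
  assumes "norm x = 1" "norm y = 1"
  shows "(norm (outer x - outer y))\<^sup>2 = 2 * (1 - (cmod (cinner x y))\<^sup>2)"
proof -
  have "inner (outer x) (outer x) = 1" "inner (outer y) (outer y) = 1"
    using assms by (simp_all add: inner_outer cinner_self)
  then show ?thesis
    by (simp add: power2_norm_eq_inner[of "outer x - outer y"] inner_diff_left inner_diff_right inner_commute[of "outer y" "outer x"])
       (simp add: inner_outer)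
qed

lemma sqrt_eq_norm_outer:
  assumes "norm x = 1" "norm y = 1"
  shows "sqrt (1 - (cmod (cinner x y))\<^sup>2) = norm (outer x - outer y) / sqrt 2"
proof -
  have "1 - (cmod (cinner x y))\<^sup>2 = (norm (outer x - outer y))\<^sup>2 / 2"
    using norm_outer_diff[OF assms] by simp
  then show ?thesis by (simp only: real_sqrt_divide real_sqrt_abs abs_norm_cancel)
qed

lemma outer_vec: "outer x *v z = cinner x z *s x"
  by (simp add: outer_def matrix_vector_mult_def cinner_def vec_eq_iff sum_distrib_left
      sum_distrib_right algebra_simps)

instantiation cproj :: (finite) metric_space
begin

definition dist_cproj :: "'a cproj \<Rightarrow> 'a cproj \<Rightarrow> real" where
  "dist_cproj p q = sqrt (1 - (cmod (cinner (unit_rep p) (unit_rep q)))\<^sup>2)"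

definition uniformity_cproj :: "('a cproj \<times> 'a cproj) filter" where
  "uniformity_cproj = (INF e\<in>{0 <..}. principal {(p, q). dist p q < e})"

definition open_cproj :: "'a cproj set \<Rightarrow> bool" where
  "open_cproj U = (\<forall>p\<in>U. eventually (\<lambda>(p', q). p' = p \<longrightarrow> q \<in> U) uniformity)"

instance
proof
  have d: "dist p q = norm (outer (unit_rep p) - outer (unit_rep q)) / sqrt 2" for p q :: "'a cproj"
    unfolding dist_cproj_def by (rule sqrt_eq_norm_outer) (rule unit_rep)+
  fix p q r :: "'a cproj"
  show "dist p q = 0 \<longleftrightarrow> p = q"
  proof
    assume "dist p q = 0"
    then have "outer (unit_rep p) = outer (unit_rep q)" by (simp add: d)
    then have "outer (unit_rep p) *v unit_rep q = outer (unit_rep q) *v unit_rep q" by simp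
    then have "unit_rep q = cinner (unit_rep p) (unit_rep q) *s unit_rep p"
      by (simp add: outer_vec cinner_self unit_rep)
    moreover have "unit_rep p \<noteq> 0" "unit_rep q \<noteq> 0" by (metis unit_rep(1) norm_zero zero_neq_one)+
    ultimately have "proj (unit_rep p) = proj (unit_rep q)" using proj_eq_iff by blast
    then show "p = q" by (simp add: unit_rep)
  qed (simp add: d)
  show "dist p q \<le> dist p r + dist q r"
  proof -
    have "norm (outer (unit_rep p) - outer (unit_rep q))
        \<le> norm (outer (unit_rep p) - outer (unit_rep r)) + norm (outer (unit_rep q) - outer (unit_rep r))"
      using norm_triangle_ineq4[of "outer (unit_rep p) - outer (unit_rep r)" "outer (unit_rep q) - outer (unit_rep r)"]
      by simp
    then show ?thesis by (simp add: d divide_simps)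
  qed
qed (simp_all add: uniformity_cproj_def open_cproj_def)

end

text \<open>The distance does not depend on the chosen norm-one representatives.\<close>

lemma unit_rep_proj:
  assumes "norm z = 1"
  shows "\<exists>c. cmod c = 1 \<and> unit_rep (proj z) = c *s z"
proof -
  have "z \<noteq> 0" "unit_rep (proj z) \<noteq> 0" using assms unit_rep(1)[of "proj z"] by force+
  then obtain c where c: "unit_rep (proj z) = c *s z"
    using proj_eq_iff[of z "unit_rep (proj z)"] by (auto simp: unit_rep)
  then have "cmod c = 1" using assms unit_rep(1)[of "proj z"] by (simp add: norm_vector_smult)
  with c show ?thesis by blast
qed

lemma dist_proj:
  assumes "norm x = 1" "norm y = 1"
  shows "dist (proj x) (proj y) = sqrt (1 - (cmod (cinner x y))\<^sup>2)"
proof -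
  obtain a b where "cmod a = 1" "unit_rep (proj x) = a *s x" "cmod b = 1" "unit_rep (proj y) = b *s y"
    using unit_rep_proj[OF assms(1)] unit_rep_proj[OF assms(2)] by blast
  then show ?thesis
    by (simp add: dist_cproj_def cinner_smult_left cinner_smult_right norm_mult)
qed


section \<open>The measure on matrices and the assumptions (Pur) and (Erg)\<close>

abbreviation opnorm :: "complex ^ 'n ^ 'n \<Rightarrow> real" where
  "opnorm v \<equiv> onorm (\<lambda>x. v *v x)"

definition cadjoint :: "complex ^ 'n ^ 'n \<Rightarrow> complex ^ 'n ^ 'n" where
  "cadjoint v = map_matrix cnj (transpose v)"

text \<open>Sequences are indexed from 0: \<open>\<omega> i\<close> is \<open>v\<^sub>i\<^sub>+\<^sub>1\<close>, so that
  \<open>W n \<omega>\<close> is \<open>v\<^sub>n \<cdots> v\<^sub>1\<close>.\<close>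

primrec W :: "nat \<Rightarrow> (nat \<Rightarrow> complex ^ 'n ^ 'n) \<Rightarrow> complex ^ 'n ^ 'n" where
  "W 0 \<omega> = mat 1"
| "W (Suc n) \<omega> = \<omega> n ** W n \<omega>"

definition orthogonal_projector :: "complex ^ 'n ^ 'n \<Rightarrow> bool" where
  "orthogonal_projector \<pi> \<longleftrightarrow> \<pi> ** \<pi> = \<pi> \<and> cadjoint \<pi> = \<pi>"

text \<open>\<open>PiM {..<n} (\<lambda>_. \<mu>)\<close> is \<open>\<mu>\<^sup>\<otimes>\<^sup>n\<close>, and \<open>cadjoint (W n \<omega>)\<close> is
  \<open>v\<^sub>1\<^sup>* \<cdots> v\<^sub>n\<^sup>*\<close>.\<close>

definition purifying :: "(complex ^ 'n ^ 'n) measure \<Rightarrow> bool" where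
  "purifying \<mu> \<longleftrightarrow>
     (\<forall>\<pi>. orthogonal_projector \<pi> \<and> \<pi> \<noteq> 0 \<and>
        (\<forall>n. AE \<omega> in PiM {..<n} (\<lambda>_. \<mu>).
           \<exists>c. \<pi> ** cadjoint (W n \<omega>) ** W n \<omega> ** \<pi> = map_matrix (\<lambda>z. c * z) \<pi>)
        \<longrightarrow> rank \<pi> = 1)"

definition msupport :: "('a :: topological_space) measure \<Rightarrow> 'a set" where
  "msupport \<mu> = {v. \<forall>U. open U \<and> v \<in> U \<longrightarrow> emeasure \<mu> U \<noteq> 0}"

definition nonzero_invariant_subspace :: "(complex ^ 'n ^ 'n) measure \<Rightarrow> (complex ^ 'n) set \<Rightarrow> bool" where
  "nonzero_invariant_subspace \<mu> E \<longleftrightarrow>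
     vec.subspace E \<and> E \<noteq> {0} \<and> (\<forall>v\<in>msupport \<mu>. (\<lambda>x. v *v x) ` E \<subseteq> E)"

definition ergodic :: "(complex ^ 'n ^ 'n) measure \<Rightarrow> bool" where
  "ergodic \<mu> \<longleftrightarrow>
     (\<exists>!E. nonzero_invariant_subspace \<mu> E \<and>
        (\<forall>F. nonzero_invariant_subspace \<mu> F \<and> F \<subseteq> E \<longrightarrow> F = E))"


section \<open>The kernel and the quantum trajectory\<close>

definition act :: "complex ^ 'n ^ 'n \<Rightarrow> 'n cproj \<Rightarrow> 'n cproj" where
  "act v p = proj (v *v unit_rep p)"

lemma act_proj:
  assumes "norm x = 1"
  shows "act v (proj x) = proj (v *v x)"
proof -
  obtain c where c: "cmod c = 1" "unit_rep (proj x) = c *s x"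
    using unit_rep_proj[OF assms] by blast
  then have e: "v *v unit_rep (proj x) = c *s (v *v x)"
    by (simp only: c(2) vector_scalar_commute)
  show ?thesis
  proof (cases "v *v x = 0")
    case False
    then have "c *s (v *v x) \<noteq> 0" using c by auto
    with False have "proj (v *v x) = proj (c *s (v *v x))" using proj_eq_iff by blast
    then show ?thesis by (simp add: act_def e)
  qed (simp add: act_def e)
qed

definition kernel :: "(complex ^ 'n ^ 'n) measure \<Rightarrow> 'n cproj \<Rightarrow> 'n cproj set \<Rightarrow> ennreal" where
  "kernel \<mu> p S = (\<integral>\<^sup>+v. indicator S (act v p) * ennreal ((norm (v *v unit_rep p))\<^sup>2) \<partial>\<mu>)"

definition borel_prob :: "('a :: topological_space) measure \<Rightarrow> bool" where
  "borel_prob \<nu> \<longleftrightarrow> prob_space \<nu> \<and> sets \<nu> = sets borel"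

definition invariant_prob :: "(complex ^ 'n ^ 'n) measure \<Rightarrow> ('n cproj) measure \<Rightarrow> bool" where
  "invariant_prob \<mu> \<nu> \<longleftrightarrow>
     borel_prob \<nu> \<and> (\<forall>S\<in>sets borel. (\<integral>\<^sup>+p. kernel \<mu> p S \<partial>\<nu>) = emeasure \<nu> S)"

text \<open>The defining property of \<open>\<P>\<^sub>\<nu>\<close>. The elements of \<open>\<O>\<^sub>n\<close> are the cylinders
  \<open>prod_emb UNIV (\<lambda>_. borel) {..<n} B\<close> with \<open>B\<close> in the product \<open>\<sigma>\<close>-algebra of the first
  \<open>n\<close> coordinates.\<close>

definition trajectory_measure ::
    "(complex ^ 'n ^ 'n) measure \<Rightarrow> ('n cproj) measure \<Rightarrow>
     ('n cproj \<times> (nat \<Rightarrow> complex ^ 'n ^ 'n)) measure \<Rightarrow> bool" where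
  "trajectory_measure \<mu> \<nu> P \<longleftrightarrow>
     prob_space P \<and>
     sets P = sets (borel \<Otimes>\<^sub>M PiM UNIV (\<lambda>_. borel)) \<and>
     (\<forall>n. \<forall>S\<in>sets borel. \<forall>B\<in>sets (PiM {..<n} (\<lambda>_. borel)).
        emeasure P (S \<times> prod_emb UNIV (\<lambda>_. borel) {..<n} B) =
          (\<integral>\<^sup>+p\<in>S. (\<integral>\<^sup>+\<omega>\<in>B. ennreal ((norm (W n \<omega> *v unit_rep p))\<^sup>2)
             \<partial>PiM {..<n} (\<lambda>_. \<mu>)) \<partial>\<nu>))"

definition trajectory :: "nat \<Rightarrow> 'n cproj \<times> (nat \<Rightarrow> complex ^ 'n ^ 'n) \<Rightarrow> 'n cproj" where
  "trajectory n = (\<lambda>(p, \<omega>). act (W n \<omega>) p)"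

end

theory Submission
  imports Defs "HOL-Complex_Analysis.Great_Picard"
begin

text \<open>Write \<open>\<Pi>\<close> for the transition operator of the quantum trajectory (\<open>markov\<close> below). For continuous
  \<open>f\<close> the differences \<open>f (x\<^sub>k\<^sub>+\<^sub>1) - \<Pi> f (x\<^sub>k)\<close> are bounded and pairwise orthogonal, so their averages
  tend to \<open>0\<close> almost surely (\<open>orthogonal_strong_law\<close>, \<open>markov_step_strong_law\<close>). Applied to \<open>g\<close>,
  \<open>\<Pi> g\<close>, \<open>\<Pi>\<^sup>2 g\<close>, and so on, this allows \<open>g\<close> to be replaced by one of its Cesaro averages
  \<open>A\<^sub>m g = (g + \<Pi> g + \<dots> + \<Pi>\<^sup>m\<^sup>-\<^sup>1 g) / m\<close> in the time average along the trajectory. The theorem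
  follows once \<open>A\<^sub>m g\<close> tends to the constant \<open>\<integral> g d\<nu>_inv\<close> uniformly on projective space, and this
  convergence is the part where purification and ergodicity enter.

  Purification makes the image of a long matrix product almost one-dimensional. Let
  \<open>u\<^sub>n(x, y) = \<integral> \<parallel>W\<^sub>n x \<and> W\<^sub>n y\<parallel> d\<mu>\<^sup>\<otimes>\<^sup>n\<close>. As \<open>\<parallel>W x \<and> W y\<parallel>\<close> depends on \<open>x \<and> y\<close> alone and is at most
  \<open>\<parallel>W x\<parallel> \<parallel>W y\<parallel>\<close>, the supremum of \<open>u\<^sub>n\<close> over orthonormal pairs is at most \<open>1\<close> and
  submultiplicative in \<open>n\<close>. If it were \<open>1\<close> for all \<open>n\<close>, compactness would give one orthonormal pair
  with \<open>u\<^sub>n(x, y) = 1\<close> for all \<open>n\<close>; equality in the inequalities just used makes \<open>W\<^sub>n x\<close> and \<open>W\<^sub>n y\<close>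
  orthogonal and of equal length almost everywhere, and the projector onto the plane of \<open>x\<close> and \<open>y\<close>
  contradicts purification. Hence \<open>u\<^sub>n\<close> tends to \<open>0\<close> uniformly (\<open>wedge_tendsto_0\<close>).

  Consequently \<open>f (W\<^sub>n \<cdot> x)\<close> hardly depends on \<open>x\<close>, and replacing it by a quantity that depends on
  \<open>W\<^sub>n\<close> only turns \<open>\<Pi>\<^sup>n f (x) = \<integral> f (W\<^sub>n \<cdot> x) \<parallel>W\<^sub>n x\<parallel>\<^sup>2 d\<mu>\<^sup>\<otimes>\<^sup>n\<close> into a quadratic form in \<open>x\<close>
  (\<open>markov_pow_asymptotic\<close>). So the Cesaro averages accumulate only at quadratic forms, which are then
  fixed by \<open>q \<mapsto> \<integral> q (v x) d\<mu>(v)\<close>. For such a form the vectors at which \<open>q / \<parallel>\<cdot>\<parallel>\<^sup>2\<close> attains its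
  maximum form, together with \<open>0\<close>, an invariant subspace, and so do those at which it attains its
  minimum; if the two values differed, each subspace would contain its own minimal invariant subspace,
  against ergodicity (\<open>fixed_quadratic_form_const\<close>). Thus every limit point is a constant, and integration against
  \<open>\<nu>_inv\<close> identifies it (\<open>cesaro_uniform_limit\<close>).\<close>

section \<open>Hermitian geometry\<close>

lemma cinner_commute: "cinner y x = cnj (cinner x y)"
  by (simp add: cinner_def mult.commute)

lemma cinner_add_right: "cinner x (y + z) = cinner x y + cinner x z"
  by (simp add: cinner_def distrib_left sum.distrib)

lemma inner_eq_Re_cinner: "inner x y = Re (cinner x y)"
  by (simp add: cinner_def inner_vec_def inner_complex_def)

lemma continuous_on_cinner [continuous_intros]:
  assumes "continuous_on S f" "continuous_on S g"
  shows "continuous_on S (\<lambda>s. cinner (f s) (g s))"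
  unfolding cinner_def by (intro continuous_intros assms)

text \<open>The squared modulus of the Hermitian product is the real inner product of the rank-one matrices
  \<open>outer x\<close> and \<open>outer y\<close>, so the real Cauchy--Schwarz inequality for matrices applies.\<close>

lemma cinner_Cauchy_Schwarz: "cmod (cinner x y) \<le> norm x * norm y"
proof -
  have self: "norm (outer z) = (norm z)\<^sup>2" for z :: "complex ^ 'a"
  proof -
    have "(norm (outer z))\<^sup>2 = ((norm z)\<^sup>2)\<^sup>2"
      unfolding power2_norm_eq_inner[of "outer z"] inner_outer cinner_self
      by (simp only: norm_of_real) simp
    then show ?thesis by (rule power2_eq_imp_eq) simp_all
  qed
  have "(cmod (cinner x y))\<^sup>2 \<le> norm (outer x) * norm (outer y)"
    unfolding inner_outer[symmetric] by (rule norm_cauchy_schwarz)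
  also have "\<dots> = (norm x * norm y)\<^sup>2"
    by (simp add: self power_mult_distrib)
  finally show ?thesis by (rule power2_le_imp_le) simp
qed

lemma norm_matrix_vector_mult_le:
  fixes v :: "complex ^ 'n ^ 'm"
  shows "norm (v *v x) \<le> norm v * norm x"
proof -
  have "norm ((v *v x) $ i) \<le> norm (v $ i) * norm x" for i
  proof -
    have "norm ((v *v x) $ i) \<le> (\<Sum>j\<in>UNIV. \<bar>norm (v $ i $ j)\<bar> * \<bar>norm (x $ j)\<bar>)"
      unfolding matrix_vector_mult_def by (simp add: norm_sum[THEN order_trans] norm_mult)
    also have "\<dots> \<le> norm (v $ i) * norm x"
      unfolding norm_vec_def by (rule L2_set_mult_ineq)
    finally show ?thesis .
  qed
  then have "norm (v *v x) \<le> L2_set (\<lambda>i. norm (v $ i) * norm x) UNIV"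
    unfolding norm_vec_def[of "v *v x"] by (intro L2_set_mono) auto
  also have "\<dots> = norm v * norm x"
    unfolding norm_vec_def[of v] by (simp add: L2_set_left_distrib)
  finally show ?thesis .
qed

lemma norm_matrix_matrix_mult_le:
  fixes v :: "complex ^ 'n ^ 'm" and w :: "complex ^ 'k ^ 'n"
  shows "norm (v ** w) \<le> norm v * norm w"
proof -
  have "norm ((v ** w) $ i) \<le> norm (v $ i) * norm w" for i
  proof -
    have e: "(v ** w) $ i = (\<Sum>j\<in>UNIV. v $ i $ j *s w $ j)"
      by (simp add: matrix_matrix_mult_def vec_eq_iff)
    have "norm ((v ** w) $ i) \<le> (\<Sum>j\<in>UNIV. \<bar>norm (v $ i $ j)\<bar> * \<bar>norm (w $ j)\<bar>)"
      unfolding e by (rule order_trans[OF norm_sum]) (simp add: norm_vector_smult)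
    also have "\<dots> \<le> norm (v $ i) * norm w"
      unfolding norm_vec_def[of "v $ i"] norm_vec_def[of w] by (rule L2_set_mult_ineq)
    finally show ?thesis .
  qed
  then have "norm (v ** w) \<le> L2_set (\<lambda>i. norm (v $ i) * norm w) UNIV"
    unfolding norm_vec_def[of "v ** w"] by (intro L2_set_mono) auto
  also have "\<dots> = norm v * norm w"
    unfolding norm_vec_def[of v] by (simp add: L2_set_left_distrib)
  finally show ?thesis .
qed

lemma matrix_vector_mult_axis: "(v *v axis j (1 :: complex)) $ i = v $ i $ j"
  by (simp add: matrix_vector_mult_def axis_def if_distrib[of "\<lambda>t. _ * t"] cong: if_cong)

lemma continuous_on_matrix_vector_mult_complex [continuous_intros]:
  fixes f :: "'a::topological_space \<Rightarrow> complex ^ 'n ^ 'm"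
  assumes "continuous_on S f" "continuous_on S g"
  shows "continuous_on S (\<lambda>s. f s *v g s)"
  unfolding matrix_vector_mult_def by (intro continuous_intros assms)

lemma continuous_on_matrix_matrix_mult_complex [continuous_intros]:
  fixes f :: "'a::topological_space \<Rightarrow> complex ^ 'n ^ 'm"
  assumes "continuous_on S f" "continuous_on S g"
  shows "continuous_on S (\<lambda>s. f s ** g s)"
  unfolding matrix_matrix_mult_def by (intro continuous_intros assms)

text \<open>The area \<open>\<parallel>x \<and> y\<parallel>\<close> of the parallelogram spanned by \<open>x\<close> and \<open>y\<close>, through the Gram determinant.\<close>

definition cross :: "complex ^ 'n \<Rightarrow> complex ^ 'n \<Rightarrow> real" where
  "cross x y = sqrt ((norm x)\<^sup>2 * (norm y)\<^sup>2 - (cmod (cinner x y))\<^sup>2)"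

lemma cross_radicand_nonneg: "0 \<le> (norm x)\<^sup>2 * (norm y)\<^sup>2 - (cmod (cinner x y))\<^sup>2"
  using power_mono[OF cinner_Cauchy_Schwarz[of x y], of 2] by (simp add: power_mult_distrib)

lemma cross_nonneg [simp]: "0 \<le> cross x y"
  unfolding cross_def using cross_radicand_nonneg by simp

lemma cross_sq: "(cross x y)\<^sup>2 = (norm x)\<^sup>2 * (norm y)\<^sup>2 - (cmod (cinner x y))\<^sup>2"
  unfolding cross_def using cross_radicand_nonneg by simp

lemma cross_le: "cross x y \<le> norm x * norm y"
  by (rule power2_le_imp_le) (simp_all add: cross_sq power_mult_distrib)

lemma cross_smult_left: "cross (c *s x) y = cmod c * cross x y"
proof -
  have "(cross (c *s x) y)\<^sup>2 = (cmod c * cross x y)\<^sup>2"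
    by (simp add: cross_sq norm_vector_smult cinner_smult_left norm_mult power_mult_distrib algebra_simps)
  then show ?thesis by (rule power2_eq_imp_eq) simp_all
qed

lemma cross_smult_right: "cross x (c *s y) = cmod c * cross x y"
proof -
  have "(cross x (c *s y))\<^sup>2 = (cmod c * cross x y)\<^sup>2"
    by (simp add: cross_sq norm_vector_smult cinner_smult_right norm_mult power_mult_distrib algebra_simps)
  then show ?thesis by (rule power2_eq_imp_eq) simp_all
qed

lemma norm_add_sq: "(norm (x + y))\<^sup>2 = (norm x)\<^sup>2 + (norm y)\<^sup>2 + 2 * Re (cinner x y)"
  for x y :: "complex ^ 'n"
  unfolding inner_eq_Re_cinner[symmetric] power2_norm_eq_inner
  by (simp add: inner_add_left inner_add_right inner_commute)

lemma cross_add_smult: "cross x (y + c *s x) = cross x y"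
proof -
  let ?b = "cinner x y" and ?X = "(norm x)\<^sup>2"
  have n: "(norm (y + c *s x))\<^sup>2 = (norm y)\<^sup>2 + (cmod c)\<^sup>2 * ?X + 2 * Re (c * cnj ?b)"
    by (simp only: norm_add_sq norm_vector_smult cinner_smult_right cinner_commute[of y x] power_mult_distrib)
  have b: "cinner x (y + c *s x) = ?b + c * of_real ?X"
    by (simp only: cinner_add_right cinner_smult_right cinner_self)
  have key: "(cmod (?b + c * of_real X))\<^sup>2 = (cmod ?b)\<^sup>2 + X * (X * (cmod c)\<^sup>2) + X * (2 * Re (c * cnj ?b))" for X
    unfolding cmod_power2 by (simp add: power2_eq_square algebra_simps)
  have "(cross x (y + c *s x))\<^sup>2 = (cross x y)\<^sup>2"
    unfolding cross_sq n b key by (simp add: algebra_simps)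
  then show ?thesis by (rule power2_eq_imp_eq) simp_all
qed

lemma continuous_on_cross [continuous_intros]:
  assumes "continuous_on S f" "continuous_on S g"
  shows "continuous_on S (\<lambda>s. cross (f s) (g s))"
  unfolding cross_def by (intro continuous_intros assms)

text \<open>Adding a multiple of \<open>x\<close> to \<open>y\<close> changes neither \<open>cross x y\<close> nor \<open>cross (w *v x) (w *v y)\<close>, and
  both are homogeneous in each argument, so Gram--Schmidt reduces a general pair to an orthonormal one
  that serves all \<open>w\<close> at once.\<close>

lemma cross_orthonormalize:
  fixes x y :: "complex ^ 'n"
  shows "(\<forall>w :: complex ^ 'n ^ 'n. cross (w *v x) (w *v y) = 0) \<or>
    (\<exists>x' y'. norm x' = 1 \<and> norm y' = 1 \<and> cinner x' y' = 0 \<and>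
       (\<forall>w :: complex ^ 'n ^ 'n. cross (w *v x) (w *v y) = cross x y * cross (w *v x') (w *v y')))"
proof (cases "x = 0")
  case True
  have "cross (0 :: complex ^ 'n) z = 0" for z
    using cross_smult_left[of 0 0 z] by simp
  then show ?thesis using True by simp
next
  case x: False
  define c where "c = cinner x y / of_real ((norm x)\<^sup>2)"
  define z where "z = y + (- c) *s x"
  have y: "y = z + c *s x"
    by (simp add: z_def vec_eq_iff)
  have red: "cross (w *v x) (w *v y) = cross (w *v x) (w *v z)" for w :: "complex ^ 'n ^ 'n"
  proof -
    have "w *v y = w *v z + c *s (w *v x)"
      by (simp only: y matrix_vector_right_distrib vector_scalar_commute)
    then show ?thesis by (simp only: cross_add_smult)
  qed
  show ?thesis
  proof (cases "z = 0")
    case True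
    have "cross u (0 :: complex ^ 'n) = 0" for u
      using cross_smult_right[of u 0 0] by simp
    then show ?thesis using True red by simp
  next
    case z: False
    let ?a = "complex_of_real (norm x)" and ?b = "complex_of_real (norm z)"
    define x' where "x' = inverse ?a *s x"
    define z' where "z' = inverse ?b *s z"
    have x': "x = ?a *s x'" and z': "z = ?b *s z'"
      using x z by (simp_all add: x'_def z'_def vector_smult_assoc)
    have n: "norm x' = 1" "norm z' = 1"
      using x z by (simp_all add: x'_def z'_def norm_vector_smult norm_inverse)
    have "cinner x z = 0"
      using x by (simp only: z_def cinner_add_right cinner_smult_right cinner_self) (simp add: c_def)
    then have o: "cinner x' z' = 0"
      by (simp add: x'_def z'_def cinner_smult_left cinner_smult_right)
    have sc: "cross (w *v x) (w *v y) = norm x * norm z * cross (w *v x') (w *v z')"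
      for w :: "complex ^ 'n ^ 'n"
      by (subst red, subst x', subst z')
         (simp only: vector_scalar_commute cross_smult_left cross_smult_right
            norm_of_real abs_norm_cancel mult_ac)
    have "cross x' z' = 1"
      by (simp add: cross_def n o)
    then have "cross x y = norm x * norm z"
      using sc[of "mat 1"] by simp
    then show ?thesis using sc n o
      by (intro disjI2 exI[of _ x'] exI[of _ z']) simp
  qed
qed

section \<open>Functions of quadratic growth\<close>

text \<open>The class in which all integrands live: it is stable under averaging over a matrix with
  integrable squared norm, and it contains the weight \<open>(norm z)\<^sup>2\<close> of the kernel.\<close>

definition quad_growth :: "('a::real_normed_vector \<Rightarrow> real) \<Rightarrow> bool" where
  "quad_growth \<Gamma> \<longleftrightarrow> continuous_on UNIV \<Gamma> \<and> (\<exists>C. \<forall>z. \<bar>\<Gamma> z\<bar> \<le> C * (norm z)\<^sup>2)"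

lemma quad_growthI:
  assumes "continuous_on UNIV \<Gamma>" "\<And>z. \<bar>\<Gamma> z\<bar> \<le> C * (norm z)\<^sup>2"
  shows "quad_growth \<Gamma>"
  using assms unfolding quad_growth_def by blast

lemma quad_growthE:
  assumes "quad_growth \<Gamma>"
  obtains C where "C \<ge> 0" "\<And>z. \<bar>\<Gamma> z\<bar> \<le> C * (norm z)\<^sup>2"
proof -
  obtain C where C: "\<And>z. \<bar>\<Gamma> z\<bar> \<le> C * (norm z)\<^sup>2" using assms unfolding quad_growth_def by blast
  have "\<bar>\<Gamma> z\<bar> \<le> max C 0 * (norm z)\<^sup>2" for z
    by (rule order_trans[OF C mult_right_mono]) auto
  then show ?thesis using that[of "max C 0"] by auto
qed

lemma quad_growth_continuous: "quad_growth \<Gamma> \<Longrightarrow> continuous_on UNIV \<Gamma>"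
  by (simp add: quad_growth_def)

lemma quad_growth_zero: "quad_growth \<Gamma> \<Longrightarrow> \<Gamma> 0 = 0"
  by (erule quad_growthE) (metis abs_le_zero_iff mult_zero_right norm_zero zero_eq_power2)

lemma quad_growth_add:
  assumes "quad_growth \<Gamma>" "quad_growth \<Delta>"
  shows "quad_growth (\<lambda>z. \<Gamma> z + \<Delta> z)"
proof -
  obtain C D where "\<And>z. \<bar>\<Gamma> z\<bar> \<le> C * (norm z)\<^sup>2" "\<And>z. \<bar>\<Delta> z\<bar> \<le> D * (norm z)\<^sup>2"
    using assms quad_growthE by metis
  then have "\<bar>\<Gamma> z + \<Delta> z\<bar> \<le> (C + D) * (norm z)\<^sup>2" for z
    by (simp add: distrib_right) (meson abs_triangle_ineq add_mono order_trans)
  then show ?thesis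
    by (rule quad_growthI[rotated]) (intro continuous_intros quad_growth_continuous assms)
qed

lemma quad_growth_cmult:
  assumes "quad_growth \<Gamma>"
  shows "quad_growth (\<lambda>z. c * \<Gamma> z)"
proof -
  obtain C where "\<And>z. \<bar>\<Gamma> z\<bar> \<le> C * (norm z)\<^sup>2" using assms quad_growthE by metis
  then have "\<bar>c * \<Gamma> z\<bar> \<le> (\<bar>c\<bar> * C) * (norm z)\<^sup>2" for z
    by (simp add: abs_mult mult.assoc mult_left_mono)
  then show ?thesis
    by (rule quad_growthI[rotated]) (intro continuous_intros quad_growth_continuous assms)
qed

lemma quad_growth_diff:
  assumes "quad_growth \<Gamma>" "quad_growth \<Delta>"
  shows "quad_growth (\<lambda>z. \<Gamma> z - \<Delta> z)"
  using quad_growth_add[OF assms(1) quad_growth_cmult[OF assms(2), of "- 1"]] by simp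

lemma quad_growth_sum:
  assumes "\<And>i. i \<in> I \<Longrightarrow> quad_growth (\<Gamma> i)"
  shows "quad_growth (\<lambda>z. \<Sum>i\<in>I. \<Gamma> i z)"
  using assms
proof (induction I rule: infinite_finite_induct)
  case (insert i I)
  then show ?case by (simp add: quad_growth_add)
qed (auto intro!: quad_growthI[where C = 0])

lemma quad_growth_norm_sq: "quad_growth (\<lambda>z :: 'a::real_normed_vector. (norm z)\<^sup>2)"
  by (rule quad_growthI[where C = 1]) (auto intro!: continuous_intros)

lemma quad_growth_compose:
  assumes \<Gamma>: "quad_growth \<Gamma>" and \<phi>: "continuous_on UNIV \<phi>" "\<And>z. norm (\<phi> z) \<le> K * norm z"
  shows "quad_growth (\<lambda>z. \<Gamma> (\<phi> z))"
proof -
  obtain C where C: "C \<ge> 0" "\<And>z. \<bar>\<Gamma> z\<bar> \<le> C * (norm z)\<^sup>2" using quad_growthE[OF \<Gamma>] by metis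
  show ?thesis
  proof (rule quad_growthI)
    show "continuous_on UNIV (\<lambda>z. \<Gamma> (\<phi> z))"
      by (rule continuous_on_compose2[OF quad_growth_continuous[OF \<Gamma>] \<phi>(1)]) simp
    show "\<bar>\<Gamma> (\<phi> z)\<bar> \<le> (C * K\<^sup>2) * (norm z)\<^sup>2" for z
    proof -
      have "(norm (\<phi> z))\<^sup>2 \<le> (K * norm z)\<^sup>2" by (intro power_mono \<phi>) simp
      then have "C * (norm (\<phi> z))\<^sup>2 \<le> (C * K\<^sup>2) * (norm z)\<^sup>2"
        using C(1) by (simp add: power_mult_distrib mult.assoc mult_left_mono)
      then show ?thesis using C(2)[of "\<phi> z"] by linarith
    qed
  qed
qed

text \<open>The quadratic bound already forces continuity at \<open>0\<close>, the one point where a function defined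
  through lines or through quotients may be irregular.\<close>

lemma quad_growthI_punctured:
  fixes \<Gamma> :: "'a::real_normed_vector \<Rightarrow> real"
  assumes cont: "continuous_on (- {0}) \<Gamma>" and bound: "\<And>z. \<bar>\<Gamma> z\<bar> \<le> C * (norm z)\<^sup>2"
  shows "quad_growth \<Gamma>"
proof (rule quad_growthI[OF _ bound])
  have "isCont \<Gamma> z" for z
  proof (cases "z = 0")
    case False
    moreover have "open (- {0 :: 'a})" by auto
    ultimately show ?thesis using cont
      by (simp add: continuous_on_eq_continuous_at[OF \<open>open (- {0})\<close>])
  next
    case True
    have "isCont (\<lambda>z. C * (norm z)\<^sup>2) (0 :: 'a)"
      by (intro continuous_intros)
    then have "((\<lambda>z. C * (norm z)\<^sup>2) \<longlongrightarrow> 0) (at (0 :: 'a))"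
      by (simp add: isCont_def)
    then have "(\<Gamma> \<longlongrightarrow> 0) (at 0)"
      by (rule Lim_null_comparison[rotated]) (auto simp: bound)
    moreover have "\<Gamma> 0 = 0" using bound[of 0] by simp
    ultimately show ?thesis using True by (simp add: isCont_def)
  qed
  then show "continuous_on UNIV \<Gamma>" by (simp add: continuous_at_imp_continuous_on)
qed

section \<open>Functions on projective space\<close>

lemma proj_smult: "c \<noteq> 0 \<Longrightarrow> proj (c *s x) = proj x"
  using proj_eq_iff[of x "c *s x"] by (cases "x = 0") auto

lemma unit_rep_nonzero [simp]: "unit_rep p \<noteq> 0"
  using unit_rep(1)[of p] by force

lemma normalize_unit: "x \<noteq> 0 \<Longrightarrow> norm (complex_of_real (1 / norm x) *s x) = 1"
  by (simp add: norm_vector_smult norm_divide)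

lemma norm_smult_unit_rep:
  assumes "z \<noteq> 0"
  obtains c where "z = c *s unit_rep (proj z)" "cmod c = norm z"
proof -
  have "proj (unit_rep (proj z)) = proj z" by (simp add: unit_rep)
  then obtain c where c: "z = c *s unit_rep (proj z)"
    using proj_eq_iff[OF unit_rep_nonzero assms] by blast
  have "cmod c = norm z"
    using arg_cong[OF c, of norm] by (simp add: norm_vector_smult unit_rep)
  with c show ?thesis by (rule that)
qed

lemma dist_proj_mult:
  assumes "x \<noteq> 0" "y \<noteq> 0"
  shows "dist (proj x) (proj y) * (norm x * norm y) = cross x y"
proof -
  let ?a = "complex_of_real (1 / norm x)" and ?b = "complex_of_real (1 / norm y)"
  have nx: "norm (?a *s x) = 1" and ny: "norm (?b *s y) = 1"
    by (rule normalize_unit[OF assms(1)], rule normalize_unit[OF assms(2)])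
  have "?a \<noteq> 0" "?b \<noteq> 0" using assms by auto
  then have "dist (proj x) (proj y) = dist (proj (?a *s x)) (proj (?b *s y))"
    using proj_smult by metis
  also have "\<dots> = cross (?a *s x) (?b *s y)"
    by (simp only: dist_proj[OF nx ny] cross_def nx ny) simp
  also have "\<dots> = cross x y / (norm x * norm y)"
    by (simp only: cross_smult_left cross_smult_right norm_of_real) simp
  finally show ?thesis using assms by simp
qed

lemma continuous_on_proj: "continuous_on (- {0}) (proj :: complex ^ 'n \<Rightarrow> 'n cproj)"
proof -
  have "(proj \<longlongrightarrow> proj x) (at x within - {0})" if x: "x \<noteq> 0" for x :: "complex ^ 'n"
  proof -
    have "((\<lambda>y. cross y x / (norm y * norm x)) \<longlongrightarrow> cross x x / (norm x * norm x)) (at x within - {0})"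
    proof -
      have "continuous_on (- {0}) (\<lambda>y. cross y x / (norm y * norm x))"
        by (intro continuous_intros) (use x in auto)
      then show ?thesis using x by (simp add: continuous_on_def)
    qed
    moreover have "cross x x = 0"
      by (simp add: cross_def cinner_self power2_eq_square norm_mult)
    ultimately have l: "((\<lambda>y. cross y x / (norm y * norm x)) \<longlongrightarrow> 0) (at x within - {0})"
      by simp
    have "eventually (\<lambda>y. cross y x / (norm y * norm x) = dist (proj y) (proj x)) (at x within - {0})"
      using dist_proj_mult[OF _ x] x by (auto simp: eventually_at_filter field_simps intro!: always_eventually)
    then have "((\<lambda>y. dist (proj y) (proj x)) \<longlongrightarrow> 0) (at x within - {0})"
      by (rule Lim_transform_eventually[OF l])
    then show ?thesis by (rule tendsto_dist_iff[THEN iffD2])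
  qed
  then show ?thesis by (auto simp: continuous_on_def)
qed

lemma compact_cproj: "compact (UNIV :: ('n :: finite) cproj set)"
proof -
  have "UNIV = proj ` sphere (0 :: complex ^ 'n) 1"
  proof -
    have "p \<in> proj ` sphere (0 :: complex ^ 'n) 1" for p
      by (rule image_eqI[of _ _ "unit_rep p"]) (simp_all add: unit_rep)
    then show ?thesis by blast
  qed
  moreover have "compact (proj ` sphere (0 :: complex ^ 'n) 1)"
    by (intro compact_continuous_image continuous_on_subset[OF continuous_on_proj]) auto
  ultimately show ?thesis by simp
qed

text \<open>The section \<open>unit_rep\<close> need not be continuous, but a convergent sequence of lines has
  convergent representatives once their phases are aligned with the limit.\<close>

lemma unit_rep_tendsto_phase:
  assumes "q \<longlonglongrightarrow> p"
  obtains c where "\<And>k. cmod (c k) = 1" "(\<lambda>k. c k *s unit_rep (q k)) \<longlonglongrightarrow> unit_rep p"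
proof -
  define b where "b k = cinner (unit_rep p) (unit_rep (q k))" for k
  \<comment> \<open>The phase that makes the product with the limit vector real and nonnegative.\<close>
  define c where "c k = (if b k = 0 then 1 else cnj (b k) / of_real (cmod (b k)))" for k
  have c1: "cmod (c k) = 1" for k by (simp add: c_def norm_divide)
  have cb: "c k * b k = of_real (cmod (b k))" for k
    by (simp add: c_def complex_norm_square[symmetric] power2_eq_square mult.commute)
  have bound: "(norm (c k *s unit_rep (q k) - unit_rep p))\<^sup>2 \<le> 2 * (dist (q k) p)\<^sup>2" for k
  proof -
    let ?y = "c k *s unit_rep (q k)"
    have ny: "norm ?y = 1" by (simp add: norm_vector_smult c1 unit_rep)
    have b1: "cmod (b k) \<le> 1"
      unfolding b_def using cinner_Cauchy_Schwarz[of "unit_rep p" "unit_rep (q k)"] by (simp add: unit_rep)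
    have "inner ?y (unit_rep p) = cmod (b k)"
      by (subst inner_commute) (simp add: inner_eq_Re_cinner cinner_smult_right cb flip: b_def)
    moreover have "(norm (?y - unit_rep p))\<^sup>2 = (norm ?y)\<^sup>2 + (norm (unit_rep p))\<^sup>2 - 2 * inner ?y (unit_rep p)"
      by (simp add: power2_norm_eq_inner inner_diff_left inner_diff_right inner_commute)
    ultimately have "(norm (?y - unit_rep p))\<^sup>2 = 2 - 2 * cmod (b k)"
      by (simp add: ny unit_rep)
    also have "\<dots> \<le> 2 * (1 - (cmod (b k))\<^sup>2)"
      using b1 mult_left_le[of "cmod (b k)" "cmod (b k)"] by (simp add: power2_eq_square)
    also have "1 - (cmod (b k))\<^sup>2 = (dist (q k) p)\<^sup>2"
    proof -
      have "(cmod (b k))\<^sup>2 \<le> 1" using b1 by (simp add: power_le_one)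
      then show ?thesis by (subst dist_commute) (simp add: dist_cproj_def b_def[symmetric])
    qed
    finally show ?thesis .
  qed
  have "(\<lambda>k. dist (q k) p) \<longlonglongrightarrow> 0"
    using assms by (rule tendsto_dist_iff[THEN iffD1])
  then have "(\<lambda>k. 2 * (dist (q k) p)\<^sup>2) \<longlonglongrightarrow> 2 * 0\<^sup>2"
    by (intro tendsto_mult tendsto_power tendsto_const)
  then have "(\<lambda>k. sqrt (2 * (dist (q k) p)\<^sup>2)) \<longlonglongrightarrow> sqrt (2 * 0\<^sup>2)"
    by (rule tendsto_real_sqrt)
  then have lim: "(\<lambda>k. sqrt (2 * (dist (q k) p)\<^sup>2)) \<longlonglongrightarrow> 0"
    by simp
  have "norm (c k *s unit_rep (q k) - unit_rep p) \<le> sqrt (2 * (dist (q k) p)\<^sup>2)" for k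
    using bound by (rule real_le_rsqrt)
  then have "(\<lambda>k. c k *s unit_rep (q k) - unit_rep p) \<longlonglongrightarrow> 0"
    by (intro Lim_null_comparison[OF _ lim] always_eventually) simp
  then have "(\<lambda>k. c k *s unit_rep (q k)) \<longlonglongrightarrow> unit_rep p"
    by (rule LIM_zero_cancel)
  with c1 that show ?thesis by blast
qed

text \<open>A function that ignores phases does not notice that the chosen representatives jump.\<close>

lemma continuous_on_unit_rep:
  fixes K :: "'a::metric_space \<Rightarrow> complex ^ 'n \<Rightarrow> 'b::topological_space"
  assumes cont: "continuous_on UNIV (\<lambda>(a, x). K a x)"
    and phase: "\<And>a c x. cmod c = 1 \<Longrightarrow> K a (c *s x) = K a x"
  shows "continuous_on UNIV (\<lambda>(a, p). K a (unit_rep p))"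
  unfolding continuous_on_sequentially
proof (intro allI ballI impI, elim conjE)
  fix s :: "nat \<Rightarrow> 'a \<times> 'n cproj" and l
  assume s: "s \<longlonglongrightarrow> l"
  obtain a p where l: "l = (a, p)" by force
  have "(\<lambda>k. snd (s k)) \<longlonglongrightarrow> p" and a: "(\<lambda>k. fst (s k)) \<longlonglongrightarrow> a"
    using tendsto_snd[OF s] tendsto_fst[OF s] by (simp_all add: l)
  then obtain c where c: "\<And>k. cmod (c k) = 1"
    and lim: "(\<lambda>k. c k *s unit_rep (snd (s k))) \<longlonglongrightarrow> unit_rep p"
    using unit_rep_tendsto_phase by metis
  have "(\<lambda>k. (fst (s k), c k *s unit_rep (snd (s k)))) \<longlonglongrightarrow> (a, unit_rep p)"
    by (intro tendsto_Pair a lim)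
  then have "(\<lambda>k. (\<lambda>(a, x). K a x) (fst (s k), c k *s unit_rep (snd (s k)))) \<longlonglongrightarrow> (\<lambda>(a, x). K a x) (a, unit_rep p)"
    using cont unfolding continuous_on_sequentially comp_def by blast
  then show "((\<lambda>(a, p). K a (unit_rep p)) \<circ> s) \<longlonglongrightarrow> (\<lambda>(a, p). K a (unit_rep p)) l"
    by (simp add: phase c l comp_def case_prod_beta)
qed

text \<open>The map \<open>p \<mapsto> outer (unit_rep p)\<close> embeds projective space isometrically, up to the factor
  \<open>sqrt 2\<close>, into the matrices, from which it inherits a countable basis. With it, Borel sets of a
  product with projective space are generated by rectangles.\<close>

instance cproj :: (finite) second_countable_topology
proof
  let ?e = "\<lambda>p :: 'a cproj. outer (unit_rep p)"
  have d: "dist p q = dist (?e p) (?e q) / sqrt 2" for p q :: "'a cproj"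
    unfolding dist_cproj_def dist_norm by (rule sqrt_eq_norm_outer) (rule unit_rep)+
  have "continuous_on UNIV ?e"
  proof (rule continuous_onI)
    fix p :: "'a cproj" and e :: real assume "e > 0"
    then show "\<exists>d>0. \<forall>q\<in>UNIV. dist q p < d \<longrightarrow> dist (?e q) (?e p) \<le> e"
      by (intro exI[of _ "e / sqrt 2"]) (simp add: d divide_simps)
  qed
  then have cont: "open (?e -` V)" if "open V" for V
    using that by (simp add: continuous_on_open_vimage)
  obtain B :: "(complex ^ 'a ^ 'a) set set" where B: "countable B" "topological_basis B"
    using ex_countable_basis by blast
  have "topological_basis ((\<lambda>b. ?e -` b) ` B)"
  proof (rule topological_basisI)
    fix U :: "'a cproj set" assume "U \<in> (\<lambda>b. ?e -` b) ` B"
    then show "open U" using cont topological_basis_open[OF B(2)] by blast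
  next
    fix U :: "'a cproj set" and p assume "open U" "p \<in> U"
    then obtain r where r: "r > 0" "\<And>q. dist q p < r \<Longrightarrow> q \<in> U"
      by (auto simp: open_dist)
    obtain b where b: "b \<in> B" "?e p \<in> b" "b \<subseteq> ball (?e p) (r * sqrt 2)"
    proof (rule topological_basisE[OF B(2) open_ball[of "?e p" "r * sqrt 2"]])
      show "?e p \<in> ball (?e p) (r * sqrt 2)" using r(1) by simp
    qed
    have "?e -` b \<subseteq> U"
    proof
      fix q assume "q \<in> ?e -` b"
      then have "dist (?e q) (?e p) < r * sqrt 2" using b(3) by (auto simp: dist_commute)
      then show "q \<in> U" by (intro r(2)) (simp add: d divide_simps)
    qed
    then show "\<exists>b'\<in>(\<lambda>b. ?e -` b) ` B. p \<in> b' \<and> b' \<subseteq> U"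
      using b(1,2) by blast
  qed
  then show "\<exists>B :: 'a cproj set set. countable B \<and> open = generate_topology B"
    using B(1) topological_basis_imp_subbasis by blast
qed

text \<open>The \<open>2\<close>-homogeneous extension of \<open>f\<close> to the cone over projective space. It turns
  the weight \<open>(norm (v *v x))\<^sup>2\<close> of the kernel into part of the function, so that the kernel
  becomes plain integration of \<open>hom2 f (v *v x)\<close>.\<close>

definition hom2 :: "('n cproj \<Rightarrow> real) \<Rightarrow> complex ^ ('n :: finite) \<Rightarrow> real" where
  "hom2 f z = (norm z)\<^sup>2 * f (proj z)"

lemma hom2_smult: "hom2 f (c *s z) = (cmod c)\<^sup>2 * hom2 f z"
  by (cases "c = 0") (simp_all add: hom2_def norm_vector_smult proj_smult power_mult_distrib)

lemma hom2_unit_rep [simp]: "hom2 f (unit_rep p) = f p"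
  by (simp add: hom2_def unit_rep)

lemma continuous_bounded_cproj:
  fixes f :: "('n :: finite) cproj \<Rightarrow> real"
  assumes "continuous_on UNIV f"
  obtains C where "C > 0" "\<And>p. \<bar>f p\<bar> \<le> C"
proof -
  have "bounded (range f)"
    using compact_continuous_image[OF assms compact_cproj] by (rule compact_imp_bounded)
  then show ?thesis using that by (auto simp: bounded_pos)
qed

lemma integrable_continuous_cproj:
  fixes g :: "('n :: finite) cproj \<Rightarrow> real"
  assumes \<nu>: "borel_prob \<nu>" and g: "continuous_on UNIV g"
  shows "integrable \<nu> g"
proof -
  interpret prob_space \<nu> using \<nu> by (simp add: borel_prob_def)
  obtain B where "\<And>p. \<bar>g p\<bar> \<le> B" using continuous_bounded_cproj[OF g] by blast
  moreover have "g \<in> borel_measurable \<nu>"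
    using borel_measurable_continuous_onI[OF g] \<nu> by (simp add: borel_prob_def cong: measurable_cong_sets)
  ultimately show ?thesis by (intro integrable_const_bound[where B = B]) auto
qed

lemma hom2_bound: "(\<And>p. \<bar>f p\<bar> \<le> C) \<Longrightarrow> \<bar>hom2 f z\<bar> \<le> C * (norm z)\<^sup>2"
  using mult_right_mono[of "\<bar>f (proj z)\<bar>" C "(norm z)\<^sup>2"] by (simp add: hom2_def abs_mult mult.commute)

lemma quad_growth_hom2:
  assumes f: "continuous_on UNIV f"
  shows "quad_growth (hom2 f)"
proof -
  obtain C where C: "C > 0" "\<And>p. \<bar>f p\<bar> \<le> C"
    using continuous_bounded_cproj[OF f] by blast
  show ?thesis
  proof (rule quad_growthI_punctured)
    show "continuous_on (- {0}) (hom2 f)"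
      unfolding hom2_def
      by (intro continuous_intros continuous_on_compose2[OF f continuous_on_proj]) auto
  qed (rule hom2_bound[OF C(2)])
qed

lemmas continuous_on_hom2 = quad_growth_hom2[THEN quad_growth_continuous]

section \<open>The transfer operator\<close>

lemma bounded_linear_matrix_vector_mult_complex:
  fixes v :: "complex ^ 'n ^ 'm"
  shows "bounded_linear ((*v) v)"
proof (rule bounded_linear_intro[where K = "norm v"])
  show "v *v (r *\<^sub>R x) = r *\<^sub>R (v *v x)" for r x
    by (simp add: matrix_vector_mult_def vec_eq_iff scaleR_sum_right)
  show "norm (v *v x) \<le> norm x * norm v" for x
    using norm_matrix_vector_mult_le[of v x] by (simp add: mult.commute)
qed (simp add: matrix_vector_right_distrib)

text \<open>Integrability is assumed for the operator norm, while the estimates below use the Euclidean norm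
  of the matrix entries.\<close>

lemma norm_le_opnorm:
  fixes v :: "complex ^ 'n ^ 'n"
  shows "norm v \<le> of_nat (CARD('n) * CARD('n)) * opnorm v"
proof -
  have "norm (v $ i $ j) \<le> opnorm v" for i j
  proof -
    have "norm ((v *v axis j 1) $ i) \<le> norm (v *v axis j 1)" by (rule Finite_Cartesian_Product.norm_nth_le)
    also have "\<dots> \<le> opnorm v * norm (axis j (1 :: complex) :: complex ^ 'n)"
      by (rule onorm[OF bounded_linear_matrix_vector_mult_complex])
    finally show ?thesis by (simp add: matrix_vector_mult_axis)
  qed
  then have "(\<Sum>i\<in>UNIV. \<Sum>j\<in>UNIV. norm (v $ i $ j)) \<le> (\<Sum>i\<in>(UNIV::'n set). \<Sum>j\<in>(UNIV::'n set). opnorm v)"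
    by (intro sum_mono)
  moreover have "norm v \<le> (\<Sum>i\<in>UNIV. \<Sum>j\<in>UNIV. norm (v $ i $ j))"
  proof -
    have "norm v \<le> (\<Sum>i\<in>UNIV. norm (v $ i))" unfolding norm_vec_def[of v] by (rule L2_set_le_sum) simp
    also have "\<dots> \<le> (\<Sum>i\<in>UNIV. \<Sum>j\<in>UNIV. norm (v $ i $ j))"
      unfolding norm_vec_def[of "v $ _"] by (intro sum_mono L2_set_le_sum) simp
    finally show ?thesis .
  qed
  ultimately show ?thesis by simp
qed

lemma cinner_cadjoint: "cinner x (cadjoint A *v y) = cinner (A *v x) y"
proof -
  have "cinner x (cadjoint A *v y) = (\<Sum>i\<in>UNIV. \<Sum>j\<in>UNIV. cnj (x $ i) * (cnj (A $ j $ i) * y $ j))"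
    by (simp add: cinner_def cadjoint_def matrix_vector_mult_def transpose_def sum_distrib_left)
  also have "\<dots> = (\<Sum>j\<in>UNIV. \<Sum>i\<in>UNIV. cnj (x $ i) * (cnj (A $ j $ i) * y $ j))"
    by (rule sum.swap)
  also have "\<dots> = cinner (A *v x) y"
    by (simp add: cinner_def matrix_vector_mult_def sum_distrib_left sum_distrib_right mult_ac)
  finally show ?thesis .
qed

lemma norm_cadjoint: "norm (cadjoint v) = norm (v :: complex ^ 'n ^ 'n)"
proof -
  have n: "(norm w)\<^sup>2 = (\<Sum>i\<in>UNIV. \<Sum>j\<in>UNIV. (cmod (w $ i $ j))\<^sup>2)" for w :: "complex ^ 'n ^ 'n"
    by (simp add: norm_vec_def L2_set_def sum_nonneg)
  have "(norm (cadjoint v))\<^sup>2 = (norm v)\<^sup>2"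
    unfolding n by (subst sum.swap) (simp add: cadjoint_def transpose_def)
  then show ?thesis by (rule power2_eq_imp_eq) simp_all
qed

lemma continuous_on_cadjoint [continuous_intros]:
  assumes "continuous_on S f"
  shows "continuous_on S (\<lambda>s. cadjoint (f s :: complex ^ 'n ^ 'n))"
  unfolding cadjoint_def map_matrix_def transpose_def by (simp, intro continuous_intros assms)

text \<open>One notion of action covers single vectors, pairs of vectors, and matrices acted on by
  multiplication from the left.\<close>

definition matrix_action :: "(complex ^ 'n ^ 'n \<Rightarrow> 'a \<Rightarrow> 'a::real_normed_vector) \<Rightarrow> bool" where
  "matrix_action a \<longleftrightarrow> continuous_on UNIV (\<lambda>(v, z). a v z) \<and> (\<forall>v z. norm (a v z) \<le> norm v * norm z)"

lemma matrix_action_continuous: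
  assumes "matrix_action a" "continuous_on S f" "continuous_on S g"
  shows "continuous_on S (\<lambda>s. a (f s) (g s))"
proof -
  have "continuous_on S ((\<lambda>(v, z). a v z) \<circ> (\<lambda>s. (f s, g s)))"
    using assms(1) unfolding matrix_action_def
    by (intro continuous_on_compose continuous_intros assms(2,3)) (auto elim: continuous_on_subset)
  then show ?thesis by (simp add: comp_def)
qed

lemma matrix_action_norm: "matrix_action a \<Longrightarrow> norm (a v z) \<le> norm v * norm z"
  by (simp add: matrix_action_def)

lemma quad_growth_matrix_vec:
  fixes G :: "complex ^ 'n \<Rightarrow> real"
  assumes "quad_growth G"
  shows "quad_growth (\<lambda>w :: complex ^ 'n ^ 'n. G (w *v x))"
proof (rule quad_growth_compose[OF assms])
  show "norm (w *v x) \<le> norm x * norm w" for w :: "complex ^ 'n ^ 'n"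
    using norm_matrix_vector_mult_le[of w x] by (simp add: mult.commute)
qed (intro continuous_intros)

lemma quad_growth_matrix_pair:
  fixes G :: "(complex ^ 'n) \<times> (complex ^ 'n) \<Rightarrow> real"
  assumes "quad_growth G"
  shows "quad_growth (\<lambda>w :: complex ^ 'n ^ 'n. G (w *v x, w *v y))"
proof (rule quad_growth_compose[OF assms])
  show "norm (w *v x, w *v y) \<le> (norm x + norm y) * norm w" for w :: "complex ^ 'n ^ 'n"
    using norm_Pair_le[of "w *v x" "w *v y"] norm_matrix_vector_mult_le[of w x] norm_matrix_vector_mult_le[of w y]
    by (simp add: algebra_simps)
qed (intro continuous_intros)

definition act_pair :: "complex ^ 'n ^ 'n \<Rightarrow> (complex ^ 'n) \<times> (complex ^ 'n) \<Rightarrow> (complex ^ 'n) \<times> (complex ^ 'n)" where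
  "act_pair v z = (v *v fst z, v *v snd z)"

lemma matrix_action_vec: "matrix_action ((*v) :: complex ^ 'n ^ 'n \<Rightarrow> _)"
  unfolding matrix_action_def case_prod_beta
  by (auto intro!: continuous_intros norm_matrix_vector_mult_le)

lemma matrix_action_matrix: "matrix_action ((**) :: complex ^ 'n ^ 'n \<Rightarrow> complex ^ 'n ^ 'n \<Rightarrow> _)"
  unfolding matrix_action_def case_prod_beta
  by (auto intro!: continuous_intros norm_matrix_matrix_mult_le)

lemma matrix_action_pair: "matrix_action (act_pair :: complex ^ 'n ^ 'n \<Rightarrow> _)"
  unfolding matrix_action_def case_prod_beta act_pair_def
proof (intro conjI allI)
  fix v :: "complex ^ 'n ^ 'n" and z :: "(complex ^ 'n) \<times> (complex ^ 'n)"
  have "(norm (v *v fst z))\<^sup>2 + (norm (v *v snd z))\<^sup>2 \<le> (norm v * norm (fst z))\<^sup>2 + (norm v * norm (snd z))\<^sup>2"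
    by (intro add_mono power_mono norm_matrix_vector_mult_le) auto
  also have "\<dots> = (norm v * norm z)\<^sup>2"
    by (simp add: norm_prod_def power_mult_distrib distrib_left)
  finally show "norm (v *v fst z, v *v snd z) \<le> norm v * norm z"
    by (simp add: norm_Pair real_le_lsqrt)
qed (intro continuous_intros)

locale kraus_measure =
  fixes \<mu> :: "(complex ^ 'n ^ 'n) measure"
  assumes sets_mu [simp, measurable_cong]: "sets \<mu> = sets borel"
    and int_opnorm: "integrable \<mu> (\<lambda>v. (opnorm v)\<^sup>2)"
    and unital: "(\<integral>v. cadjoint v ** v \<partial>\<mu>) = mat 1"
begin

lemma measurable_mu_continuous:
  fixes f :: "complex ^ 'n ^ 'n \<Rightarrow> 'b::topological_space"
  assumes "continuous_on UNIV f"
  shows "f \<in> borel_measurable \<mu>"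
  using borel_measurable_continuous_onI[OF assms] by simp

lemma integrable_norm_sq: "integrable \<mu> (\<lambda>v. (norm v)\<^sup>2)"
proof (rule Bochner_Integration.integrable_bound)
  let ?K = "real (CARD('n) * CARD('n))"
  show "integrable \<mu> (\<lambda>v. ?K\<^sup>2 * (opnorm v)\<^sup>2)" using int_opnorm by simp
  have "(norm v)\<^sup>2 \<le> ?K\<^sup>2 * (opnorm v)\<^sup>2" for v :: "complex ^ 'n ^ 'n"
    using power_mono[OF norm_le_opnorm[of v], of 2] by (simp add: power_mult_distrib)
  then show "AE v in \<mu>. norm ((norm v)\<^sup>2) \<le> norm (?K\<^sup>2 * (opnorm v)\<^sup>2)"
    by (intro AE_I2) auto
qed (intro measurable_mu_continuous continuous_intros)

text \<open>The normalisation \<open>\<integral> v\<^sup>* v d\<mu> = 1\<close>, tested against \<open>z\<close>. It makes the transfer operator below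
  preserve the squared norm, hence the kernel a probability kernel.\<close>

lemma integral_norm_sq: "(\<integral>v. (norm (v *v z))\<^sup>2 \<partial>\<mu>) = (norm z)\<^sup>2"
proof -
  define L where "L A = Re (cinner z (A *v z))" for A :: "complex ^ 'n ^ 'n"
  have L: "bounded_linear L"
  proof (rule bounded_linear_intro[where K = "norm z * norm z"])
    fix A B :: "complex ^ 'n ^ 'n" and r :: real
    show "L (A + B) = L A + L B"
      by (simp add: L_def matrix_vector_mult_add_rdistrib cinner_add_right)
    have "(r *\<^sub>R A) *v z = complex_of_real r *s (A *v z)"
      by (simp add: matrix_vector_mult_def vec_eq_iff sum_distrib_left scaleR_conv_of_real[where 'a = complex] mult.assoc)
    then show "L (r *\<^sub>R A) = r *\<^sub>R L A"
      by (simp add: L_def cinner_smult_right)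
    have "norm (L A) \<le> norm z * norm (A *v z)"
      unfolding L_def by (simp add: abs_Re_le_cmod[THEN order_trans] cinner_Cauchy_Schwarz)
    also have "\<dots> \<le> norm z * (norm A * norm z)"
      by (intro mult_left_mono norm_matrix_vector_mult_le) simp
    finally show "norm (L A) \<le> norm A * (norm z * norm z)" by (simp add: mult_ac)
  qed
  have "integrable \<mu> (\<lambda>v. cadjoint v ** v)"
  proof (rule Bochner_Integration.integrable_bound[OF integrable_norm_sq])
    show "AE v in \<mu>. norm (cadjoint v ** v) \<le> norm ((norm v)\<^sup>2)"
      using norm_matrix_matrix_mult_le[of "cadjoint _" "_"] by (intro AE_I2) (simp add: norm_cadjoint power2_eq_square)
  qed (intro measurable_mu_continuous continuous_intros)
  then have "(\<integral>v. L (cadjoint v ** v) \<partial>\<mu>) = L (mat 1)"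
    using integral_bounded_linear[OF L] unital by metis
  moreover have "L (cadjoint v ** v) = (norm (v *v z))\<^sup>2" for v
    unfolding L_def matrix_vector_mul_assoc[symmetric] cinner_cadjoint cinner_self by simp
  moreover have "L (mat 1) = (norm z)\<^sup>2"
    unfolding L_def matrix_vector_mul_lid cinner_self by simp
  ultimately show ?thesis by simp
qed

text \<open>Iterated \<open>n\<close> times, this is integration over products of \<open>n\<close> matrices. On functions of the form
  \<open>hom2 f\<close>, a single step is the transition kernel of the quantum trajectory.\<close>

definition transfer :: "(complex ^ 'n ^ 'n \<Rightarrow> 'a \<Rightarrow> 'a) \<Rightarrow> ('a \<Rightarrow> real) \<Rightarrow> 'a \<Rightarrow> real" where
  "transfer a \<Gamma> z = (\<integral>v. \<Gamma> (a v z) \<partial>\<mu>)"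

lemma measurable_action:
  assumes "matrix_action a" "quad_growth \<Gamma>"
  shows "(\<lambda>v. \<Gamma> (a v z)) \<in> borel_measurable \<mu>"
  by (intro measurable_mu_continuous continuous_on_compose2[OF quad_growth_continuous[OF assms(2)]]
      matrix_action_continuous[OF assms(1)] continuous_intros) simp

lemma action_bound:
  fixes a :: "complex ^ 'n ^ 'n \<Rightarrow> 'a \<Rightarrow> 'a::real_normed_vector"
  assumes "matrix_action a" "C \<ge> 0" "\<And>z. \<bar>\<Gamma> z\<bar> \<le> C * (norm z)\<^sup>2"
  shows "\<bar>\<Gamma> (a v z)\<bar> \<le> C * (norm z)\<^sup>2 * (norm v)\<^sup>2"
proof -
  have "\<bar>\<Gamma> (a v z)\<bar> \<le> C * (norm (a v z))\<^sup>2" by (rule assms)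
  also have "\<dots> \<le> C * (norm v * norm z)\<^sup>2"
    by (intro mult_left_mono power_mono matrix_action_norm assms) simp
  finally show ?thesis by (simp add: power_mult_distrib mult_ac)
qed

lemma integrable_action:
  assumes "matrix_action a" "quad_growth \<Gamma>"
  shows "integrable \<mu> (\<lambda>v. \<Gamma> (a v z))"
proof -
  obtain C where C: "C \<ge> 0" "\<And>z. \<bar>\<Gamma> z\<bar> \<le> C * (norm z)\<^sup>2" using quad_growthE[OF assms(2)] by metis
  show ?thesis
  proof (rule Bochner_Integration.integrable_bound)
    show "integrable \<mu> (\<lambda>v. C * (norm z)\<^sup>2 * (norm v)\<^sup>2)" using integrable_norm_sq by simp
    show "AE v in \<mu>. norm (\<Gamma> (a v z)) \<le> norm (C * (norm z)\<^sup>2 * (norm v)\<^sup>2)"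
      using action_bound[OF assms(1) C] C(1) by (intro AE_I2) simp
  qed (rule measurable_action[OF assms])
qed

text \<open>Continuity passes to the average by dominated convergence: along a convergent, hence bounded,
  sequence of arguments the integrands are dominated by a multiple of \<open>(norm v)\<^sup>2\<close>.\<close>

lemma quad_growth_transfer:
  fixes a :: "complex ^ 'n ^ 'n \<Rightarrow> 'a \<Rightarrow> 'a::real_normed_vector"
  assumes "matrix_action a" "quad_growth \<Gamma>"
  shows "quad_growth (transfer a \<Gamma>)"
proof -
  obtain C where C: "C \<ge> 0" "\<And>z. \<bar>\<Gamma> z\<bar> \<le> C * (norm z)\<^sup>2" using quad_growthE[OF assms(2)] by blast
  note bound = action_bound[where \<Gamma> = \<Gamma>, OF assms(1) C]
  show ?thesis
  proof (rule quad_growthI)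
    show "continuous_on UNIV (transfer a \<Gamma>)"
      unfolding continuous_on_sequentially
    proof (intro allI ballI impI, elim conjE)
      fix s :: "nat \<Rightarrow> 'a" and z assume s: "s \<longlonglongrightarrow> z"
      then obtain B where B: "\<And>k. norm (s k) \<le> B"
        using Bseq_def[of s] convergent_imp_Bseq convergent_def by metis
      have "B \<ge> 0" using B[of 0] norm_ge_zero order_trans by blast
      have "(\<lambda>k. \<integral>v. \<Gamma> (a v (s k)) \<partial>\<mu>) \<longlonglongrightarrow> (\<integral>v. \<Gamma> (a v z) \<partial>\<mu>)"
      proof (rule integral_dominated_convergence[where w = "\<lambda>v. C * B\<^sup>2 * (norm v)\<^sup>2"])
        show "integrable \<mu> (\<lambda>v. C * B\<^sup>2 * (norm v)\<^sup>2)" using integrable_norm_sq by simp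
        show "AE v in \<mu>. norm (\<Gamma> (a v (s k))) \<le> C * B\<^sup>2 * (norm v)\<^sup>2" for k
        proof (intro AE_I2)
          fix v :: "complex ^ 'n ^ 'n"
          have "(norm (s k))\<^sup>2 \<le> B\<^sup>2" using B by (intro power_mono) auto
          then have "C * (norm (s k))\<^sup>2 * (norm v)\<^sup>2 \<le> C * B\<^sup>2 * (norm v)\<^sup>2"
            using C(1) by (intro mult_right_mono mult_left_mono) auto
          with bound[of v "s k"] show "norm (\<Gamma> (a v (s k))) \<le> C * B\<^sup>2 * (norm v)\<^sup>2" by simp
        qed
        show "AE v in \<mu>. (\<lambda>k. \<Gamma> (a v (s k))) \<longlonglongrightarrow> \<Gamma> (a v z)"
        proof (intro AE_I2)
          fix v :: "complex ^ 'n ^ 'n"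
          have "continuous_on UNIV (\<lambda>z. \<Gamma> (a v z))"
            by (intro continuous_on_compose2[OF quad_growth_continuous[OF assms(2)]]
                matrix_action_continuous[OF assms(1)] continuous_intros) simp
          with s show "(\<lambda>k. \<Gamma> (a v (s k))) \<longlonglongrightarrow> \<Gamma> (a v z)"
            unfolding continuous_on_sequentially comp_def by blast
        qed
      qed (rule measurable_action[OF assms])+
      then show "(transfer a \<Gamma> \<circ> s) \<longlonglongrightarrow> transfer a \<Gamma> z"
        by (simp add: comp_def transfer_def)
    qed
    show "\<bar>transfer a \<Gamma> z\<bar> \<le> (C * (\<integral>v. (norm v)\<^sup>2 \<partial>\<mu>)) * (norm z)\<^sup>2" for z
    proof -
      have "\<bar>transfer a \<Gamma> z\<bar> \<le> (\<integral>v. \<bar>\<Gamma> (a v z)\<bar> \<partial>\<mu>)"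
        unfolding transfer_def by (rule integral_abs_bound)
      also have "\<dots> \<le> (\<integral>v. C * (norm z)\<^sup>2 * (norm v)\<^sup>2 \<partial>\<mu>)"
      proof (rule integral_mono)
        show "integrable \<mu> (\<lambda>v. \<bar>\<Gamma> (a v z)\<bar>)"
          by (intro integrable_abs integrable_action assms)
        show "integrable \<mu> (\<lambda>v. C * (norm z)\<^sup>2 * (norm v)\<^sup>2)"
          using integrable_norm_sq by simp
      qed (rule bound)
      finally show ?thesis by (simp add: mult_ac)
    qed
  qed
qed

lemma quad_growth_transfer_pow:
  assumes "matrix_action a" "quad_growth \<Gamma>"
  shows "quad_growth ((transfer a ^^ n) \<Gamma>)"
  by (induction n) (simp_all add: assms quad_growth_transfer)

lemma transfer_mono:
  assumes "matrix_action a" "quad_growth \<Gamma>" "quad_growth \<Delta>" "\<And>z. \<Gamma> z \<le> \<Delta> z"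
  shows "transfer a \<Gamma> z \<le> transfer a \<Delta> z"
  unfolding transfer_def by (intro integral_mono integrable_action assms)

lemma transfer_pow_mono:
  assumes "matrix_action a" "quad_growth \<Gamma>" "quad_growth \<Delta>" "\<And>z. \<Gamma> z \<le> \<Delta> z"
  shows "(transfer a ^^ n) \<Gamma> z \<le> (transfer a ^^ n) \<Delta> z"
proof (induction n arbitrary: z)
  case (Suc n)
  then show ?case
    by (simp add: transfer_mono[OF assms(1) quad_growth_transfer_pow quad_growth_transfer_pow] assms)
qed (simp add: assms)

lemma transfer_add:
  assumes "matrix_action a" "quad_growth \<Gamma>" "quad_growth \<Delta>"
  shows "transfer a (\<lambda>z. \<Gamma> z + \<Delta> z) = (\<lambda>z. transfer a \<Gamma> z + transfer a \<Delta> z)"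
  unfolding transfer_def
  by (intro ext Bochner_Integration.integral_add integrable_action assms)

lemma transfer_pow_add:
  assumes "matrix_action a" "quad_growth \<Gamma>" "quad_growth \<Delta>"
  shows "(transfer a ^^ n) (\<lambda>z. \<Gamma> z + \<Delta> z) = (\<lambda>z. (transfer a ^^ n) \<Gamma> z + (transfer a ^^ n) \<Delta> z)"
proof (induction n)
  case (Suc n)
  then show ?case
    by (simp add: transfer_add quad_growth_transfer_pow assms)
qed simp

lemma transfer_pow_cmult:
  "(transfer a ^^ n) (\<lambda>z. c * \<Gamma> z) = (\<lambda>z. c * (transfer a ^^ n) \<Gamma> z)"
  by (induction n) (simp_all add: transfer_def fun_eq_iff)

lemma transfer_pow_diff:
  assumes "matrix_action a" "quad_growth \<Gamma>" "quad_growth \<Delta>"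
  shows "(transfer a ^^ n) (\<lambda>z. \<Gamma> z - \<Delta> z) = (\<lambda>z. (transfer a ^^ n) \<Gamma> z - (transfer a ^^ n) \<Delta> z)"
  using transfer_pow_add[OF assms(1,2) quad_growth_cmult[OF assms(3), of "- 1"], of n]
    transfer_pow_cmult[of n a "- 1" \<Delta>] by simp

lemma transfer_pow_abs_le:
  assumes "matrix_action a" "quad_growth \<Gamma>" "quad_growth \<Delta>" "\<And>z. \<bar>\<Gamma> z\<bar> \<le> \<Delta> z"
  shows "\<bar>(transfer a ^^ n) \<Gamma> z\<bar> \<le> (transfer a ^^ n) \<Delta> z"
proof (rule abs_leI)
  show "(transfer a ^^ n) \<Gamma> z \<le> (transfer a ^^ n) \<Delta> z"
    by (intro transfer_pow_mono assms order_trans[OF abs_ge_self assms(4)])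
  have "(transfer a ^^ n) (\<lambda>z. - 1 * \<Gamma> z) z \<le> (transfer a ^^ n) \<Delta> z"
    using assms(4) by (intro transfer_pow_mono quad_growth_cmult assms) (simp add: abs_le_iff)
  then show "- (transfer a ^^ n) \<Gamma> z \<le> (transfer a ^^ n) \<Delta> z"
    using transfer_pow_cmult[of n a "- 1" \<Gamma>] by simp
qed

lemma transfer_pow_sum:
  assumes "matrix_action a" "finite I" "\<And>i. i \<in> I \<Longrightarrow> quad_growth (\<Gamma> i)"
  shows "(transfer a ^^ n) (\<lambda>z. \<Sum>i\<in>I. \<Gamma> i z) = (\<lambda>z. \<Sum>i\<in>I. (transfer a ^^ n) (\<Gamma> i) z)"
  using assms(2,3)
proof (induction I rule: finite_induct)
  case empty
  then show ?case using transfer_pow_cmult[of n a 0 "\<lambda>_. 0"] by simp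
next
  case (insert i I)
  then show ?case
    by (simp add: transfer_pow_add[OF assms(1) _ quad_growth_sum])
qed

text \<open>Every computation with several vectors moved by the same random matrices is a computation
  with the matrices themselves, transported along an intertwining map such as \<open>\<lambda>w. w *v x\<close>.\<close>

lemma transfer_pow_intertwine:
  assumes "\<And>v z. \<phi> (a v z) = b v (\<phi> z)"
  shows "(transfer a ^^ n) (\<lambda>z. \<Gamma> (\<phi> z)) = (\<lambda>z. (transfer b ^^ n) \<Gamma> (\<phi> z))"
  by (induction n) (simp_all add: transfer_def fun_eq_iff assms)

lemma transfer_pow_norm_sq:
  "(transfer (*v) ^^ n) (\<lambda>z. (norm z)\<^sup>2) = (\<lambda>z :: complex ^ 'n. (norm z)\<^sup>2)"
  by (induction n) (simp_all add: transfer_def integral_norm_sq)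

end

section \<open>Product measures and matrix products\<close>

text \<open>A measure obtained by extension is, by definition, zero when no extension exists. So a single set
  of nonzero measure certifies that the prescribed values are attained, even where uniqueness of the
  extension fails.\<close>

lemma emeasure_extend_measure_nonnull:
  assumes G: "G ` I \<subseteq> Pow \<Omega>" and nz: "emeasure (extend_measure \<Omega> I G m) X \<noteq> 0" and i: "i \<in> I"
  shows "emeasure (extend_measure \<Omega> I G m) (G i) = m i"
proof -
  define Q where "Q m' \<longleftrightarrow> (\<forall>i\<in>I. m' (G i) = m i) \<and> measure_space \<Omega> (sigma_sets \<Omega> (G ` I)) m'" for m'
  have *: "(\<exists>m'. Q m') \<and> \<not> (\<forall>i\<in>I. m i = 0)"
  proof (rule ccontr)
    assume "\<not> ((\<exists>m'. Q m') \<and> \<not> (\<forall>i\<in>I. m i = 0))"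
    then have "extend_measure \<Omega> I G m = measure_of \<Omega> (G ` I) (\<lambda>_. 0)"
      unfolding extend_measure_def Q_def by (simp only: if_False)
    then show False using nz by (simp add: emeasure_sigma)
  qed
  then have M: "extend_measure \<Omega> I G m = measure_of \<Omega> (G ` I) (Eps Q)"
    unfolding extend_measure_def Q_def by (simp only: if_True simp_thms)
  have "\<exists>m'. Q m'" using * by blast
  then have Q: "Q (Eps Q)" by (rule someI_ex)
  show ?thesis
  proof (subst emeasure_measure_of[OF M G])
    show "positive (sets (extend_measure \<Omega> I G m)) (Eps Q)"
      "countably_additive (sets (extend_measure \<Omega> I G m)) (Eps Q)"
      using Q unfolding Q_def measure_space_def sets_extend_measure[OF G] by blast+
    show "G i \<in> sets (extend_measure \<Omega> I G m)"
      unfolding sets_extend_measure[OF G] using i by blast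
    show "Eps Q (G i) = m i"
      using Q i unfolding Q_def by blast
  qed
qed

text \<open>The product formula for boxes, for arbitrary factors: a \<open>\<sigma>\<close>-finiteness condition is replaced by
  the product measure being nonzero.\<close>

lemma emeasure_PiM_box:
  assumes "finite I" and nz: "emeasure (PiM I M) (space (PiM I M)) \<noteq> 0"
    and A: "\<And>i. i \<in> I \<Longrightarrow> A i \<in> sets (M i)"
  shows "emeasure (PiM I M) (Pi\<^sub>E I A) = (\<Prod>i\<in>I. emeasure (M i) (A i))"
proof -
  let ?J = "{(J, X). (J \<noteq> {} \<or> I = {}) \<and> finite J \<and> J \<subseteq> I \<and> X \<in> (\<Pi> j\<in>J. sets (M j))}"
  let ?G = "\<lambda>(J, X). prod_emb I M J (\<Pi>\<^sub>E j\<in>J. X j)"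
  let ?m = "\<lambda>(J, X). \<Prod>j\<in>J \<union> {i\<in>I. emeasure (M i) (space (M i)) \<noteq> 1}.
    if j \<in> J then emeasure (M j) (X j) else emeasure (M j) (space (M j))"
  have "emeasure (PiM I M) (?G (I, A)) = ?m (I, A)"
    unfolding PiM_def
  proof (rule emeasure_extend_measure_nonnull)
    show "?G ` ?J \<subseteq> Pow (\<Pi>\<^sub>E i\<in>I. space (M i))"
      by (auto simp: prod_emb_def PiE_iff)
    show "(I, A) \<in> ?J"
      using assms by auto
  qed (rule nz[unfolded PiM_def])
  moreover have "?G (I, A) = Pi\<^sub>E I A"
    using sets.sets_into_space[OF A] by (simp add: prod_emb_PiE_same_index)
  moreover have "?m (I, A) = (\<Prod>i\<in>I. emeasure (M i) (A i))"
    by (auto intro!: prod.cong)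
  ultimately show ?thesis by simp
qed

lemma W_cong: "(\<And>i. i < n \<Longrightarrow> \<omega> i = \<omega>' i) \<Longrightarrow> W n \<omega> = W n \<omega>'"
  by (induction n) auto

lemma W_fun_upd [simp]: "W n (fun_upd \<omega> n v) = W n \<omega>"
  by (rule W_cong) simp

lemma W_eq_0: "i < n \<Longrightarrow> \<omega> i = 0 \<Longrightarrow> W n \<omega> = 0"
  by (induction n) (auto simp: less_Suc_eq)

lemma borel_measurable_matrix_matrix_mult [measurable (raw)]:
  fixes f g :: "'a \<Rightarrow> complex ^ 'n ^ 'n"
  assumes "f \<in> borel_measurable M" "g \<in> borel_measurable M"
  shows "(\<lambda>x. f x ** g x) \<in> borel_measurable M"
  by (rule borel_measurable_continuous_Pair[OF assms]) (intro continuous_intros)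

lemma measurable_W:
  assumes "{..<n} \<subseteq> I"
  shows "(W n :: (nat \<Rightarrow> complex ^ 'n ^ 'n) \<Rightarrow> _) \<in> PiM I (\<lambda>_. borel) \<rightarrow>\<^sub>M borel"
  using assms
proof (induction n)
  case (Suc n)
  then have [measurable]: "(W n :: (nat \<Rightarrow> complex ^ 'n ^ 'n) \<Rightarrow> _) \<in> PiM I (\<lambda>_. borel) \<rightarrow>\<^sub>M borel"
    and "n \<in> I"
    by (auto simp: lessThan_Suc)
  then have [measurable]: "(\<lambda>\<omega>. \<omega> n) \<in> PiM I (\<lambda>_. borel) \<rightarrow>\<^sub>M (borel :: (complex ^ 'n ^ 'n) measure)"
    by (intro measurable_component_singleton)
  show ?case by simp
next
  case 0
  have "W 0 = (\<lambda>_ :: nat \<Rightarrow> complex ^ 'n ^ 'n. mat 1)" by (simp add: fun_eq_iff)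
  then show ?case by simp
qed

context kraus_measure
begin

text \<open>The measure \<open>\<mu>\<close> is finite away from every neighbourhood of \<open>0\<close>, but may have an infinite
  atom at \<open>0\<close>. Products containing the factor \<open>0\<close> have weight \<open>0\<close>, so nothing is
  lost by removing the atom, and what remains is \<open>\<sigma>\<close>-finite.\<close>

definition \<mu>\<^sub>0 :: "(complex ^ 'n ^ 'n) measure" where
  "\<mu>\<^sub>0 = density \<mu> (indicator (- {0}))"

lemma sets_\<mu>\<^sub>0 [simp, measurable_cong]: "sets \<mu>\<^sub>0 = sets borel"
  by (simp add: \<mu>\<^sub>0_def)

lemma space_\<mu> [simp]: "space \<mu> = UNIV"
  using sets_eq_imp_space_eq[OF sets_mu] by simp

lemma emeasure_\<mu>\<^sub>0: "A \<in> sets borel \<Longrightarrow> emeasure \<mu>\<^sub>0 A = emeasure \<mu> (A - {0})"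
  unfolding \<mu>\<^sub>0_def
  by (subst emeasure_density)
     (auto simp: indicator_def nn_integral_indicator[symmetric] simp del: nn_integral_indicator
        intro!: nn_integral_cong split: if_splits)

lemma nn_integral_\<mu>\<^sub>0:
  assumes "h \<in> borel_measurable borel" "h 0 = 0"
  shows "(\<integral>\<^sup>+v. h v \<partial>\<mu>\<^sub>0) = (\<integral>\<^sup>+v. h v \<partial>\<mu>)"
proof -
  have "(\<integral>\<^sup>+v. h v \<partial>\<mu>\<^sub>0) = (\<integral>\<^sup>+v. indicator (- {0}) v * h v \<partial>\<mu>)"
    unfolding \<mu>\<^sub>0_def using assms(1) by (subst nn_integral_density) auto
  also have "\<dots> = (\<integral>\<^sup>+v. h v \<partial>\<mu>)"
    using assms(2) by (intro nn_integral_cong) (auto simp: indicator_def)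
  finally show ?thesis .
qed

text \<open>By Chebyshev's inequality for the squared norm, the sets \<open>{v. norm v \<ge> 1 / (k + 1)}\<close> have finite
  measure; they exhaust the nonzero matrices.\<close>

lemma sigma_finite_\<mu>\<^sub>0: "sigma_finite_measure \<mu>\<^sub>0"
proof (rule sigma_finite_measure.intro)
  define A where "A k = {v :: complex ^ 'n ^ 'n. norm v \<ge> 1 / real (Suc k)}" for k
  have A [measurable]: "A k \<in> sets borel" for k
    unfolding A_def by measurable
  have fin: "emeasure \<mu>\<^sub>0 (A k) \<noteq> \<infinity>" for k
  proof -
    have "0 \<notin> A k" by (simp add: A_def)
    then have "emeasure \<mu>\<^sub>0 (A k) = emeasure \<mu> (A k)" by (simp add: emeasure_\<mu>\<^sub>0)
    also have "\<dots> = (\<integral>\<^sup>+v. indicator (A k) v \<partial>\<mu>)" by simp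
    also have "\<dots> \<le> (\<integral>\<^sup>+v. ennreal ((real (Suc k))\<^sup>2 * (norm v)\<^sup>2) \<partial>\<mu>)"
    proof (intro nn_integral_mono)
      fix v :: "complex ^ 'n ^ 'n"
      have "1 \<le> (real (Suc k))\<^sup>2 * (norm v)\<^sup>2" if "v \<in> A k"
      proof -
        have "1 \<le> real (Suc k) * norm v" using that by (simp add: A_def field_simps)
        then show ?thesis using one_le_power[of "real (Suc k) * norm v" 2] by (simp only: power_mult_distrib)
      qed
      then show "indicator (A k) v \<le> ennreal ((real (Suc k))\<^sup>2 * (norm v)\<^sup>2)"
        by (auto simp: indicator_def simp flip: ennreal_1 intro!: ennreal_leI)
    qed
    also have "\<dots> = ennreal (\<integral>v. (real (Suc k))\<^sup>2 * (norm v)\<^sup>2 \<partial>\<mu>)"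
      using integrable_norm_sq by (intro nn_integral_eq_integral) auto
    finally show ?thesis by (auto simp: top_unique)
  qed
  have null: "emeasure \<mu>\<^sub>0 {0} = 0"
    by (subst emeasure_\<mu>\<^sub>0) auto
  show "\<exists>B. countable B \<and> B \<subseteq> sets \<mu>\<^sub>0 \<and> \<Union> B = space \<mu>\<^sub>0 \<and> (\<forall>a\<in>B. emeasure \<mu>\<^sub>0 a \<noteq> \<infinity>)"
  proof (intro exI[of _ "insert {0} (range A)"] conjI ballI)
    have "\<exists>k. v \<in> A k" if "v \<noteq> 0" for v :: "complex ^ 'n ^ 'n"
      using reals_Archimedean[of "norm v"] that by (auto simp: A_def inverse_eq_divide intro: less_imp_le)
    then show "\<Union> (insert {0} (range A)) = space \<mu>\<^sub>0"
      using sets_eq_imp_space_eq[OF sets_\<mu>\<^sub>0] by auto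
  qed (use fin null A in auto)
qed

sublocale \<mu>\<^sub>0: product_sigma_finite "\<lambda>_ :: nat. \<mu>\<^sub>0"
  by (rule product_sigma_finite.intro) (rule sigma_finite_\<mu>\<^sub>0)

end

text \<open>Nonvanishing of the product measures is what makes them satisfy the product formula in the
  presence of an infinite atom at \<open>0\<close>. It follows from the existence of a trajectory measure.\<close>

locale kraus_product = kraus_measure \<mu> for \<mu> :: "(complex ^ 'n ^ 'n) measure" +
  assumes PiM_nonnull: "\<And>n :: nat. emeasure (PiM {..<n} (\<lambda>_. \<mu>)) (space (PiM {..<n} (\<lambda>_. \<mu>))) \<noteq> 0"
begin

lemma sets_PiM_\<mu>: "sets (PiM I (\<lambda>_. \<mu>)) = sets (PiM I (\<lambda>_. borel))"
  by (intro sets_PiM_cong) auto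

lemma sets_PiM_\<mu>\<^sub>0: "sets (PiM I (\<lambda>_. \<mu>\<^sub>0)) = sets (PiM I (\<lambda>_. borel))"
  by (intro sets_PiM_cong) auto

lemma nn_integral_PiM_\<mu>\<^sub>0:
  fixes n :: nat and h :: "(nat \<Rightarrow> complex ^ 'n ^ 'n) \<Rightarrow> ennreal"
  assumes h: "h \<in> borel_measurable (PiM {..<n} (\<lambda>_. borel))"
    and z: "\<And>\<omega> i. i < n \<Longrightarrow> \<omega> i = 0 \<Longrightarrow> h \<omega> = 0"
  shows "(\<integral>\<^sup>+\<omega>. h \<omega> \<partial>PiM {..<n} (\<lambda>_. \<mu>)) = (\<integral>\<^sup>+\<omega>. h \<omega> \<partial>PiM {..<n} (\<lambda>_. \<mu>\<^sub>0))"
proof -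
  let ?M = "PiM {..<n} (\<lambda>_. \<mu>)"
  let ?N = "Pi\<^sub>E {..<n} (\<lambda>_. - {0 :: complex ^ 'n ^ 'n})"
  note [measurable_cong] = sets_PiM_\<mu>
  have N: "?N \<in> sets (PiM {..<n} (\<lambda>_. \<mu>))"
    by (intro sets_PiM_I_finite) auto
  have "density ?M (indicator ?N) = PiM {..<n} (\<lambda>_. \<mu>\<^sub>0)"
  proof (rule \<mu>\<^sub>0.PiM_eqI)
    show "sets (density ?M (indicator ?N)) = sets (PiM {..<n} (\<lambda>_. \<mu>\<^sub>0))"
      by (simp add: sets_PiM_\<mu> sets_PiM_\<mu>\<^sub>0)
    fix A assume "\<And>i. i \<in> {..<n} \<Longrightarrow> A i \<in> sets \<mu>\<^sub>0"
    then have A: "\<And>i. i < n \<Longrightarrow> A i \<in> sets borel" by simp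
    then have "Pi\<^sub>E {..<n} A \<in> sets ?M"
      by (intro sets_PiM_I_finite) auto
    then have "emeasure (density ?M (indicator ?N)) (Pi\<^sub>E {..<n} A)
      = (\<integral>\<^sup>+\<omega>. indicator (?N \<inter> Pi\<^sub>E {..<n} A) \<omega> \<partial>?M)"
      unfolding indicator_inter_arith using N by (intro emeasure_density) auto
    also have "\<dots> = emeasure ?M (?N \<inter> Pi\<^sub>E {..<n} A)"
      using N \<open>Pi\<^sub>E {..<n} A \<in> sets ?M\<close> by (intro nn_integral_indicator sets.Int)
    also have "?N \<inter> Pi\<^sub>E {..<n} A = Pi\<^sub>E {..<n} (\<lambda>i. A i - {0})"
      by (auto simp: PiE_iff)
    also have "emeasure ?M \<dots> = (\<Prod>i<n. emeasure \<mu> (A i - {0}))"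
      using A by (intro emeasure_PiM_box[OF _ PiM_nonnull]) auto
    also have "\<dots> = (\<Prod>i<n. emeasure \<mu>\<^sub>0 (A i))"
      using A by (intro prod.cong) (auto simp: emeasure_\<mu>\<^sub>0)
    finally show "emeasure (density ?M (indicator ?N)) (Pi\<^sub>E {..<n} A) = (\<Prod>i<n. emeasure \<mu>\<^sub>0 (A i))" .
  qed simp
  then have "(\<integral>\<^sup>+\<omega>. h \<omega> \<partial>PiM {..<n} (\<lambda>_. \<mu>\<^sub>0)) = (\<integral>\<^sup>+\<omega>. indicator ?N \<omega> * h \<omega> \<partial>?M)"
    using h N by (subst nn_integral_density[symmetric]) auto
  also have "\<dots> = (\<integral>\<^sup>+\<omega>. h \<omega> \<partial>?M)"
    by (intro nn_integral_cong) (auto simp: indicator_def space_PiM PiE_iff dest: z)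
  finally show ?thesis ..
qed

text \<open>Fubini's theorem for the last factor. Functions that vanish as soon as one factor is \<open>0\<close> have the
  same integral for \<open>\<mu>\<close> and for the \<open>\<sigma>\<close>-finite measure \<open>\<mu>\<^sub>0\<close>, which carries the argument.\<close>

lemma nn_integral_PiM_Suc:
  fixes h :: "(nat \<Rightarrow> complex ^ 'n ^ 'n) \<Rightarrow> ennreal"
  assumes h: "h \<in> borel_measurable (PiM {..<Suc n} (\<lambda>_. borel))"
    and z: "\<And>\<omega> i. i < Suc n \<Longrightarrow> \<omega> i = 0 \<Longrightarrow> h \<omega> = 0"
  shows "(\<integral>\<^sup>+\<omega>. h \<omega> \<partial>PiM {..<Suc n} (\<lambda>_. \<mu>))
    = (\<integral>\<^sup>+\<omega>. (\<integral>\<^sup>+v. h (fun_upd \<omega> n v) \<partial>\<mu>) \<partial>PiM {..<n} (\<lambda>_. \<mu>))"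
proof -
  note [measurable_cong] = sets_PiM_\<mu>\<^sub>0
  note [measurable] = h
  have ins: "{..<Suc n} = insert n {..<n}" by auto
  have h': "h \<in> borel_measurable (PiM (insert n {..<n}) (\<lambda>_. \<mu>\<^sub>0))"
    unfolding ins[symmetric] by measurable
  interpret pair_sigma_finite "PiM {..<n} (\<lambda>_. \<mu>\<^sub>0)" \<mu>\<^sub>0
    by (intro pair_sigma_finite.intro \<mu>\<^sub>0.sigma_finite sigma_finite_\<mu>\<^sub>0) simp
  have m: "(\<lambda>\<omega>. \<integral>\<^sup>+v. h (fun_upd \<omega> n v) \<partial>\<mu>\<^sub>0) \<in> borel_measurable (PiM {..<n} (\<lambda>_. borel))"
  proof -
    have "(\<lambda>(\<omega>, v). h (fun_upd \<omega> n v)) \<in> borel_measurable (PiM {..<n} (\<lambda>_. \<mu>\<^sub>0) \<Otimes>\<^sub>M \<mu>\<^sub>0)"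
      using measurable_compose[OF measurable_add_dim h'] by (simp add: case_prod_beta)
    then show ?thesis
      using sigma_finite_measure.borel_measurable_nn_integral[OF sigma_finite_\<mu>\<^sub>0, of "\<lambda>\<omega> v. h (fun_upd \<omega> n v)" "PiM {..<n} (\<lambda>_. \<mu>\<^sub>0)"]
      by (simp add: measurable_cong_sets[OF sets_PiM_\<mu>\<^sub>0 refl])
  qed
  have inner: "(\<integral>\<^sup>+v. h (fun_upd \<omega> n v) \<partial>\<mu>\<^sub>0) = (\<integral>\<^sup>+v. h (fun_upd \<omega> n v) \<partial>\<mu>)" if "\<omega> \<in> space (PiM {..<n} (\<lambda>_. borel))" for \<omega>
  proof -
    have "(\<lambda>v. h (fun_upd \<omega> n v)) \<in> borel_measurable borel"
    proof -
      have "(\<lambda>v. fun_upd \<omega> n v) \<in> borel \<rightarrow>\<^sub>M PiM {..<Suc n} (\<lambda>_. borel)"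
        unfolding ins using that by (intro measurable_fun_upd[where J = "{..<n}"]) auto
      then show ?thesis by (rule measurable_compose) (rule h)
    qed
    then show ?thesis
      using z[of n "fun_upd \<omega> n 0"] by (intro nn_integral_\<mu>\<^sub>0) simp_all
  qed
  have "(\<integral>\<^sup>+\<omega>. h \<omega> \<partial>PiM {..<Suc n} (\<lambda>_. \<mu>)) = (\<integral>\<^sup>+\<omega>. h \<omega> \<partial>PiM (insert n {..<n}) (\<lambda>_. \<mu>\<^sub>0))"
    unfolding ins[symmetric] by (rule nn_integral_PiM_\<mu>\<^sub>0[OF h z])
  also have "\<dots> = (\<integral>\<^sup>+\<omega>. (\<integral>\<^sup>+v. h (fun_upd \<omega> n v) \<partial>\<mu>\<^sub>0) \<partial>PiM {..<n} (\<lambda>_. \<mu>\<^sub>0))"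
    by (rule \<mu>\<^sub>0.product_nn_integral_insert[OF _ _ h']) auto
  also have "\<dots> = (\<integral>\<^sup>+\<omega>. (\<integral>\<^sup>+v. h (fun_upd \<omega> n v) \<partial>\<mu>\<^sub>0) \<partial>PiM {..<n} (\<lambda>_. \<mu>))"
  proof (rule nn_integral_PiM_\<mu>\<^sub>0[OF m, symmetric])
    fix \<omega> i assume "i < n" "\<omega> i = (0 :: complex ^ 'n ^ 'n)"
    then show "(\<integral>\<^sup>+v. h (fun_upd \<omega> n v) \<partial>\<mu>\<^sub>0) = 0"
      using z[of i "fun_upd \<omega> n _"] by simp
  qed
  also have "\<dots> = (\<integral>\<^sup>+\<omega>. (\<integral>\<^sup>+v. h (fun_upd \<omega> n v) \<partial>\<mu>) \<partial>PiM {..<n} (\<lambda>_. \<mu>))"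
    by (intro nn_integral_cong inner) (simp add: space_PiM)
  finally show ?thesis .
qed

text \<open>Matrices accumulate on the left of the product, so integrating out the last one applies
  \<open>transfer\<close> to the integrand. Evaluation at the identity matrix starts the product.\<close>

lemma nn_integral_W_eq_transfer:
  assumes "quad_growth \<Gamma>" "\<And>w. \<Gamma> w \<ge> 0"
  shows "(\<integral>\<^sup>+\<omega>. ennreal (\<Gamma> (W n \<omega>)) \<partial>PiM {..<n} (\<lambda>_. \<mu>)) = ennreal ((transfer (**) ^^ n) \<Gamma> (mat 1))"
  using assms
proof (induction n arbitrary: \<Gamma>)
  case 0
  then show ?case by (simp add: PiM_empty nn_integral_count_space_finite)
next
  case (Suc n)
  note [measurable] = measurable_W[OF order_refl]
  note act = matrix_action_matrix
  have [measurable]: "\<Gamma> \<in> borel_measurable borel"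
    using quad_growth_continuous[OF Suc.prems(1)] by (rule borel_measurable_continuous_onI)
  have "(\<integral>\<^sup>+\<omega>. ennreal (\<Gamma> (W (Suc n) \<omega>)) \<partial>PiM {..<Suc n} (\<lambda>_. \<mu>))
      = (\<integral>\<^sup>+\<omega>. (\<integral>\<^sup>+v. ennreal (\<Gamma> (W (Suc n) (fun_upd \<omega> n v))) \<partial>\<mu>) \<partial>PiM {..<n} (\<lambda>_. \<mu>))"
  proof (rule nn_integral_PiM_Suc)
    show "ennreal (\<Gamma> (W (Suc n) \<omega>)) = 0" if "i < Suc n" "\<omega> i = 0" for \<omega> i
      using W_eq_0[of i "Suc n" \<omega>] that quad_growth_zero[OF Suc.prems(1)] by simp
  qed measurable
  also have "\<dots> = (\<integral>\<^sup>+\<omega>. ennreal (transfer (**) \<Gamma> (W n \<omega>)) \<partial>PiM {..<n} (\<lambda>_. \<mu>))"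
    unfolding transfer_def W.simps W_fun_upd fun_upd_same
    by (intro nn_integral_cong nn_integral_eq_integral integrable_action act Suc.prems AE_I2)
  also have "\<dots> = ennreal ((transfer (**) ^^ n) (transfer (**) \<Gamma>) (mat 1))"
  proof (rule Suc.IH)
    show "quad_growth (transfer (**) \<Gamma>)" by (rule quad_growth_transfer[OF act Suc.prems(1)])
    show "transfer (**) \<Gamma> w \<ge> 0" for w
      unfolding transfer_def by (intro integral_nonneg_AE AE_I2 Suc.prems)
  qed
  also have "\<dots> = ennreal ((transfer (**) ^^ Suc n) \<Gamma> (mat 1))"
    by (simp only: funpow_Suc_right comp_apply)
  finally show ?case .
qed

end

section \<open>Purification\<close>

lemma outer_sum_mult: "(outer x + outer y) *v z = cinner x z *s x + cinner y z *s y"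
  by (simp add: matrix_vector_mult_add_rdistrib outer_vec)

lemma cinner_eq_0_sym: "cinner x y = 0 \<Longrightarrow> cinner y x = 0"
  by (simp add: cinner_commute[of y x])

lemma orthogonal_projector_outer_sum:
  fixes x y :: "complex ^ 'n"
  assumes "norm x = 1" "norm y = 1" "cinner x y = 0"
  shows "orthogonal_projector (outer x + outer y)"
proof -
  have "((outer x + outer y) ** (outer x + outer y)) *v z = (outer x + outer y) *v z" for z
    by (simp add: matrix_vector_mul_assoc[symmetric] outer_sum_mult cinner_add_right
        cinner_smult_right cinner_self assms cinner_eq_0_sym[OF assms(3)])
  then have "(outer x + outer y) ** (outer x + outer y) = outer x + outer y"
    by (simp add: matrix_eq)
  moreover have "cadjoint (outer x + outer y) = outer x + outer y"
    by (simp add: cadjoint_def outer_def transpose_def map_matrix_def vec_eq_iff mult.commute)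
  ultimately show ?thesis by (simp add: orthogonal_projector_def)
qed

text \<open>The complex conjugates of \<open>x\<close> and \<open>y\<close> are two independent vectors in the row space.\<close>

lemma rank_outer_sum:
  fixes x y :: "complex ^ 'n"
  assumes "norm x = 1" "norm y = 1" "cinner x y = 0"
  shows "rank (outer x + outer y) \<noteq> 1"
proof -
  let ?A = "outer x + outer y"
  define cv where "cv u = (\<chi> i. cnj (u $ i))" for u :: "complex ^ 'n"
  have row: "row i ?A = x $ i *s cv x + y $ i *s cv y" for i
    by (simp add: row_def outer_def cv_def vec_eq_iff)
  have s: "(\<Sum>i\<in>UNIV. cnj (u $ i) *s row i ?A) = cinner u x *s cv x + cinner u y *s cv y" for u
    by (simp add: row cinner_def vec_eq_iff distrib_left sum.distrib sum_distrib_right mult.assoc)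
  have mem: "(\<Sum>i\<in>UNIV. cnj (u $ i) *s row i ?A) \<in> vec.span (rows ?A)" for u
    by (intro vec.span_sum vec.span_scale vec.span_base) (auto simp: rows_def)
  have "cv x \<in> vec.span (rows ?A)" "cv y \<in> vec.span (rows ?A)"
    using mem[of x] mem[of y] unfolding s
    by (simp_all add: cinner_self assms cinner_eq_0_sym[OF assms(3)])
  then have sub: "{cv x, cv y} \<subseteq> vec.span (rows ?A)" by simp
  have ncv: "cv u \<noteq> 0" if "norm u = 1" for u
  proof
    assume "cv u = 0"
    then have "u = 0" by (simp add: cv_def vec_eq_iff)
    then show False using that by simp
  qed
  have no: "cv x \<noteq> k *s cv y" for k
  proof
    assume "cv x = k *s cv y"
    then have "cnj (cv x $ i) = cnj ((k *s cv y) $ i)" for i by simp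
    then have "x = cnj k *s y" by (simp add: cv_def vec_eq_iff)
    then have "cinner x y = k * cinner y y" by (simp add: cinner_smult_left)
    then have "k = 0" using assms by (simp add: cinner_self)
    then have "x = 0" using \<open>x = cnj k *s y\<close> by simp
    then show False using assms(1) by simp
  qed
  have "cv x \<noteq> cv y" using no[of 1] by simp
  moreover have "vec.independent {cv x, cv y}"
    using no ncv[OF assms(2)] by (auto simp: vec.independent_insert vec.span_singleton \<open>cv x \<noteq> cv y\<close>)
  ultimately have "2 \<le> vec.dim (vec.span (rows ?A))"
    using vec.independent_card_le_dim[OF sub] by simp
  then show ?thesis by (simp add: row_rank_def_gen)
qed

text \<open>An operator that maps an orthonormal pair to an orthogonal pair of equal lengths is a multiple of
  an isometry on the plane of the pair.\<close>

lemma outer_sum_compression: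
  fixes x y :: "complex ^ 'n" and A :: "complex ^ 'n ^ 'n"
  assumes "norm (A *v x) = norm (A *v y)" "cinner (A *v x) (A *v y) = 0"
  defines "\<pi> \<equiv> outer x + outer y"
  shows "\<pi> ** cadjoint A ** A ** \<pi> = map_matrix (\<lambda>z. complex_of_real ((norm (A *v x))\<^sup>2) * z) \<pi>"
proof -
  let ?c = "complex_of_real ((norm (A *v x))\<^sup>2)"
  have m: "map_matrix (\<lambda>z. ?c * z) \<pi> *v z = ?c *s (\<pi> *v z)" for z
    by (simp add: map_matrix_def matrix_vector_mult_def vec_eq_iff sum_distrib_left mult.assoc)
  have "(\<pi> ** cadjoint A ** A ** \<pi>) *v z = ?c *s (\<pi> *v z)" for z
  proof -
    have A: "A *v (\<pi> *v z) = cinner x z *s (A *v x) + cinner y z *s (A *v y)"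
      by (simp only: \<pi>_def outer_sum_mult matrix_vector_right_distrib vector_scalar_commute)
    have "(\<pi> ** cadjoint A ** A ** \<pi>) *v z = \<pi> *v (cadjoint A *v (A *v (\<pi> *v z)))"
      by (simp only: matrix_vector_mul_assoc matrix_mul_assoc)
    also have "\<dots> = cinner (A *v x) (A *v (\<pi> *v z)) *s x + cinner (A *v y) (A *v (\<pi> *v z)) *s y"
      unfolding \<pi>_def by (subst outer_sum_mult) (simp only: cinner_cadjoint)
    also have "\<dots> = ?c *s (cinner x z *s x + cinner y z *s y)"
      using assms(1)
      by (simp only: A cinner_add_right cinner_smult_right cinner_self assms(2) cinner_eq_0_sym[OF assms(2)])
         (simp add: vec_eq_iff algebra_simps)
    finally show ?thesis by (simp only: \<pi>_def outer_sum_mult)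
  qed
  then show ?thesis unfolding matrix_eq m by blast
qed

definition orthonormal_pair :: "(complex ^ 'n) \<times> (complex ^ 'n) \<Rightarrow> bool" where
  "orthonormal_pair z \<longleftrightarrow> norm (fst z) = 1 \<and> norm (snd z) = 1 \<and> cinner (fst z) (snd z) = 0"

lemma compact_orthonormal_pair: "compact {z :: (complex ^ 'n) \<times> (complex ^ 'n). orthonormal_pair z}"
proof -
  have "{z :: (complex ^ 'n) \<times> (complex ^ 'n). orthonormal_pair z} =
    (sphere 0 1 \<times> sphere 0 1) \<inter> {z. cinner (fst z) (snd z) = 0}"
    by (auto simp: orthonormal_pair_def)
  moreover have "closed {z :: (complex ^ 'n) \<times> (complex ^ 'n). cinner (fst z) (snd z) = 0}"
    by (intro closed_Collect_eq continuous_intros)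
  ultimately show ?thesis by (simp add: compact_Int_closed compact_Times)
qed

lemma quad_growth_cross: "quad_growth (\<lambda>z :: (complex ^ 'n) \<times> (complex ^ 'n). cross (fst z) (snd z))"
proof (rule quad_growthI[where C = 1])
  fix z :: "(complex ^ 'n) \<times> (complex ^ 'n)"
  have "cross (fst z) (snd z) \<le> norm (fst z) * norm (snd z)" by (rule cross_le)
  also have "\<dots> \<le> norm z * norm z" using norm_fst_le[of "fst z" "snd z"] norm_snd_le[of "snd z" "fst z"] by (intro mult_mono) auto
  finally show "\<bar>cross (fst z) (snd z)\<bar> \<le> 1 * (norm z)\<^sup>2" by (simp add: power2_eq_square)
qed (intro continuous_intros)

lemma cross_le_mean: "cross a b \<le> ((norm a)\<^sup>2 + (norm b)\<^sup>2) / 2"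
  using cross_le[of a b] sum_squares_bound[of "norm a" "norm b"] by simp

text \<open>Equality throughout \<open>\<parallel>a \<and> b\<parallel> \<le> \<parallel>a\<parallel> \<parallel>b\<parallel> \<le> (\<parallel>a\<parallel>\<^sup>2 + \<parallel>b\<parallel>\<^sup>2) / 2\<close>.\<close>

lemma cross_eq_mean:
  assumes "((norm a)\<^sup>2 + (norm b)\<^sup>2) / 2 - cross a b = 0"
  shows "norm a = norm b" "cinner a b = 0"
proof -
  have "(norm a - norm b)\<^sup>2 \<le> 0"
    using assms cross_le[of a b] by (simp add: power2_diff)
  then show ab: "norm a = norm b" by simp
  then have "cross a b = norm a * norm b"
    using assms by (simp add: power2_eq_square)
  then have "(cmod (cinner a b))\<^sup>2 = 0"
    using cross_sq[of a b] by (simp add: power_mult_distrib)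
  then show "cinner a b = 0" by simp
qed

context kraus_measure
begin

text \<open>The mean area \<open>\<integral> \<parallel>W\<^sub>n x \<and> W\<^sub>n y\<parallel> d\<mu>\<^sup>\<otimes>\<^sup>n\<close> of the image of a parallelogram.\<close>

definition wedge :: "nat \<Rightarrow> (complex ^ 'n) \<times> (complex ^ 'n) \<Rightarrow> real" where
  "wedge n = (transfer act_pair ^^ n) (\<lambda>z. cross (fst z) (snd z))"

lemma quad_growth_wedge: "quad_growth (wedge n)"
  unfolding wedge_def by (intro quad_growth_transfer_pow matrix_action_pair quad_growth_cross)

lemma wedge_0 [simp]: "wedge 0 z = cross (fst z) (snd z)"
  by (simp add: wedge_def)

lemma wedge_eq_transfer_matrix:
  "(transfer (**) ^^ n) (\<lambda>w. cross (w *v x) (w *v y)) w = wedge n (w *v x, w *v y)"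
  using transfer_pow_intertwine[of "\<lambda>w. (w *v x, w *v y)" "(**)" act_pair n "\<lambda>z. cross (fst z) (snd z)"]
  by (simp add: wedge_def act_pair_def matrix_vector_mul_assoc)

lemma transfer_pow_mean:
  "(transfer act_pair ^^ n) (\<lambda>z. ((norm (fst z))\<^sup>2 + (norm (snd z))\<^sup>2) / 2)
    = (\<lambda>z. ((norm (fst z))\<^sup>2 + (norm (snd z))\<^sup>2) / 2)"
proof (induction n)
  case (Suc n)
  have i: "integrable \<mu> (\<lambda>v. (norm (v *v x))\<^sup>2)" for x
    by (rule integrable_action[OF matrix_action_vec quad_growth_norm_sq])
  have "transfer act_pair (\<lambda>z. ((norm (fst z))\<^sup>2 + (norm (snd z))\<^sup>2) / 2)
    = (\<lambda>z. ((norm (fst z))\<^sup>2 + (norm (snd z))\<^sup>2) / 2)"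
    by (rule ext) (simp add: transfer_def act_pair_def i integral_norm_sq)
  then show ?case using Suc by simp
qed simp

lemma quad_growth_mean: "quad_growth (\<lambda>z :: (complex ^ 'n) \<times> (complex ^ 'n). ((norm (fst z))\<^sup>2 + (norm (snd z))\<^sup>2) / 2)"
proof (rule quad_growthI[where C = 1])
  show "\<bar>((norm (fst z))\<^sup>2 + (norm (snd z))\<^sup>2) / 2\<bar> \<le> 1 * (norm z)\<^sup>2" for z :: "(complex ^ 'n) \<times> (complex ^ 'n)"
    by (simp add: norm_prod_def)
qed (intro continuous_intros, simp)

lemma wedge_le_mean: "wedge n z \<le> ((norm (fst z))\<^sup>2 + (norm (snd z))\<^sup>2) / 2"
  using transfer_pow_mono[OF matrix_action_pair quad_growth_cross quad_growth_mean cross_le_mean, of n z]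
  by (simp add: transfer_pow_mean wedge_def)

lemma wedge_le_1: "orthonormal_pair z \<Longrightarrow> wedge n z \<le> 1"
  using wedge_le_mean[of n z] by (simp add: orthonormal_pair_def)

text \<open>The mean expansion of area is a property of the plane, so a bound for orthonormal pairs is a bound
  relative to the initial area for all pairs.\<close>

lemma wedge_le_cross:
  assumes \<kappa>: "\<kappa> \<ge> 0" "\<And>z. orthonormal_pair z \<Longrightarrow> wedge n z \<le> \<kappa>"
  shows "wedge n z \<le> \<kappa> * cross (fst z) (snd z)"
proof -
  obtain x y where z: "z = (x, y)" by force
  have red: "wedge n (a, b) = (transfer (**) ^^ n) (\<lambda>w. cross (w *v a) (w *v b)) (mat 1)" for a b
    using wedge_eq_transfer_matrix[of n a b "mat 1"] by simp
  show ?thesis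
    using cross_orthonormalize[of x y]
  proof (elim disjE exE conjE)
    assume "\<forall>w :: complex ^ 'n ^ 'n. cross (w *v x) (w *v y) = 0"
    then have "wedge n z = 0"
      using transfer_pow_cmult[of n "(**)" 0 "\<lambda>_ :: complex ^ 'n ^ 'n. 0"] by (simp add: z red)
    then show ?thesis using \<kappa>(1) by simp
  next
    fix x' y' assume o: "norm x' = 1" "norm y' = 1" "cinner x' y' = 0"
      and "\<forall>w :: complex ^ 'n ^ 'n. cross (w *v x) (w *v y) = cross x y * cross (w *v x') (w *v y')"
    then have "wedge n z = cross x y * wedge n (x', y')"
      by (simp add: z red transfer_pow_cmult)
    also have "\<dots> \<le> cross x y * \<kappa>"
      using o by (intro mult_left_mono \<kappa>(2)) (auto simp: orthonormal_pair_def)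
    finally show ?thesis by (simp add: z mult.commute)
  qed
qed

text \<open>Split the product after \<open>m\<close> factors and bound the contraction by the remaining \<open>n\<close> factors
  uniformly over the planes that the first \<open>m\<close> factors produce.\<close>

lemma wedge_submultiplicative:
  assumes \<kappa>: "\<kappa> \<ge> 0" "\<And>z. orthonormal_pair z \<Longrightarrow> wedge n z \<le> \<kappa>"
  shows "wedge (m + n) z \<le> \<kappa> * wedge m z"
proof -
  have "wedge (m + n) z = (transfer act_pair ^^ m) (wedge n) z"
    by (simp add: wedge_def funpow_add)
  also have "\<dots> \<le> (transfer act_pair ^^ m) (\<lambda>z. \<kappa> * cross (fst z) (snd z)) z"
    by (intro transfer_pow_mono matrix_action_pair quad_growth_wedge quad_growth_cmult quad_growth_cross
        wedge_le_cross \<kappa>)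
  also have "\<dots> = \<kappa> * wedge m z"
    by (simp add: transfer_pow_cmult wedge_def)
  finally show ?thesis .
qed

lemma wedge_antimono: "n \<le> m \<Longrightarrow> wedge m z \<le> wedge n z"
  using wedge_submultiplicative[of 1 "m - n" n z] wedge_le_1 by simp

end

context kraus_product
begin

text \<open>An orthonormal pair whose exterior product is not contracted on average keeps both its
  orthogonality and the equality of its norms under almost every product of matrices. Its plane is
  then a dark subspace of dimension two, which purification excludes.\<close>

lemma wedge_contracts_some:
  assumes pur: "purifying \<mu>" and z: "orthonormal_pair z"
  shows "\<exists>n. wedge n z < 1"
proof (rule ccontr)
  assume "\<not> (\<exists>n. wedge n z < 1)"
  then have w1: "wedge n z = 1" for n
    using wedge_le_1[OF z, of n] by (meson antisym not_less)
  obtain x y where xy: "z = (x, y)" by force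
  with z have o: "norm x = 1" "norm y = 1" "cinner x y = 0"
    by (auto simp: orthonormal_pair_def)
  define \<Delta> where "\<Delta> z = ((norm (fst z))\<^sup>2 + (norm (snd z))\<^sup>2) / 2 - cross (fst z) (snd z)"
    for z :: "(complex ^ 'n) \<times> (complex ^ 'n)"
  have \<Delta>: "quad_growth \<Delta>"
    unfolding \<Delta>_def by (intro quad_growth_diff quad_growth_mean quad_growth_cross)
  have "AE \<omega> in PiM {..<n} (\<lambda>_. \<mu>). \<Delta> (W n \<omega> *v x, W n \<omega> *v y) = 0" for n
  proof -
    let ?\<Gamma> = "\<lambda>w. \<Delta> (w *v x, w *v y)"
    have \<Gamma>: "quad_growth ?\<Gamma>" by (rule quad_growth_matrix_pair[OF \<Delta>])
    have "(transfer (**) ^^ n) ?\<Gamma> (mat 1) = (transfer act_pair ^^ n) \<Delta> z"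
      using transfer_pow_intertwine[of "\<lambda>w. (w *v x, w *v y)" "(**)" act_pair n \<Delta>]
      by (simp add: act_pair_def matrix_vector_mul_assoc xy)
    also have "\<dots> = 1 - wedge n z"
      unfolding \<Delta>_def
      by (subst transfer_pow_diff[OF matrix_action_pair quad_growth_mean quad_growth_cross])
         (simp add: transfer_pow_mean wedge_def xy o)
    finally have "(\<integral>\<^sup>+\<omega>. ennreal (?\<Gamma> (W n \<omega>)) \<partial>PiM {..<n} (\<lambda>_. \<mu>)) = 0"
      using cross_le_mean by (subst nn_integral_W_eq_transfer[OF \<Gamma>]) (auto simp: w1 \<Delta>_def)
    moreover have "(\<lambda>\<omega>. ennreal (?\<Gamma> (W n \<omega>))) \<in> borel_measurable (PiM {..<n} (\<lambda>_. \<mu>))"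
    proof -
      have [measurable]: "?\<Gamma> \<in> borel_measurable borel"
        using quad_growth_continuous[OF \<Gamma>] by (rule borel_measurable_continuous_onI)
      note [measurable] = measurable_W[OF order_refl] and [measurable_cong] = sets_PiM_\<mu>
      show ?thesis by measurable
    qed
    ultimately have "AE \<omega> in PiM {..<n} (\<lambda>_. \<mu>). ennreal (?\<Gamma> (W n \<omega>)) = 0"
      by (simp add: nn_integral_0_iff_AE)
    moreover have "?\<Gamma> w \<ge> 0" for w
      using cross_le_mean[of "w *v x" "w *v y"] by (simp add: \<Delta>_def)
    ultimately show ?thesis
      by (elim eventually_mono) (metis ennreal_eq_0_iff order_antisym)
  qed
  then have "AE \<omega> in PiM {..<n} (\<lambda>_. \<mu>). \<exists>c. (outer x + outer y) ** cadjoint (W n \<omega>) ** W n \<omega> ** (outer x + outer y)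
      = map_matrix (\<lambda>z. c * z) (outer x + outer y)" for n
  proof (rule eventually_mono)
    fix \<omega> assume "\<Delta> (W n \<omega> *v x, W n \<omega> *v y) = 0"
    then have "norm (W n \<omega> *v x) = norm (W n \<omega> *v y)" "cinner (W n \<omega> *v x) (W n \<omega> *v y) = 0"
      using cross_eq_mean unfolding \<Delta>_def by auto
    then show "\<exists>c. (outer x + outer y) ** cadjoint (W n \<omega>) ** W n \<omega> ** (outer x + outer y)
      = map_matrix (\<lambda>z. c * z) (outer x + outer y)"
      using outer_sum_compression by blast
  qed
  moreover have "outer x + outer y \<noteq> 0"
  proof
    assume "outer x + outer y = 0"
    then have "(outer x + outer y) *v x = 0" by simp
    then have "x = 0" by (simp add: outer_sum_mult cinner_self o cinner_eq_0_sym[OF o(3)])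
    then show False using o(1) by simp
  qed
  ultimately have "rank (outer x + outer y) = 1"
    using pur orthogonal_projector_outer_sum[OF o] unfolding purifying_def by blast
  then show False using rank_outer_sum[OF o] by simp
qed

text \<open>The continuous functions \<open>wedge n\<close> decrease in \<open>n\<close> on the compact set of orthonormal pairs. If their
  maxima were all \<open>1\<close>, a limit point of near-maximisers would have mean area \<open>1\<close> for every \<open>n\<close>.\<close>

lemma wedge_uniform_contraction:
  assumes pur: "purifying \<mu>"
  shows "\<exists>n \<kappa>. 0 \<le> \<kappa> \<and> \<kappa> < 1 \<and> (\<forall>z. orthonormal_pair z \<longrightarrow> wedge n z \<le> \<kappa>)"
proof (rule ccontr)
  assume no: "\<not> ?thesis"
  have "\<exists>z. orthonormal_pair z \<and> wedge k z > 1 - 1 / real (Suc k)" for k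
  proof (rule ccontr)
    assume "\<not> (\<exists>z. orthonormal_pair z \<and> wedge k z > 1 - 1 / real (Suc k))"
    then have "\<forall>z. orthonormal_pair z \<longrightarrow> wedge k z \<le> 1 - 1 / real (Suc k)"
      by (meson not_le)
    moreover have "0 \<le> 1 - 1 / real (Suc k)" "1 - 1 / real (Suc k) < 1"
      by (simp_all add: field_simps)
    ultimately show False using no by blast
  qed
  then obtain s where s: "\<And>k. orthonormal_pair (s k)" "\<And>k. wedge k (s k) > 1 - 1 / real (Suc k)"
    by metis
  have "\<forall>k. s k \<in> {z. orthonormal_pair z}" using s(1) by simp
  then obtain l r where l: "l \<in> {z. orthonormal_pair z}" and r: "strict_mono (r :: nat \<Rightarrow> nat)"
    and lim: "(s \<circ> r) \<longlonglongrightarrow> l"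
    using compact_orthonormal_pair[unfolded compact_def] by meson
  have "1 \<le> wedge n l" for n
  proof (rule LIMSEQ_le)
    show "(\<lambda>k. 1 - 1 / real (Suc k)) \<longlonglongrightarrow> 1"
      using tendsto_diff[OF tendsto_const LIMSEQ_inverse_real_of_nat, of 1] by (simp add: inverse_eq_divide)
    have "continuous_on UNIV (wedge n)" by (rule quad_growth_continuous[OF quad_growth_wedge])
    then show "(\<lambda>k. wedge n (s (r k))) \<longlonglongrightarrow> wedge n l"
      using lim unfolding continuous_on_sequentially comp_def by blast
    show "\<exists>N. \<forall>k\<ge>N. 1 - 1 / real (Suc k) \<le> wedge n (s (r k))"
    proof (intro exI[of _ n] allI impI)
      fix k assume "k \<ge> n"
      have "k \<le> r k" using r by (rule seq_suble)
      have "1 - 1 / real (Suc k) \<le> 1 - 1 / real (Suc (r k))"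
        using \<open>k \<le> r k\<close> by (simp add: frac_le)
      also have "\<dots> \<le> wedge (r k) (s (r k))" using s(2)[of "r k"] by simp
      also have "\<dots> \<le> wedge n (s (r k))"
        using \<open>k \<ge> n\<close> \<open>k \<le> r k\<close> by (intro wedge_antimono) simp
      finally show "1 - 1 / real (Suc k) \<le> wedge n (s (r k))" .
    qed
  qed
  then show False
    using wedge_contracts_some[OF pur] l by (meson mem_Collect_eq not_le)
qed

text \<open>Submultiplicativity turns one strict contraction into exponential decay.\<close>

lemma wedge_tendsto_0:
  assumes pur: "purifying \<mu>" and "\<epsilon> > 0"
  shows "\<exists>N. \<forall>n\<ge>N. \<forall>z. wedge n z \<le> \<epsilon> * cross (fst z) (snd z)"
proof -
  obtain n \<kappa> where \<kappa>: "0 \<le> \<kappa>" "\<kappa> < 1" "\<And>z. orthonormal_pair z \<Longrightarrow> wedge n z \<le> \<kappa>"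
    using wedge_uniform_contraction[OF pur] by blast
  have pow: "wedge (n * k) z \<le> \<kappa> ^ k * cross (fst z) (snd z)" for k z
  proof (induction k)
    case (Suc k)
    have "wedge (n * Suc k) z \<le> \<kappa> * wedge (n * k) z"
      using wedge_submultiplicative[of \<kappa> n "n * k" z] \<kappa> by (simp add: add.commute)
    also have "\<dots> \<le> \<kappa> * (\<kappa> ^ k * cross (fst z) (snd z))"
      by (intro mult_left_mono Suc \<kappa>)
    finally show ?case by simp
  qed simp
  obtain k where k: "\<kappa> ^ k < \<epsilon>" using real_arch_pow_inv[OF \<open>\<epsilon> > 0\<close> \<kappa>(2)] by blast
  have "wedge m z \<le> \<epsilon> * cross (fst z) (snd z)" if "m \<ge> n * k" for m z
  proof -
    have "wedge m z \<le> wedge (n * k) z" using that by (rule wedge_antimono)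
    also have "\<dots> \<le> \<kappa> ^ k * cross (fst z) (snd z)" by (rule pow)
    also have "\<dots> \<le> \<epsilon> * cross (fst z) (snd z)" using k by (intro mult_right_mono) auto
    finally show ?thesis .
  qed
  then show ?thesis by blast
qed

end

section \<open>Fixed quadratic forms under ergodicity\<close>

text \<open>Hermitian forms through their values on the diagonal. The parallelogram law survives pointwise
  limits and needs no choice of a matrix.\<close>

definition quadratic_form :: "(complex ^ 'n \<Rightarrow> real) \<Rightarrow> bool" where
  "quadratic_form q \<longleftrightarrow>
     (\<forall>x y. q (x + y) + q (x - y) = 2 * q x + 2 * q y) \<and> (\<forall>c x. q (c *s x) = (cmod c)\<^sup>2 * q x)"

lemma norm_sq_parallelogram:
  "(norm (x + y))\<^sup>2 + (norm (x - y))\<^sup>2 = 2 * (norm x)\<^sup>2 + 2 * (norm (y :: 'a::real_inner))\<^sup>2"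
  by (simp add: power2_norm_eq_inner inner_add_left inner_add_right inner_diff_left inner_diff_right)

lemma quadratic_form_norm_sq: "quadratic_form (\<lambda>x :: complex ^ 'n. (norm x)\<^sup>2)"
  by (simp add: quadratic_form_def norm_sq_parallelogram norm_vector_smult power_mult_distrib)

lemma quadratic_form_lincomb:
  assumes "quadratic_form q" "quadratic_form r"
  shows "quadratic_form (\<lambda>x. a * q x + b * r x)"
  unfolding quadratic_form_def
proof (intro conjI allI)
  fix x y c
  have "q (x + y) + q (x - y) = 2 * q x + 2 * q y" "r (x + y) + r (x - y) = 2 * r x + 2 * r y"
    "q (c *s x) = (cmod c)\<^sup>2 * q x" "r (c *s x) = (cmod c)\<^sup>2 * r x"
    using assms unfolding quadratic_form_def by blast+
  note e = this
  have "(a * q (x + y) + b * r (x + y)) + (a * q (x - y) + b * r (x - y))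
      = a * (q (x + y) + q (x - y)) + b * (r (x + y) + r (x - y))"
    by (simp add: algebra_simps)
  then show "(a * q (x + y) + b * r (x + y)) + (a * q (x - y) + b * r (x - y))
      = 2 * (a * q x + b * r x) + 2 * (a * q y + b * r y)"
    unfolding e by (simp add: algebra_simps)
  show "a * q (c *s x) + b * r (c *s x) = (cmod c)\<^sup>2 * (a * q x + b * r x)"
    unfolding e by (simp add: algebra_simps)
qed

lemma homogeneous_sphere_le:
  fixes q :: "complex ^ 'n \<Rightarrow> real"
  assumes "\<And>c x. q (c *s x) = (cmod c)\<^sup>2 * q x" and "\<And>x. norm x = 1 \<Longrightarrow> q x \<le> K"
  shows "q x \<le> K * (norm x)\<^sup>2"
proof (cases "x = 0")
  case True
  then show ?thesis using assms(1)[of 0 x] by simp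
next
  case False
  let ?u = "complex_of_real (1 / norm x) *s x"
  have "x = complex_of_real (norm x) *s ?u"
    using False by (simp add: vector_smult_assoc)
  then have "q x = (norm x)\<^sup>2 * q ?u"
    using assms(1)[of "complex_of_real (norm x)" ?u] by simp
  also have "\<dots> \<le> (norm x)\<^sup>2 * K"
    using False by (intro mult_left_mono assms(2) normalize_unit) auto
  finally show ?thesis by (simp add: mult.commute)
qed

text \<open>For a nonnegative form, \<open>q (x + y) + q (x - y) = 0\<close> forces both terms to vanish.\<close>

lemma quadratic_form_zero_subspace:
  assumes q: "quadratic_form q" and nonneg: "\<And>x. q x \<ge> 0"
  shows "vec.subspace {x. q x = 0}"
  unfolding vec.subspace_def
proof (intro conjI ballI allI)
  have sm: "q (c *s x) = (cmod c)\<^sup>2 * q x" for c x using q by (simp add: quadratic_form_def)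
  show "0 \<in> {x. q x = 0}" using sm[of 0 0] by simp
  show "c *s x \<in> {x. q x = 0}" if "x \<in> {x. q x = 0}" for c x using that by (simp add: sm)
  show "x + y \<in> {x. q x = 0}" if "x \<in> {x. q x = 0}" "y \<in> {x. q x = 0}" for x y
  proof -
    have "q (x + y) + q (x - y) = 0" using q that by (simp add: quadratic_form_def)
    then show ?thesis using nonneg[of "x + y"] nonneg[of "x - y"] by simp
  qed
qed

text \<open>Take an invariant subspace of least dimension.\<close>

lemma exists_minimal_invariant_subspace:
  assumes "nonzero_invariant_subspace \<mu> F"
  shows "\<exists>E \<subseteq> F. nonzero_invariant_subspace \<mu> E \<and> (\<forall>F'. nonzero_invariant_subspace \<mu> F' \<and> F' \<subseteq> E \<longrightarrow> F' = E)"
proof -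
  let ?P = "\<lambda>E. nonzero_invariant_subspace \<mu> E \<and> E \<subseteq> F"
  obtain E where E: "?P E" "\<And>F'. ?P F' \<Longrightarrow> vec.dim E \<le> vec.dim F'"
    using ex_has_least_nat[of ?P F vec.dim] assms by blast
  have "F' = E" if "nonzero_invariant_subspace \<mu> F'" "F' \<subseteq> E" for F'
  proof (rule vec.subspace_dim_equal)
    show "vec.subspace F'" "vec.subspace E"
      using that E(1) by (simp_all add: nonzero_invariant_subspace_def)
    show "vec.dim E \<le> vec.dim F'"
      using that E(1) by (intro E(2)) auto
  qed (rule that)
  then show ?thesis using E(1) by blast
qed

context kraus_measure
begin

text \<open>If \<open>q x = 0\<close> then the nonnegative function \<open>v \<mapsto> q (v *v x)\<close> has integral \<open>q x = 0\<close>, so it vanishes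
  almost everywhere and, being continuous, on the support.\<close>

lemma zero_set_invariant:
  assumes q: "quadratic_form q" "quad_growth q" and nonneg: "\<And>x. q x \<ge> 0"
    and fixed: "\<And>x. transfer (*v) q x = q x"
    and x: "x \<noteq> 0" "q x = 0"
  shows "nonzero_invariant_subspace \<mu> {x. q x = 0}"
  unfolding nonzero_invariant_subspace_def
proof (intro conjI ballI)
  show "vec.subspace {x. q x = 0}"
    using q(1) nonneg by (rule quadratic_form_zero_subspace)
  show "{x. q x = 0} \<noteq> {0}" using x by blast
  fix v assume v: "v \<in> msupport \<mu>"
  have "q (v *v y) = 0" if y: "q y = 0" for y
  proof (rule ccontr)
    assume nz: "q (v *v y) \<noteq> 0"
    let ?U = "{w. q (w *v y) \<noteq> 0}"
    have "continuous_on UNIV (\<lambda>w :: complex ^ 'n ^ 'n. q (w *v y))"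
      by (rule continuous_on_compose2[OF quad_growth_continuous[OF q(2)]]) (auto intro!: continuous_intros)
    then have U: "open ?U"
      by (intro open_Collect_neq continuous_on_const)
    have "(\<integral>w. q (w *v y) \<partial>\<mu>) = 0"
      using fixed[of y] y by (simp add: transfer_def)
    then have "AE w in \<mu>. q (w *v y) = 0"
      using integrable_action[OF matrix_action_vec q(2)] nonneg
      by (subst (asm) integral_nonneg_eq_0_iff_AE) auto
    then have "emeasure \<mu> ?U = 0"
      using U by (subst (asm) AE_iff_measurable[OF _ refl]) auto
    then show False using v U nz unfolding msupport_def by blast
  qed
  then show "(*v) v ` {x. q x = 0} \<subseteq> {x. q x = 0}" by auto
qed

text \<open>A non-constant fixed form would have two invariant zero sets, those of its distances to its
  largest and its smallest value on the sphere, and these sets only meet in \<open>0\<close>.\<close>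

lemma fixed_quadratic_form_const:
  assumes erg: "ergodic \<mu>" and q: "quadratic_form q" "quad_growth q"
    and fixed: "\<And>x. transfer (*v) q x = q x"
  shows "\<exists>c. \<forall>x. q x = c * (norm x)\<^sup>2"
proof -
  let ?S = "sphere (0 :: complex ^ 'n) 1"
  have S: "compact ?S" "?S \<noteq> {}"
    by (auto intro!: exI[of _ "unit_rep undefined"] simp: unit_rep)
  have cont: "continuous_on ?S q"
    using quad_growth_continuous[OF q(2)] by (rule continuous_on_subset) simp
  obtain a where a: "norm a = 1" "\<And>x. norm x = 1 \<Longrightarrow> q x \<le> q a"
    using continuous_attains_sup[OF S cont] by auto
  obtain b where b: "norm b = 1" "\<And>x. norm x = 1 \<Longrightarrow> q b \<le> q x"
    using continuous_attains_inf[OF S cont] by auto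
  have sm: "q (c *s x) = (cmod c)\<^sup>2 * q x" for c x using q by (simp add: quadratic_form_def)
  have ub: "q x \<le> q a * (norm x)\<^sup>2" for x
    using sm a(2) by (rule homogeneous_sphere_le)
  have lb: "q b * (norm x)\<^sup>2 \<le> q x" for x
    using homogeneous_sphere_le[of "\<lambda>x. - q x" "- q b" x] sm b(2) by simp
  \<comment> \<open>Used for \<open>q a * (norm x)\<^sup>2 - q x\<close> and for \<open>q x - q b * (norm x)\<^sup>2\<close>.\<close>
  have ex: "\<exists>E \<subseteq> {x. s * q x + t * (norm x)\<^sup>2 = 0}. nonzero_invariant_subspace \<mu> E \<and>
      (\<forall>F'. nonzero_invariant_subspace \<mu> F' \<and> F' \<subseteq> E \<longrightarrow> F' = E)"
    if nonneg: "\<And>x. s * q x + t * (norm x)\<^sup>2 \<ge> 0" and z: "norm z = 1" "s * q z + t * (norm z)\<^sup>2 = 0" for s t z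
  proof (intro exists_minimal_invariant_subspace zero_set_invariant)
    show "transfer (*v) (\<lambda>x. s * q x + t * (norm x)\<^sup>2) x = s * q x + t * (norm x)\<^sup>2" for x
    proof -
      note act = matrix_action_vec
      have "transfer (*v) (\<lambda>x. s * q x + t * (norm x)\<^sup>2) x
          = s * transfer (*v) q x + t * transfer (*v) (\<lambda>x. (norm x)\<^sup>2) x"
        using integrable_action[OF act q(2), of x] integrable_action[OF act quad_growth_norm_sq, of x]
        by (simp add: transfer_def)
      moreover have "transfer (*v) (\<lambda>x. (norm x)\<^sup>2) x = (norm x)\<^sup>2"
        by (simp add: transfer_def integral_norm_sq)
      ultimately show ?thesis by (simp only: fixed)
    qed
    show "z \<noteq> 0" using z(1) by force
  qed (use nonneg z q in \<open>auto intro!: quadratic_form_lincomb quadratic_form_norm_sq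
      quad_growth_add quad_growth_cmult quad_growth_norm_sq\<close>)
  obtain E1 where E1: "E1 \<subseteq> {x. - 1 * q x + q a * (norm x)\<^sup>2 = 0}" "nonzero_invariant_subspace \<mu> E1"
    "\<forall>F'. nonzero_invariant_subspace \<mu> F' \<and> F' \<subseteq> E1 \<longrightarrow> F' = E1"
    using ex[of "- 1" "q a" a] ub a(1) by auto
  obtain E2 where E2: "E2 \<subseteq> {x. 1 * q x + (- q b) * (norm x)\<^sup>2 = 0}" "nonzero_invariant_subspace \<mu> E2"
    "\<forall>F'. nonzero_invariant_subspace \<mu> F' \<and> F' \<subseteq> E2 \<longrightarrow> F' = E2"
    using ex[of 1 "- q b" b] lb b(1) by auto
  have "E1 = E2"
    using erg E1(2,3) E2(2,3) unfolding ergodic_def by blast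
  moreover obtain x where "x \<in> E1" "x \<noteq> 0"
    using E1(2) vec.subspace_0 unfolding nonzero_invariant_subspace_def by blast
  ultimately have "- 1 * q x + q a * (norm x)\<^sup>2 = 0" "1 * q x + (- q b) * (norm x)\<^sup>2 = 0"
    using E1(1) E2(1) by blast+
  then have "q a * (norm x)\<^sup>2 = q b * (norm x)\<^sup>2" by simp
  then have "q a = q b" using \<open>x \<noteq> 0\<close> by simp
  then have "q x = q a * (norm x)\<^sup>2" for x
    using ub[of x] lb[of x] by simp
  then show ?thesis by blast
qed

section \<open>The Markov operator on continuous functions\<close>

text \<open>The transition operator, acting on functions on projective space.\<close>

definition markov :: "('n cproj \<Rightarrow> real) \<Rightarrow> 'n cproj \<Rightarrow> real" where
  "markov f p = transfer (*v) (hom2 f) (unit_rep p)"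

lemma transfer_hom2_smult: "transfer (*v) (hom2 f) (c *s z) = (cmod c)\<^sup>2 * transfer (*v) (hom2 f) z"
  by (simp add: transfer_def vector_scalar_commute hom2_smult)

lemma hom2_markov: "hom2 (markov f) = transfer (*v) (hom2 f)"
proof
  fix z
  show "hom2 (markov f) z = transfer (*v) (hom2 f) z"
  proof (cases "z = 0")
    case True
    then show ?thesis using transfer_hom2_smult[of f 0 0] by (simp add: hom2_def)
  next
    case False
    then obtain c where c: "z = c *s unit_rep (proj z)" "cmod c = norm z"
      by (rule norm_smult_unit_rep)
    have "transfer (*v) (hom2 f) z = (norm z)\<^sup>2 * transfer (*v) (hom2 f) (unit_rep (proj z))"
      by (subst c(1)) (simp only: transfer_hom2_smult c(2))
    then show ?thesis by (simp add: hom2_def markov_def)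
  qed
qed

text \<open>The Feller property. The map \<open>p \<mapsto> act v p\<close> is discontinuous at lines in the kernel of \<open>v\<close>, but the
  weight vanishes there, which is why the argument runs through \<open>hom2 f\<close>.\<close>

lemma continuous_on_markov:
  assumes "continuous_on UNIV f"
  shows "continuous_on UNIV (markov f)"
proof -
  let ?T = "transfer (*v) (hom2 f)"
  have T: "continuous_on UNIV ?T"
    by (intro quad_growth_continuous quad_growth_transfer matrix_action_vec quad_growth_hom2 assms)
  have "continuous_on UNIV (\<lambda>(a :: real, p). ?T (unit_rep p))"
  proof (rule continuous_on_unit_rep)
    show "continuous_on UNIV (\<lambda>(a :: real, x). ?T x)"
      unfolding case_prod_beta
      by (rule continuous_on_compose2[OF T]) (auto intro!: continuous_intros)
  qed (simp add: transfer_hom2_smult)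
  then have "continuous_on UNIV (\<lambda>p. (\<lambda>(a :: real, p). ?T (unit_rep p)) (0, p))"
    by (rule continuous_on_compose2) (auto intro!: continuous_intros)
  then show ?thesis by (simp add: markov_def[abs_def])
qed

lemma continuous_on_markov_pow:
  "continuous_on UNIV f \<Longrightarrow> continuous_on UNIV ((markov ^^ j) f)"
  by (induction j) (auto intro: continuous_on_markov)

lemma hom2_markov_pow: "hom2 ((markov ^^ j) f) = (transfer (*v) ^^ j) (hom2 f)"
  by (induction j) (simp_all add: hom2_markov)

lemma markov_bound:
  assumes f: "continuous_on UNIV f" "\<And>p. \<bar>f p\<bar> \<le> C"
  shows "\<bar>markov f p\<bar> \<le> C"
proof -
  have "\<bar>transfer (*v) (hom2 f) (unit_rep p)\<bar> \<le> transfer (*v) (\<lambda>z. C * (norm z)\<^sup>2) (unit_rep p)"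
    using transfer_pow_abs_le[OF matrix_action_vec quad_growth_hom2[OF f(1)]
        quad_growth_cmult[OF quad_growth_norm_sq] hom2_bound[OF f(2)], of 1] by simp
  then show ?thesis
    by (simp add: markov_def transfer_def integral_norm_sq unit_rep)
qed

lemma markov_pow_bound:
  assumes f: "continuous_on UNIV f" "\<And>p. \<bar>f p\<bar> \<le> C"
  shows "\<bar>(markov ^^ j) f p\<bar> \<le> C"
proof (induction j arbitrary: p)
  case (Suc j)
  then show ?case by (simp add: markov_bound[OF continuous_on_markov_pow[OF f(1)]])
qed (simp add: f)

end

section \<open>Asymptotic quadraticity\<close>

lemma sum_norm_columns_sq:
  fixes w :: "complex ^ 'n ^ 'n"
  shows "(\<Sum>i\<in>UNIV. (norm (w *v axis i 1))\<^sup>2) = (norm w)\<^sup>2"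
proof -
  have "(\<Sum>i\<in>UNIV. (norm (w *v axis i 1))\<^sup>2) = (\<Sum>i\<in>UNIV. \<Sum>k\<in>UNIV. (cmod (w $ k $ i))\<^sup>2)"
    by (simp add: norm_vec_def L2_set_def sum_nonneg matrix_vector_mult_axis)
  also have "\<dots> = (norm w)\<^sup>2"
    by (subst sum.swap) (simp add: norm_vec_def L2_set_def sum_nonneg)
  finally show ?thesis .
qed

text \<open>The value of \<open>f\<close> at a typical point of the image of \<open>w\<close>: the average of its values at the
  images of the basis lines, weighted by their squared lengths.\<close>

definition column_average :: "('n cproj \<Rightarrow> real) \<Rightarrow> complex ^ 'n ^ ('n :: finite) \<Rightarrow> real" where
  "column_average f w = (\<Sum>i\<in>UNIV. hom2 f (w *v axis i 1)) / (norm w)\<^sup>2"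

lemma column_average_bound:
  assumes "\<And>p. \<bar>f p\<bar> \<le> C"
  shows "\<bar>column_average f w\<bar> \<le> C"
proof (cases "w = 0")
  case True
  then show ?thesis using assms[of undefined] by (simp add: column_average_def)
next
  case False
  have "\<bar>\<Sum>i\<in>UNIV. hom2 f (w *v axis i 1)\<bar> \<le> (\<Sum>i\<in>UNIV. \<bar>hom2 f (w *v axis i 1)\<bar>)"
    by (rule sum_abs)
  also have "\<dots> \<le> (\<Sum>i\<in>UNIV. C * (norm (w *v axis i 1))\<^sup>2)"
    by (intro sum_mono hom2_bound assms)
  also have "\<dots> = C * (norm w)\<^sup>2"
    by (simp only: sum_distrib_left[symmetric] sum_norm_columns_sq)
  finally show ?thesis using False by (simp add: column_average_def divide_le_eq)
qed

lemma norm_matrix_vector_mult_sq_le: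
  fixes w :: "complex ^ 'n ^ 'n"
  shows "(norm (w *v x))\<^sup>2 \<le> (norm x)\<^sup>2 * (norm w)\<^sup>2"
  using power_mono[OF norm_matrix_vector_mult_le[of w x], of 2] by (simp add: power_mult_distrib mult.commute)

lemma quad_growth_column_average:
  fixes f :: "('n :: finite) cproj \<Rightarrow> real"
  assumes f: "continuous_on UNIV f"
  shows "quad_growth (\<lambda>w. column_average f w * (norm (w *v x))\<^sup>2)"
proof -
  obtain C where C: "C > 0" "\<And>p. \<bar>f p\<bar> \<le> C"
    using continuous_bounded_cproj[OF f] by blast
  show ?thesis
  proof (rule quad_growthI_punctured)
    show "continuous_on (- {0}) (\<lambda>w. column_average f w * (norm (w *v x))\<^sup>2)"
      unfolding column_average_def
      by (intro continuous_intros continuous_on_compose2[OF continuous_on_hom2[OF f]]) auto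
    show "\<bar>column_average f w * (norm (w *v x))\<^sup>2\<bar> \<le> (C * (norm x)\<^sup>2) * (norm w)\<^sup>2" for w
    proof -
      have "\<bar>column_average f w\<bar> * (norm (w *v x))\<^sup>2 \<le> C * ((norm x)\<^sup>2 * (norm w)\<^sup>2)"
        using C by (intro mult_mono column_average_bound norm_matrix_vector_mult_sq_le) auto
      then show ?thesis by (simp add: abs_mult mult.assoc)
    qed
  qed
qed

text \<open>Uniform continuity in the form that survives integration against unbounded weights.\<close>

lemma uniform_modulus_cproj:
  fixes f :: "('n :: finite) cproj \<Rightarrow> real"
  assumes f: "continuous_on UNIV f" and "\<epsilon> > 0"
  obtains K where "K \<ge> 0" "\<And>p q. \<bar>f p - f q\<bar> \<le> \<epsilon> + K * dist p q"
proof -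
  obtain C where C: "C > 0" "\<And>p. \<bar>f p\<bar> \<le> C"
    using continuous_bounded_cproj[OF f] by blast
  obtain \<delta> where \<delta>: "\<delta> > 0" "\<And>p q. dist p q < \<delta> \<Longrightarrow> \<bar>f p - f q\<bar> < \<epsilon>"
    using compact_uniformly_continuous[OF f compact_cproj] \<open>\<epsilon> > 0\<close>
    unfolding uniformly_continuous_on_def dist_real_def by (metis UNIV_I)
  have "\<bar>f p - f q\<bar> \<le> \<epsilon> + 2 * C / \<delta> * dist p q" for p q
  proof (cases "dist p q < \<delta>")
    case True
    moreover have "0 \<le> 2 * C / \<delta> * dist p q" using C(1) \<delta>(1) by simp
    ultimately show ?thesis using \<delta>(2)[of p q] by linarith
  next
    case False
    have "\<bar>f p - f q\<bar> \<le> 2 * C" using C(2)[of p] C(2)[of q] by linarith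
    also have "\<dots> \<le> 2 * C / \<delta> * dist p q"
      using False C(1) \<delta>(1) by (simp add: field_simps)
    finally show ?thesis using \<open>\<epsilon> > 0\<close> by linarith
  qed
  then show ?thesis using that[of "2 * C / \<delta>"] C(1) \<delta>(1) by simp
qed

text \<open>For each column \<open>w e\<^sub>i\<close> the error is the oscillation of \<open>f\<close> between the lines of \<open>w x\<close> and \<open>w e\<^sub>i\<close>,
  weighted by \<open>\<parallel>w x\<parallel>\<^sup>2 \<parallel>w e\<^sub>i\<parallel>\<^sup>2 / \<parallel>w\<parallel>\<^sup>2\<close>. The distance of these lines times \<open>\<parallel>w x\<parallel> \<parallel>w e\<^sub>i\<parallel>\<close> is the
  area \<open>\<parallel>w x \<and> w e\<^sub>i\<parallel>\<close>, and the remaining weight is at most \<open>1\<close>.\<close>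

lemma column_average_approx:
  fixes w :: "complex ^ 'n ^ 'n"
  assumes K: "K \<ge> 0" "\<And>p q. \<bar>f p - f q\<bar> \<le> \<epsilon> + K * dist p q" and x: "norm x \<le> 1"
  shows "\<bar>hom2 f (w *v x) - column_average f w * (norm (w *v x))\<^sup>2\<bar>
    \<le> \<epsilon> * (norm (w *v x))\<^sup>2 + K * (\<Sum>i\<in>UNIV. cross (w *v x) (w *v axis i 1))"
proof (cases "w = 0")
  case True
  have "cross (0 :: complex ^ 'n) 0 = 0" using cross_le[of "0 :: complex ^ 'n" 0] cross_nonneg[of "0 :: complex ^ 'n" 0] by simp
  then show ?thesis using True by (simp add: hom2_def)
next
  case False
  define a where "a i = norm (w *v axis i 1)" for i
  define b where "b = norm (w *v x)"
  define N where "N = norm w"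
  have N: "N > 0" using False by (simp add: N_def)
  have aN: "a i \<le> N" for i
    using norm_matrix_vector_mult_le[of w "axis i 1"] by (simp add: a_def N_def)
  have bN: "b \<le> N"
    using norm_matrix_vector_mult_le[of w x] mult_left_mono[OF x, of "norm w"] by (simp add: b_def N_def)
  have nn: "a i \<ge> 0" "b \<ge> 0" for i by (simp_all add: a_def b_def)
  have sa: "(\<Sum>i\<in>UNIV. (a i)\<^sup>2) = N\<^sup>2" unfolding a_def N_def by (rule sum_norm_columns_sq)
  have each: "\<bar>(a i)\<^sup>2 * hom2 f (w *v x) - hom2 f (w *v axis i 1) * b\<^sup>2\<bar>
      \<le> \<epsilon> * (a i)\<^sup>2 * b\<^sup>2 + K * (cross (w *v x) (w *v axis i 1) * N\<^sup>2)" for i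
  proof (cases "w *v x = 0 \<or> w *v axis i 1 = 0")
    case True
    then have z: "(a i)\<^sup>2 * hom2 f (w *v x) - hom2 f (w *v axis i 1) * b\<^sup>2 = 0" "(a i)\<^sup>2 * b\<^sup>2 = 0"
      by (auto simp: a_def b_def hom2_def)
    show ?thesis unfolding z(1) mult.assoc z(2) using K(1) by simp
  next
    case False
    let ?p = "proj (w *v x)" and ?q = "proj (w *v axis i 1)"
    have d: "dist ?p ?q * (b * a i) = cross (w *v x) (w *v axis i 1)"
      unfolding a_def b_def using False by (intro dist_proj_mult) auto
    have "\<bar>(a i)\<^sup>2 * hom2 f (w *v x) - hom2 f (w *v axis i 1) * b\<^sup>2\<bar> = (a i)\<^sup>2 * b\<^sup>2 * \<bar>f ?p - f ?q\<bar>"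
    proof -
      have "(a i)\<^sup>2 * hom2 f (w *v x) - hom2 f (w *v axis i 1) * b\<^sup>2 = (a i)\<^sup>2 * b\<^sup>2 * (f ?p - f ?q)"
        by (simp add: hom2_def a_def b_def algebra_simps)
      then show ?thesis by (simp add: abs_mult)
    qed
    also have "\<dots> \<le> (a i)\<^sup>2 * b\<^sup>2 * (\<epsilon> + K * dist ?p ?q)"
      by (intro mult_left_mono K(2)) simp
    also have "\<dots> = \<epsilon> * (a i)\<^sup>2 * b\<^sup>2 + K * (cross (w *v x) (w *v axis i 1) * (a i * b))"
      unfolding d[symmetric] by (simp add: power2_eq_square algebra_simps)
    also have "\<dots> \<le> \<epsilon> * (a i)\<^sup>2 * b\<^sup>2 + K * (cross (w *v x) (w *v axis i 1) * N\<^sup>2)"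
      using K(1) nn aN bN unfolding power2_eq_square[of N]
      by (intro add_left_mono mult_left_mono mult_mono) auto
    finally show ?thesis .
  qed
  have eq: "hom2 f (w *v x) - column_average f w * b\<^sup>2
      = (\<Sum>i\<in>UNIV. (a i)\<^sup>2 * hom2 f (w *v x) - hom2 f (w *v axis i 1) * b\<^sup>2) / N\<^sup>2"
  proof -
    have "(\<Sum>i\<in>UNIV. (a i)\<^sup>2 * hom2 f (w *v x) - hom2 f (w *v axis i 1) * b\<^sup>2)
        = N\<^sup>2 * hom2 f (w *v x) - (\<Sum>i\<in>UNIV. hom2 f (w *v axis i 1)) * b\<^sup>2"
      by (simp add: sum_subtractf sum_distrib_right[symmetric] sa)
    then show ?thesis using N by (simp add: column_average_def N_def[symmetric] field_simps)
  qed
  have "\<bar>\<Sum>i\<in>UNIV. (a i)\<^sup>2 * hom2 f (w *v x) - hom2 f (w *v axis i 1) * b\<^sup>2\<bar>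
      \<le> (\<Sum>i\<in>UNIV. \<epsilon> * (a i)\<^sup>2 * b\<^sup>2 + K * (cross (w *v x) (w *v axis i 1) * N\<^sup>2))"
    by (rule order_trans[OF sum_abs]) (intro sum_mono each)
  also have "\<dots> = (\<epsilon> * b\<^sup>2 + K * (\<Sum>i\<in>UNIV. cross (w *v x) (w *v axis i 1))) * N\<^sup>2"
    by (simp add: sum.distrib sum_distrib_right[symmetric] sum_distrib_left[symmetric] sa algebra_simps)
  finally show ?thesis
    unfolding b_def[symmetric] eq using N by (simp add: divide_le_eq)
qed

context kraus_product
begin

lemma transfer_pow_matrix_vec:
  "(transfer (**) ^^ n) (\<lambda>w. G (w *v x)) (mat 1) = (transfer (*v) ^^ n) G x"
  using transfer_pow_intertwine[of "\<lambda>w. w *v x" "(**)" "(*v)" n G]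
  by (simp add: matrix_vector_mul_assoc)

text \<open>In \<open>\<Pi>\<^sup>n f (x) = \<integral> f (W\<^sub>n \<cdot> x) \<parallel>W\<^sub>n x\<parallel>\<^sup>2 d\<mu>\<^sup>\<otimes>\<^sup>n\<close> the value of \<open>f\<close> is replaced by one that does not
  involve \<open>x\<close>; what is left depends on \<open>x\<close> quadratically.\<close>

definition asymptotic_form :: "('n cproj \<Rightarrow> real) \<Rightarrow> nat \<Rightarrow> complex ^ 'n \<Rightarrow> real" where
  "asymptotic_form f n x = (transfer (**) ^^ n) (\<lambda>w. column_average f w * (norm (w *v x))\<^sup>2) (mat 1)"

lemma quadratic_form_asymptotic_form:
  assumes f: "continuous_on UNIV f"
  shows "quadratic_form (asymptotic_form f n)"
  unfolding quadratic_form_def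
proof (intro conjI allI)
  note act = matrix_action_matrix and q = quad_growth_column_average[OF f]
  fix x y :: "complex ^ 'n" and c
  have "column_average f w * (norm (w *v (x + y)))\<^sup>2 + column_average f w * (norm (w *v (x - y)))\<^sup>2
      = 2 * (column_average f w * (norm (w *v x))\<^sup>2) + 2 * (column_average f w * (norm (w *v y))\<^sup>2)" for w
    using arg_cong[OF norm_sq_parallelogram[of "w *v x" "w *v y"], of "\<lambda>t. column_average f w * t"]
    by (simp add: matrix_vector_right_distrib matrix_vector_mult_diff_distrib algebra_simps)
  then have "(transfer (**) ^^ n) (\<lambda>w. column_average f w * (norm (w *v (x + y)))\<^sup>2
        + column_average f w * (norm (w *v (x - y)))\<^sup>2) (mat 1)
      = (transfer (**) ^^ n) (\<lambda>w. 2 * (column_average f w * (norm (w *v x))\<^sup>2)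
        + 2 * (column_average f w * (norm (w *v y))\<^sup>2)) (mat 1)"
    by presburger
  then show "asymptotic_form f n (x + y) + asymptotic_form f n (x - y)
      = 2 * asymptotic_form f n x + 2 * asymptotic_form f n y"
    unfolding asymptotic_form_def
    by (simp add: transfer_pow_add[OF act q q] transfer_pow_cmult
        transfer_pow_add[OF act quad_growth_cmult[OF q] quad_growth_cmult[OF q]])
  have e: "column_average f w * (norm (w *v (c *s x)))\<^sup>2 = (cmod c)\<^sup>2 * (column_average f w * (norm (w *v x))\<^sup>2)" for w
    by (simp add: vector_scalar_commute norm_vector_smult power_mult_distrib)
  show "asymptotic_form f n (c *s x) = (cmod c)\<^sup>2 * asymptotic_form f n x"
    unfolding asymptotic_form_def by (simp only: e transfer_pow_cmult)
qed

text \<open>A Lipschitz bound that is uniform in \<open>n\<close>, because the mean of \<open>(norm (W n \<omega>))\<^sup>2\<close> is the dimension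
  for every \<open>n\<close>. It supplies the equicontinuity for the compactness argument below.\<close>

lemma asymptotic_form_diff_bound:
  assumes f: "continuous_on UNIV f" "\<And>p. \<bar>f p\<bar> \<le> C"
  shows "\<bar>asymptotic_form f n x - asymptotic_form f n y\<bar>
    \<le> C * real CARD('n) * (norm (x - y) * (norm x + norm y))"
proof -
  note act = matrix_action_matrix and q = quad_growth_column_average[OF f(1)]
  let ?L = "norm (x - y) * (norm x + norm y)"
  have C: "C \<ge> 0" using f(2)[of undefined] by linarith
  have pt: "\<bar>column_average f w * (norm (w *v x))\<^sup>2 - column_average f w * (norm (w *v y))\<^sup>2\<bar>
      \<le> C * ?L * (norm w)\<^sup>2" for w :: "complex ^ 'n ^ 'n"
  proof -
    have "\<bar>norm (w *v x) - norm (w *v y)\<bar> \<le> norm w * norm (x - y)"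
      using norm_triangle_ineq3[of "w *v x" "w *v y"] norm_matrix_vector_mult_le[of w "x - y"]
      by (simp add: matrix_vector_mult_diff_distrib)
    moreover have "norm (w *v x) + norm (w *v y) \<le> norm w * (norm x + norm y)"
      using norm_matrix_vector_mult_le[of w x] norm_matrix_vector_mult_le[of w y] by (simp add: distrib_left)
    ultimately have "\<bar>norm (w *v x) - norm (w *v y)\<bar> * (norm (w *v x) + norm (w *v y))
        \<le> (norm w * norm (x - y)) * (norm w * (norm x + norm y))"
      by (intro mult_mono) auto
    moreover have "\<bar>(norm (w *v x))\<^sup>2 - (norm (w *v y))\<^sup>2\<bar>
        = \<bar>norm (w *v x) - norm (w *v y)\<bar> * (norm (w *v x) + norm (w *v y))"
      by (simp add: power2_eq_square square_diff_square_factored abs_mult mult.commute)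
    ultimately have "\<bar>(norm (w *v x))\<^sup>2 - (norm (w *v y))\<^sup>2\<bar> \<le> ?L * (norm w)\<^sup>2"
      by (simp add: power2_eq_square mult_ac)
    then have "\<bar>column_average f w\<bar> * \<bar>(norm (w *v x))\<^sup>2 - (norm (w *v y))\<^sup>2\<bar> \<le> C * (?L * (norm w)\<^sup>2)"
      using C by (intro mult_mono column_average_bound f(2)) auto
    then show ?thesis by (simp add: abs_mult[symmetric] right_diff_distrib mult.assoc)
  qed
  have nw: "(transfer (**) ^^ n) (\<lambda>w :: complex ^ 'n ^ 'n. C * ?L * (norm w)\<^sup>2) (mat 1) = C * ?L * real CARD('n)"
  proof -
    have "(\<lambda>w :: complex ^ 'n ^ 'n. C * ?L * (norm w)\<^sup>2)
        = (\<lambda>w. C * ?L * (\<Sum>i\<in>UNIV. (norm (w *v axis i 1))\<^sup>2))"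
      by (simp add: sum_norm_columns_sq)
    moreover have "(transfer (**) ^^ n) (\<lambda>w. (\<Sum>i\<in>UNIV. (norm (w *v axis i 1))\<^sup>2)) (mat 1) = real CARD('n)"
    proof -
      show ?thesis
        by (simp add: transfer_pow_sum[OF act _ quad_growth_matrix_vec[OF quad_growth_norm_sq]] transfer_pow_matrix_vec[where G = "\<lambda>x. (norm x)\<^sup>2"]
            transfer_pow_norm_sq)
    qed
    ultimately show ?thesis by (simp add: transfer_pow_cmult)
  qed
  have "asymptotic_form f n x - asymptotic_form f n y = (transfer (**) ^^ n)
      (\<lambda>w. column_average f w * (norm (w *v x))\<^sup>2 - column_average f w * (norm (w *v y))\<^sup>2) (mat 1)"
    by (simp add: asymptotic_form_def transfer_pow_diff[OF act q q])
  also have "\<bar>\<dots>\<bar> \<le> (transfer (**) ^^ n) (\<lambda>w :: complex ^ 'n ^ 'n. C * ?L * (norm w)\<^sup>2) (mat 1)"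
    by (intro transfer_pow_abs_le act quad_growth_diff q quad_growth_cmult quad_growth_norm_sq pt)
  finally show ?thesis unfolding nw by (simp add: mult_ac)
qed

lemma asymptotic_form_bound:
  assumes f: "continuous_on UNIV f" "\<And>p. \<bar>f p\<bar> \<le> C"
  shows "\<bar>asymptotic_form f n x\<bar> \<le> C * real CARD('n) * (norm x)\<^sup>2"
proof -
  have "asymptotic_form f n (0 *s 0) = (cmod 0)\<^sup>2 * asymptotic_form f n 0"
    using quadratic_form_asymptotic_form[OF f(1)] unfolding quadratic_form_def by blast
  then have "asymptotic_form f n 0 = 0" by simp
  then show ?thesis
    using asymptotic_form_diff_bound[OF f, of n x 0] by (simp add: power2_eq_square)
qed

lemma markov_pow_asymptotic:
  assumes pur: "purifying \<mu>" and f: "continuous_on UNIV f" and "\<epsilon> > 0"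
  shows "\<exists>N. \<forall>n\<ge>N. \<forall>x. norm x = 1 \<longrightarrow> \<bar>hom2 ((markov ^^ n) f) x - asymptotic_form f n x\<bar> \<le> \<epsilon>"
proof -
  note act = matrix_action_matrix and q = quad_growth_column_average[OF f]
  let ?d = "real CARD('n)"
  obtain K where K: "K \<ge> 0" "\<And>p q. \<bar>f p - f q\<bar> \<le> \<epsilon> / 2 + K * dist p q"
    using uniform_modulus_cproj[OF f, of "\<epsilon> / 2"] \<open>\<epsilon> > 0\<close> by auto
  have d: "?d > 0" by simp
  \<comment> \<open>The threshold for the areas: \<open>K * CARD('n) * \<eta> \<le> \<epsilon> / 2\<close>, where \<open>K + 1\<close> avoids division by \<open>0\<close>.\<close>
  define \<eta> where "\<eta> = \<epsilon> / (2 * (K + 1) * ?d)"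
  have \<eta>: "\<eta> > 0" using \<open>\<epsilon> > 0\<close> K(1) d by (simp add: \<eta>_def)
  obtain N where N: "\<And>n z. n \<ge> N \<Longrightarrow> wedge n z \<le> \<eta> * cross (fst z) (snd z)"
    using wedge_tendsto_0[OF pur \<eta>] by blast
  have "\<bar>hom2 ((markov ^^ n) f) x - asymptotic_form f n x\<bar> \<le> \<epsilon>" if n: "n \<ge> N" and x: "norm x = 1" for n x
  proof -
    let ?D = "\<lambda>w :: complex ^ 'n ^ 'n. hom2 f (w *v x) - column_average f w * (norm (w *v x))\<^sup>2"
    let ?B = "\<lambda>w :: complex ^ 'n ^ 'n. \<epsilon> / 2 * (norm (w *v x))\<^sup>2 + K * (\<Sum>i\<in>UNIV. cross (w *v x) (w *v axis i 1))"
    have qc: "quad_growth (\<lambda>w :: complex ^ 'n ^ 'n. cross (w *v x) (w *v axis i 1))" for i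
      using quad_growth_matrix_pair[OF quad_growth_cross, of x "axis i 1"] by simp
    have qh: "quad_growth (\<lambda>w :: complex ^ 'n ^ 'n. hom2 f (w *v x))"
      by (rule quad_growth_matrix_vec[OF quad_growth_hom2[OF f]])
    have qD: "quad_growth ?D" by (intro quad_growth_diff q qh)
    have qn: "quad_growth (\<lambda>w :: complex ^ 'n ^ 'n. (norm (w *v x))\<^sup>2)"
      by (rule quad_growth_matrix_vec[OF quad_growth_norm_sq])
    have qs: "quad_growth (\<lambda>w :: complex ^ 'n ^ 'n. \<Sum>i\<in>UNIV. cross (w *v x) (w *v axis i 1))"
      by (rule quad_growth_sum) (rule qc)
    have qB: "quad_growth ?B" by (intro quad_growth_add quad_growth_cmult qn qs)
    have approx: "\<bar>?D w\<bar> \<le> ?B w" for w :: "complex ^ 'n ^ 'n"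
      using K x by (intro column_average_approx) auto
    have TD: "(transfer (**) ^^ n) ?D (mat 1) = hom2 ((markov ^^ n) f) x - asymptotic_form f n x"
      by (simp add: transfer_pow_diff[OF act qh q] transfer_pow_matrix_vec hom2_markov_pow asymptotic_form_def)
    have w: "(transfer (**) ^^ n) (\<lambda>w. cross (w *v x) (w *v axis i 1)) (mat 1) \<le> \<eta>" for i
    proof -
      have "wedge n (x, axis i 1) \<le> \<eta> * cross x (axis i 1)"
        using N[OF n, of "(x, axis i 1)"] by simp
      also have "\<dots> \<le> \<eta> * 1"
        using \<eta> cross_le[of x "axis i 1"] x by (intro mult_left_mono) auto
      finally show ?thesis by (simp add: wedge_eq_transfer_matrix)
    qed
    have "(transfer (**) ^^ n) ?B (mat 1)
        = \<epsilon> / 2 + K * (\<Sum>i\<in>UNIV. (transfer (**) ^^ n) (\<lambda>w. cross (w *v x) (w *v axis i 1)) (mat 1))"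
      by (subst transfer_pow_add[OF act quad_growth_cmult[OF qn] quad_growth_cmult[OF qs]])
         (simp only: transfer_pow_cmult, simp add:
          transfer_pow_sum[OF act _ qc] transfer_pow_matrix_vec[where G = "\<lambda>x. (norm x)\<^sup>2"] transfer_pow_norm_sq x)
    also have "\<dots> \<le> \<epsilon> / 2 + K * (\<Sum>i\<in>(UNIV :: 'n set). \<eta>)"
      using K(1) by (intro add_left_mono mult_left_mono sum_mono w)
    also have "K * (\<Sum>i\<in>(UNIV :: 'n set). \<eta>) \<le> \<epsilon> / 2"
    proof -
      have "K * (\<Sum>i\<in>(UNIV :: 'n set). \<eta>) = \<epsilon> / 2 * (K / (K + 1))"
        using d K(1) by (simp add: \<eta>_def)
      also have "\<dots> \<le> \<epsilon> / 2 * 1"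
        using \<open>\<epsilon> > 0\<close> K(1) by (intro mult_left_mono) auto
      finally show ?thesis by simp
    qed
    finally have TB: "(transfer (**) ^^ n) ?B (mat 1) \<le> \<epsilon>" by simp
    have "\<bar>(transfer (**) ^^ n) ?D (mat 1)\<bar> \<le> (transfer (**) ^^ n) ?B (mat 1)"
      by (rule transfer_pow_abs_le[OF act qD qB approx])
    then show ?thesis using TB unfolding TD by linarith
  qed
  then show ?thesis by blast
qed

lemma Cesaro_null:
  fixes a :: "nat \<Rightarrow> real"
  assumes "\<And>j. \<bar>a j\<bar> \<le> B" "\<And>j. j \<ge> N \<Longrightarrow> \<bar>a j\<bar> \<le> \<epsilon>" and "m > 0" "\<epsilon> \<ge> 0"
  shows "\<bar>(\<Sum>j<m. a j) / real m\<bar> \<le> B * real N / real m + \<epsilon>"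
proof -
  have B: "B \<ge> 0" using assms(1)[of 0] by linarith
  have "\<bar>\<Sum>j<m. a j\<bar> \<le> (\<Sum>j<m. \<bar>a j\<bar>)" by (rule sum_abs)
  also have "\<dots> \<le> (\<Sum>j<m. (if j < N then B else 0) + \<epsilon>)"
    using assms by (intro sum_mono) (auto simp: not_less intro: order_trans[OF assms(1)])
  also have "\<dots> = (\<Sum>j<m. if j < N then B else 0) + \<epsilon> * real m"
    by (simp add: sum.distrib)
  also have "(\<Sum>j<m. if j < N then B else 0) \<le> B * real N"
  proof -
    have "(\<Sum>j<m. if j < N then B else 0) = (\<Sum>j\<in>{..<m} \<inter> {..<N}. B)"
      by (subst sum.inter_restrict) auto
    also have "\<dots> = B * real (card ({..<m} \<inter> {..<N}))" by simp
    also have "\<dots> \<le> B * real N"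
      using card_mono[of "{..<N}" "{..<m} \<inter> {..<N}"] B by (intro mult_left_mono) auto
    finally show ?thesis .
  qed
  finally have "\<bar>\<Sum>j<m. a j\<bar> \<le> B * real N + \<epsilon> * real m" by simp
  then have "\<bar>\<Sum>j<m. a j\<bar> / real m \<le> (B * real N + \<epsilon> * real m) / real m"
    by (rule divide_right_mono) simp
  then show ?thesis using \<open>m > 0\<close> by (simp add: add_divide_distrib)
qed

end

context kraus_product
begin

definition cesaro :: "('n cproj \<Rightarrow> real) \<Rightarrow> nat \<Rightarrow> 'n cproj \<Rightarrow> real" where
  "cesaro f m p = (\<Sum>j<m. (markov ^^ j) f p) / real m"

definition cesaro_form :: "('n cproj \<Rightarrow> real) \<Rightarrow> nat \<Rightarrow> complex ^ 'n \<Rightarrow> real" where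
  "cesaro_form f m x = (\<Sum>j<m. asymptotic_form f j x) / real m"

lemma hom2_cesaro: "hom2 (cesaro f m) x = (\<Sum>j<m. hom2 ((markov ^^ j) f) x) / real m"
  by (simp add: hom2_def cesaro_def sum_distrib_left)

lemma continuous_on_cesaro: "continuous_on UNIV f \<Longrightarrow> continuous_on UNIV (cesaro f m)"
  unfolding cesaro_def by (cases "m = 0") (auto intro!: continuous_intros continuous_on_markov_pow)

lemma cesaro_form_approx:
  assumes pur: "purifying \<mu>" and f: "continuous_on UNIV f" and "\<epsilon> > 0"
  shows "\<exists>M. \<forall>m\<ge>M. \<forall>x. norm x = 1 \<longrightarrow> \<bar>hom2 (cesaro f m) x - cesaro_form f m x\<bar> \<le> \<epsilon>"
proof -
  obtain C where C: "C > 0" "\<And>p. \<bar>f p\<bar> \<le> C"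
    using continuous_bounded_cproj[OF f] by blast
  obtain N where N: "\<And>n x. n \<ge> N \<Longrightarrow> norm x = 1 \<Longrightarrow>
      \<bar>hom2 ((markov ^^ n) f) x - asymptotic_form f n x\<bar> \<le> \<epsilon> / 2"
    using markov_pow_asymptotic[OF pur f, of "\<epsilon> / 2"] \<open>\<epsilon> > 0\<close> by auto
  define B where "B = C + C * real CARD('n)"
  have B: "B > 0" using C(1) by (simp add: B_def add_pos_pos)
  have bound: "\<bar>hom2 ((markov ^^ n) f) x - asymptotic_form f n x\<bar> \<le> B" if "norm x = 1" for n x
    using hom2_bound[of "(markov ^^ n) f" C x] markov_pow_bound[OF f C(2)] that
      asymptotic_form_bound[OF f C(2), of n x] by (simp add: B_def)
  obtain M where M: "B * real N / (\<epsilon> / 2) < real M" using reals_Archimedean2 by blast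
  show ?thesis
  proof (intro exI[of _ "Suc M"] allI impI)
    fix m x assume m: "Suc M \<le> m" and x: "norm (x :: complex ^ 'n) = 1"
    have "hom2 (cesaro f m) x - cesaro_form f m x
        = (\<Sum>j<m. hom2 ((markov ^^ j) f) x - asymptotic_form f j x) / real m"
      by (simp add: hom2_cesaro cesaro_form_def sum_subtractf diff_divide_distrib)
    moreover have "\<bar>\<dots>\<bar> \<le> B * real N / real m + \<epsilon> / 2"
      using m \<open>\<epsilon> > 0\<close> by (intro Cesaro_null bound N x) auto
    moreover have "B * real N / real m \<le> \<epsilon> / 2"
    proof -
      have "B * real N \<le> \<epsilon> / 2 * real M" using M \<open>\<epsilon> > 0\<close> by (simp add: divide_less_eq mult.commute)
      also have "\<dots> \<le> \<epsilon> / 2 * real m" using m \<open>\<epsilon> > 0\<close> by (intro mult_left_mono) auto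
      finally show ?thesis using m by (simp add: divide_le_eq)
    qed
    ultimately show "\<bar>hom2 (cesaro f m) x - cesaro_form f m x\<bar> \<le> \<epsilon>" by linarith
  qed
qed

lemma quadratic_form_cesaro_form:
  assumes f: "continuous_on UNIV f"
  shows "quadratic_form (cesaro_form f m)"
proof -
  have q: "quadratic_form (asymptotic_form f j)" for j by (rule quadratic_form_asymptotic_form[OF f])
  have "quadratic_form (\<lambda>x. \<Sum>j<k. asymptotic_form f j x)" for k
  proof (induction k)
    case (Suc k)
    then show ?case using quadratic_form_lincomb[OF Suc q[of k], of 1 1] by simp
  qed (simp add: quadratic_form_def)
  then show ?thesis
    using quadratic_form_lincomb[of "\<lambda>x. \<Sum>j<m. asymptotic_form f j x" "\<lambda>x. \<Sum>j<m. asymptotic_form f j x" "1 / real m" 0]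
    by (simp add: cesaro_form_def[abs_def])
qed

lemma cesaro_form_diff_bound:
  assumes f: "continuous_on UNIV f" "\<And>p. \<bar>f p\<bar> \<le> C"
  shows "\<bar>cesaro_form f m x - cesaro_form f m y\<bar> \<le> C * real CARD('n) * (norm (x - y) * (norm x + norm y))"
    (is "_ \<le> ?R")
proof -
  have R: "?R \<ge> 0" using f(2)[of undefined] by simp
  have "\<bar>\<Sum>j<m. asymptotic_form f j x - asymptotic_form f j y\<bar> \<le> (\<Sum>j<m. ?R)"
    by (rule order_trans[OF sum_abs]) (intro sum_mono asymptotic_form_diff_bound f)
  then have "\<bar>\<Sum>j<m. asymptotic_form f j x - asymptotic_form f j y\<bar> / real m \<le> real m * ?R / real m"
    by (intro divide_right_mono) simp_all
  also have "\<dots> \<le> ?R" using R by (cases "m = 0") auto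
  finally show ?thesis
    by (simp add: cesaro_form_def sum_subtractf diff_divide_distrib[symmetric])
qed

text \<open>Applying the operator shifts the sum by one index, so only its two end terms survive.\<close>

lemma transfer_cesaro_almost_fixed:
  assumes f: "continuous_on UNIV f" "\<And>p. \<bar>f p\<bar> \<le> C" and "m > 0"
  shows "\<bar>transfer (*v) (hom2 (cesaro f m)) x - hom2 (cesaro f m) x\<bar> \<le> 2 * C / real m * (norm x)\<^sup>2"
proof -
  have q: "quad_growth (hom2 ((markov ^^ j) f))" for j
    by (intro quad_growth_hom2 continuous_on_markov_pow f)
  have "transfer (*v) (hom2 (cesaro f m)) x = (\<integral>v. (\<Sum>j<m. hom2 ((markov ^^ j) f) (v *v x)) / real m \<partial>\<mu>)"
    by (simp add: transfer_def hom2_cesaro)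
  also have "\<dots> = (\<Sum>j<m. transfer (*v) (hom2 ((markov ^^ j) f)) x) / real m"
    using integrable_action[OF matrix_action_vec q] by (simp add: transfer_def)
  also have "\<dots> = (\<Sum>j<m. hom2 ((markov ^^ Suc j) f) x) / real m"
    by (simp add: hom2_markov)
  finally have "transfer (*v) (hom2 (cesaro f m)) x - hom2 (cesaro f m) x
      = (\<Sum>j<m. hom2 ((markov ^^ Suc j) f) x - hom2 ((markov ^^ j) f) x) / real m"
    by (simp add: hom2_cesaro sum_subtractf diff_divide_distrib)
  also have "\<dots> = (hom2 ((markov ^^ m) f) x - hom2 f x) / real m"
    by (subst sum_lessThan_telescope) simp
  finally have e: "transfer (*v) (hom2 (cesaro f m)) x - hom2 (cesaro f m) x
      = (hom2 ((markov ^^ m) f) x - hom2 f x) / real m" .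
  have "\<bar>hom2 ((markov ^^ m) f) x - hom2 f x\<bar> \<le> 2 * C * (norm x)\<^sup>2"
    using hom2_bound[of "(markov ^^ m) f" C x] hom2_bound[of f C x] markov_pow_bound[OF f] f(2) by simp
  then show ?thesis unfolding e using \<open>m > 0\<close> by (simp add: divide_right_mono)
qed

text \<open>The Cesaro averages of \<open>f\<close> approach quadratic forms with a common Lipschitz bound, and a
  limit of these is a fixed quadratic form, hence constant.\<close>

lemma cesaro_subsequence_const:
  assumes pur: "purifying \<mu>" and erg: "ergodic \<mu>" and f: "continuous_on UNIV f"
    and m: "filterlim m at_top sequentially"
  obtains r c where "strict_mono (r :: nat \<Rightarrow> nat)"
    "\<And>\<epsilon>. \<epsilon> > 0 \<Longrightarrow> \<exists>K. \<forall>k\<ge>K. \<forall>p. \<bar>cesaro f (m (r k)) p - c\<bar> \<le> \<epsilon>"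
proof -
  obtain C where C: "C > 0" "\<And>p. \<bar>f p\<bar> \<le> C"
    using continuous_bounded_cproj[OF f] by blast
  let ?S = "sphere (0 :: complex ^ 'n) 1"
  define L where "L = C * real CARD('n)"
  have L: "L > 0" using C(1) by (simp add: L_def)
  define b where "b k = cesaro_form f (m k)" for k
  have bq: "quadratic_form (b k)" for k unfolding b_def by (rule quadratic_form_cesaro_form[OF f])
  have bd: "\<bar>b k x - b k y\<bar> \<le> L * (norm (x - y) * (norm x + norm y))" for k x y
    unfolding b_def L_def by (rule cesaro_form_diff_bound[OF f C(2)])
  have bsm: "b k (c *s x) = (cmod c)\<^sup>2 * b k x" for k c x using bq[of k] by (simp add: quadratic_form_def)
  have b0: "b k 0 = 0" for k using bsm[of k 0 0] by simp
  have bS: "compact ?S" by simp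
  obtain h r where r: "strict_mono (r :: nat \<Rightarrow> nat)"
    and h: "\<And>e. 0 < e \<Longrightarrow> \<exists>N. \<forall>n x. n \<ge> N \<and> x \<in> ?S \<longrightarrow> norm (b (r n) x - h x) < e"
  proof (rule Arzela_Ascoli[OF bS, of b L])
    show "norm (b n x) \<le> L" if "x \<in> ?S" for n x
      using bd[of n x 0] that by (simp add: b0)
    show "\<exists>d. 0 < d \<and> (\<forall>n y. y \<in> ?S \<and> norm (x - y) < d \<longrightarrow> norm (b n x - b n y) < e)"
      if "x \<in> ?S" "0 < e" for x e
    proof (intro exI[of _ "e / (2 * L)"] conjI allI impI)
      fix n y assume y: "y \<in> ?S \<and> norm (x - y) < e / (2 * L)"
      have "\<bar>b n x - b n y\<bar> \<le> L * (norm (x - y) * 2)"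
        using bd[of n x y] that(1) y by simp
      also have "\<dots> < e" using y L by (simp add: field_simps)
      finally show "norm (b n x - b n y) < e" by simp
    qed (use that L in simp)
  qed blast
  \<comment> \<open>The uniform limit \<open>h\<close> is only controlled on the sphere; \<open>H\<close> is its homogeneous extension.\<close>
  define H where "H x = lim (\<lambda>k. b (r k) x)" for x
  have S: "(\<lambda>k. b (r k) u) \<longlonglongrightarrow> h u" if "norm u = 1" for u
    unfolding LIMSEQ_iff using h that by (simp only: mem_sphere dist_0_norm) blast
  have lim: "(\<lambda>k. b (r k) x) \<longlonglongrightarrow> H x" for x
  proof -
    have "convergent (\<lambda>k. b (r k) x)"
    proof (cases "x = 0")
      case False
      define u where "u = complex_of_real (1 / norm x) *s x"
      have u: "x = complex_of_real (norm x) *s u" "norm u = 1"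
        using False normalize_unit[OF False] by (simp_all add: u_def vector_smult_assoc)
      have "b (r k) x = (norm x)\<^sup>2 * b (r k) u" for k
        by (subst u(1)) (simp add: bsm)
      moreover have "convergent (\<lambda>k. (norm x)\<^sup>2 * b (r k) u)"
        using tendsto_mult_left[OF S[OF u(2)]] by (rule convergentI)
      ultimately show ?thesis by simp
    qed (simp add: b0 convergent_const)
    then show ?thesis unfolding H_def by (rule convergent_LIMSEQ_iff[THEN iffD1])
  qed
  have Hq: "quadratic_form H"
    unfolding quadratic_form_def
  proof (intro conjI allI)
    fix x y c
    have "(\<lambda>k. b (r k) (x + y) + b (r k) (x - y)) \<longlonglongrightarrow> H (x + y) + H (x - y)"
      by (intro tendsto_add lim)
    moreover have "(\<lambda>k. 2 * b (r k) x + 2 * b (r k) y) \<longlonglongrightarrow> 2 * H x + 2 * H y"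
      by (intro tendsto_add tendsto_mult lim tendsto_const)
    moreover have "b (r k) (x + y) + b (r k) (x - y) = 2 * b (r k) x + 2 * b (r k) y" for k
      using bq[of "r k"] unfolding quadratic_form_def by blast
    ultimately show "H (x + y) + H (x - y) = 2 * H x + 2 * H y"
      by (simp add: LIMSEQ_unique)
    have "(\<lambda>k. b (r k) (c *s x)) \<longlonglongrightarrow> (cmod c)\<^sup>2 * H x"
      unfolding bsm by (intro tendsto_mult lim tendsto_const)
    then show "H (c *s x) = (cmod c)\<^sup>2 * H x"
      using lim[of "c *s x"] by (rule LIMSEQ_unique[rotated])
  qed
  have Hd: "\<bar>H x - H y\<bar> \<le> L * (norm (x - y) * (norm x + norm y))" for x y
    by (rule LIMSEQ_le_const2[OF tendsto_rabs[OF tendsto_diff[OF lim lim]]]) (use bd in blast)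
  have H0: "H 0 = 0" using lim[of 0] by (simp add: b0 LIMSEQ_const_iff)
  have Hqg: "quad_growth H"
  proof (rule quad_growthI)
    show "\<bar>H z\<bar> \<le> L * (norm z)\<^sup>2" for z
      using Hd[of z 0] by (simp add: H0 power2_eq_square)
    have "isCont H x" for x
    proof -
      have "((\<lambda>y. L * (norm (y - x) * (norm y + norm x))) \<longlongrightarrow> L * (norm (x - x) * (norm x + norm x))) (at x)"
        by (intro tendsto_intros)
      then have "((\<lambda>y. L * (norm (y - x) * (norm y + norm x))) \<longlongrightarrow> 0) (at x)" by simp
      then have "((\<lambda>y. H y - H x) \<longlongrightarrow> 0) (at x)"
        by (rule Lim_null_comparison[rotated]) (auto intro!: always_eventually Hd)
      then show ?thesis unfolding isCont_def by (rule LIM_zero_cancel)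
    qed
    then show "continuous_on UNIV H" by (simp add: continuous_at_imp_continuous_on)
  qed
  \<comment> \<open>By homogeneity, uniform closeness on the sphere is closeness relative to \<open>(norm x)\<^sup>2\<close> everywhere.\<close>
  have near: "\<exists>K. \<forall>k\<ge>K. \<forall>x. \<bar>hom2 (cesaro f (m (r k))) x - H x\<bar> \<le> e * (norm x)\<^sup>2" if "e > 0" for e
  proof -
    obtain N where N: "\<And>n x. n \<ge> N \<Longrightarrow> norm x = 1 \<Longrightarrow> \<bar>b (r n) x - h x\<bar> < e / 2"
      using h[of "e / 2"] \<open>e > 0\<close> by auto
    have hH: "h x = H x" if "norm x = 1" for x
      using S[OF that] lim by (rule LIMSEQ_unique)
    obtain M where M: "\<And>n x. n \<ge> M \<Longrightarrow> norm x = 1 \<Longrightarrow> \<bar>hom2 (cesaro f n) x - cesaro_form f n x\<bar> \<le> e / 2"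
      using cesaro_form_approx[OF pur f, of "e / 2"] \<open>e > 0\<close> by auto
    have "eventually (\<lambda>k. M \<le> m (r k)) sequentially"
      using filterlim_compose[OF m filterlim_subseq[OF r]] by (simp add: filterlim_at_top)
    then obtain N' where N': "\<And>k. k \<ge> N' \<Longrightarrow> M \<le> m (r k)"
      by (auto simp: eventually_sequentially)
    have "\<bar>hom2 (cesaro f (m (r k))) x - H x\<bar> \<le> e * (norm x)\<^sup>2" if k: "k \<ge> max N N'" for k x
    proof -
      let ?G = "\<lambda>x. hom2 (cesaro f (m (r k))) x - H x"
      have G: "?G (c *s x) = (cmod c)\<^sup>2 * ?G x" for c x
        using Hq by (simp add: quadratic_form_def hom2_smult right_diff_distrib)
      have one: "\<bar>?G x\<bar> \<le> e" if "norm x = 1" for x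
      proof -
        have "\<bar>hom2 (cesaro f (m (r k))) x - b (r k) x\<bar> \<le> e / 2"
          using M[OF N' that, of k] k by (simp add: b_def)
        moreover have "\<bar>b (r k) x - H x\<bar> < e / 2"
          using N[OF _ that, of k] k by (simp add: hH[OF that])
        ultimately show ?thesis by linarith
      qed
      have "\<bar>?G x\<bar> \<le> e * (norm x)\<^sup>2"
      proof (rule homogeneous_sphere_le[of "\<lambda>x. \<bar>?G x\<bar>"])
        show "\<bar>?G (c *s x)\<bar> = (cmod c)\<^sup>2 * \<bar>?G x\<bar>" for c x
          unfolding G by (simp add: abs_mult)
      qed (rule one)
      then show ?thesis .
    qed
    then show ?thesis by blast
  qed
  have "transfer (*v) H x = H x" for x
  proof -
    \<comment> \<open>Compare \<open>H\<close> with an average close to it, which is itself almost fixed by \<open>transfer\<close>.\<close>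
    have le: "\<bar>transfer (*v) H x - H x\<bar> \<le> e * (3 * (norm x)\<^sup>2)" if "e > 0" for e
    proof -
      obtain K where K: "\<And>k x. k \<ge> K \<Longrightarrow> \<bar>hom2 (cesaro f (m (r k))) x - H x\<bar> \<le> e * (norm x)\<^sup>2"
        using near[OF \<open>e > 0\<close>] by blast
      obtain M where M: "2 * C / e < real M" using reals_Archimedean2 by blast
      have "eventually (\<lambda>k. Suc M \<le> m (r k)) sequentially"
        using filterlim_compose[OF m filterlim_subseq[OF r]] by (simp add: filterlim_at_top)
      then obtain N' where N': "\<And>k. k \<ge> N' \<Longrightarrow> Suc M \<le> m (r k)"
        by (auto simp: eventually_sequentially)
      define k where "k = max K N'"
      define n where "n = m (r k)"
      have n: "n \<ge> Suc M" using N'[of k] by (simp add: k_def n_def)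
      let ?A = "hom2 (cesaro f n)"
      have A: "quad_growth ?A" by (intro quad_growth_hom2 continuous_on_cesaro f)
      have AH: "\<bar>?A y - H y\<bar> \<le> e * (norm y)\<^sup>2" for y
        unfolding n_def by (rule K) (simp add: k_def)
      have "\<bar>transfer (*v) H x - transfer (*v) ?A x\<bar> \<le> e * (norm x)\<^sup>2"
      proof -
        have "transfer (*v) H x - transfer (*v) ?A x = transfer (*v) (\<lambda>z. H z - ?A z) x"
          using transfer_pow_diff[OF matrix_action_vec Hqg A, of 1] by simp
        also have "\<bar>\<dots>\<bar> \<le> transfer (*v) (\<lambda>z. e * (norm z)\<^sup>2) x"
          using transfer_pow_abs_le[OF matrix_action_vec quad_growth_diff[OF Hqg A]
              quad_growth_cmult[OF quad_growth_norm_sq], of e 1] AH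
          by (simp add: abs_minus_commute)
        also have "\<dots> = e * (norm x)\<^sup>2" by (simp add: transfer_def integral_norm_sq)
        finally show ?thesis .
      qed
      moreover have "\<bar>transfer (*v) ?A x - ?A x\<bar> \<le> e * (norm x)\<^sup>2"
      proof -
        have "2 * C / real n \<le> e"
        proof -
          have "2 * C \<le> e * real M" using M \<open>e > 0\<close> by (simp add: divide_less_eq mult.commute)
          also have "\<dots> \<le> e * real n" using n \<open>e > 0\<close> by (intro mult_left_mono) auto
          finally show ?thesis using n by (simp add: divide_le_eq)
        qed
        then have "2 * C / real n * (norm x)\<^sup>2 \<le> e * (norm x)\<^sup>2" by (rule mult_right_mono) simp
        then show ?thesis
          using transfer_cesaro_almost_fixed[OF f C(2), of n x] n by linarith
      qed
      ultimately show ?thesis using AH[of x] by linarith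
    qed
    have "\<bar>transfer (*v) H x - H x\<bar> \<le> 0"
    proof (rule field_le_epsilon)
      fix e :: real assume e: "e > 0"
      define t where "t = 3 * (norm x)\<^sup>2"
      have t: "t \<ge> 0" by (simp add: t_def)
      have "\<bar>transfer (*v) H x - H x\<bar> \<le> e / (t + 1) * t"
        unfolding t_def by (rule le) (use e t in \<open>simp add: t_def[symmetric]\<close>)
      also have "\<dots> \<le> e" using e t by (simp add: divide_le_eq)
      finally show "\<bar>transfer (*v) H x - H x\<bar> \<le> 0 + e" by simp
    qed
    then show ?thesis by simp
  qed
  then obtain c where c: "\<And>x. H x = c * (norm x)\<^sup>2"
    using fixed_quadratic_form_const[OF erg Hq Hqg] by blast
  have "\<exists>K. \<forall>k\<ge>K. \<forall>p. \<bar>cesaro f (m (r k)) p - c\<bar> \<le> e" if "e > 0" for e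
  proof -
    obtain K where K: "\<And>k x. k \<ge> K \<Longrightarrow> \<bar>hom2 (cesaro f (m (r k))) x - H x\<bar> \<le> e * (norm x)\<^sup>2"
      using near[OF \<open>e > 0\<close>] by blast
    have "\<bar>cesaro f (m (r k)) p - c\<bar> \<le> e" if "k \<ge> K" for k p
      using K[OF that, of "unit_rep p"] by (simp add: c unit_rep)
    then show ?thesis by blast
  qed
  with r show ?thesis by (rule that)
qed

text \<open>Otherwise some sequence of averages stays away from \<open>\<integral> f d\<nu>\<close> at suitable points. A subsequence
  converges uniformly to a constant, and invariance of \<open>\<nu>\<close> forces this constant to be \<open>\<integral> f d\<nu>\<close>.\<close>

lemma cesaro_uniform_limit:
  assumes pur: "purifying \<mu>" and erg: "ergodic \<mu>" and f: "continuous_on UNIV f"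
    and \<nu>: "prob_space \<nu>" "sets \<nu> = sets borel"
    and inv: "\<And>g. continuous_on UNIV g \<Longrightarrow> (\<integral>p. markov g p \<partial>\<nu>) = (\<integral>p. g p \<partial>\<nu>)"
    and "\<epsilon> > 0"
  shows "\<exists>M. \<forall>m\<ge>M. \<forall>p. \<bar>cesaro f m p - (\<integral>p. f p \<partial>\<nu>)\<bar> \<le> \<epsilon>"
proof (rule ccontr)
  interpret prob_space \<nu> by fact
  define I where "I = (\<integral>p. f p \<partial>\<nu>)"
  have int: "integrable \<nu> g" if "continuous_on UNIV g" for g :: "'n cproj \<Rightarrow> real"
    using \<nu> that by (intro integrable_continuous_cproj) (simp add: borel_prob_def)
  assume "\<not> ?thesis"
  then have "\<forall>M. \<exists>m\<ge>M. \<exists>p. \<bar>cesaro f m p - I\<bar> > \<epsilon>"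
    unfolding I_def by (simp add: not_le)
  then have "\<forall>k. \<exists>m. m \<ge> Suc k \<and> (\<exists>p. \<bar>cesaro f m p - I\<bar> > \<epsilon>)"
    by blast
  then have "\<exists>m. \<forall>k. m k \<ge> Suc k \<and> (\<exists>p. \<bar>cesaro f (m k) p - I\<bar> > \<epsilon>)"
    by (rule choice)
  then obtain m where m: "\<And>k. m k \<ge> Suc k" "\<And>k. \<exists>p. \<bar>cesaro f (m k) p - I\<bar> > \<epsilon>"
    by blast
  have "filterlim m at_top sequentially"
    by (rule filterlim_at_top_mono[OF filterlim_ident]) (rule always_eventually, rule allI, rule Suc_leD, rule m(1))
  then obtain r c where r: "strict_mono (r :: nat \<Rightarrow> nat)"
    and c: "\<And>e. e > 0 \<Longrightarrow> \<exists>K. \<forall>k\<ge>K. \<forall>p. \<bar>cesaro f (m (r k)) p - c\<bar> \<le> e"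
    using cesaro_subsequence_const[OF pur erg f] by blast
  have pw: "(\<integral>p. (markov ^^ j) f p \<partial>\<nu>) = I" for j
    by (induction j) (simp_all add: I_def inv continuous_on_markov_pow f)
  have avg: "(\<integral>p. cesaro f n p \<partial>\<nu>) = I" if "n > 0" for n
  proof -
    have "(\<integral>p. cesaro f n p \<partial>\<nu>) = (\<Sum>j<n. \<integral>p. (markov ^^ j) f p \<partial>\<nu>) / real n"
      unfolding cesaro_def integral_divide_zero
      by (subst Bochner_Integration.integral_sum) (auto intro: int continuous_on_markov_pow f)
    then show ?thesis using that by (simp add: pw)
  qed
  have "\<bar>I - c\<bar> \<le> \<epsilon> / 2"
  proof -
    obtain K where K: "\<forall>k\<ge>K. \<forall>p. \<bar>cesaro f (m (r k)) p - c\<bar> \<le> \<epsilon> / 2"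
      using c[of "\<epsilon> / 2"] \<open>\<epsilon> > 0\<close> by auto
    have ci: "integrable \<nu> (cesaro f (m (r K)))" by (intro int continuous_on_cesaro f)
    have "m (r K) > 0" using m(1)[of "r K"] by simp
    then have "I - c = (\<integral>p. cesaro f (m (r K)) p - c \<partial>\<nu>)"
      using ci by (simp add: avg prob_space)
    also have "\<bar>\<dots>\<bar> \<le> (\<integral>p. \<bar>cesaro f (m (r K)) p - c\<bar> \<partial>\<nu>)" by (rule integral_abs_bound)
    also have "\<dots> \<le> (\<integral>p. \<epsilon> / 2 \<partial>\<nu>)"
      using K ci by (intro integral_mono) auto
    finally show ?thesis by (simp add: prob_space)
  qed
  moreover obtain K where "\<forall>k\<ge>K. \<forall>p. \<bar>cesaro f (m (r k)) p - c\<bar> \<le> \<epsilon> / 2"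
    using c[of "\<epsilon> / 2"] \<open>\<epsilon> > 0\<close> by auto
  then have "\<bar>cesaro f (m (r K)) p - c\<bar> \<le> \<epsilon> / 2" for p by blast
  moreover obtain p where "\<bar>cesaro f (m (r K)) p - I\<bar> > \<epsilon>" using m(2) by blast
  ultimately show False
  proof -
    assume c: "\<bar>I - c\<bar> \<le> \<epsilon> / 2" "\<And>p. \<bar>cesaro f (m (r K)) p - c\<bar> \<le> \<epsilon> / 2"
      and p: "\<bar>cesaro f (m (r K)) p - I\<bar> > \<epsilon>"
    show False using c(1) c(2)[of p] p by linarith
  qed
qed

end

section \<open>Measurability of the projective action\<close>

lemma continuous_on_vec_unit_rep:
  "continuous_on UNIV (\<lambda>(v :: complex ^ 'n ^ 'n, p). (norm (v *v unit_rep p))\<^sup>2)"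
proof (rule continuous_on_unit_rep)
  show "continuous_on UNIV (\<lambda>(v :: complex ^ 'n ^ 'n, x). (norm (v *v x))\<^sup>2)"
    unfolding case_prod_beta by (intro continuous_intros)
qed (simp add: vector_scalar_commute norm_vector_smult)

lemma continuous_on_hom2_unit_rep:
  fixes f :: "('n :: finite) cproj \<Rightarrow> real"
  assumes f: "continuous_on UNIV f"
  shows "continuous_on UNIV (\<lambda>(v, p). hom2 f (v *v unit_rep p))"
proof (rule continuous_on_unit_rep)
  show "continuous_on UNIV (\<lambda>(v, x). hom2 f (v *v x))"
    unfolding case_prod_beta
    by (rule continuous_on_compose2[OF continuous_on_hom2[OF f]]) (auto intro!: continuous_intros)
qed (simp add: vector_scalar_commute hom2_smult)

lemma borel_measurable_norm_unit_rep:
  fixes F :: "'a \<Rightarrow> complex ^ 'n ^ 'n"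
  assumes "F \<in> borel_measurable M" "G \<in> M \<rightarrow>\<^sub>M borel"
  shows "(\<lambda>z. (norm (F z *v unit_rep (G z)))\<^sup>2) \<in> borel_measurable M"
  using borel_measurable_continuous_Pair[OF assms, of "\<lambda>v p. (norm (v *v unit_rep p))\<^sup>2"]
    continuous_on_vec_unit_rep by (simp add: case_prod_beta)

text \<open>On the closed set of pairs where the vector is mapped to \<open>0\<close> the function is constant, and
  elsewhere it is a quotient of continuous functions.\<close>

lemma borel_measurable_continuous_act:
  fixes f :: "('n :: finite) cproj \<Rightarrow> real"
  assumes f: "continuous_on UNIV f"
    and F: "F \<in> borel_measurable M" "G \<in> M \<rightarrow>\<^sub>M borel"
  shows "(\<lambda>z. f (act (F z) (G z))) \<in> borel_measurable M"
proof -
  have [measurable]: "(\<lambda>z. hom2 f (F z *v unit_rep (G z))) \<in> borel_measurable M"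
    using borel_measurable_continuous_Pair[OF F, of "\<lambda>v p. hom2 f (v *v unit_rep p)"]
      continuous_on_hom2_unit_rep[OF f] by (simp add: case_prod_beta)
  have [measurable]: "(\<lambda>z. (norm (F z *v unit_rep (G z)))\<^sup>2) \<in> borel_measurable M"
    by (rule borel_measurable_norm_unit_rep[OF F])
  have e: "f (act (F z) (G z)) = (if (norm (F z *v unit_rep (G z)))\<^sup>2 = 0 then f (proj 0)
      else hom2 f (F z *v unit_rep (G z)) / (norm (F z *v unit_rep (G z)))\<^sup>2)" for z
    by (simp add: act_def hom2_def)
  show ?thesis unfolding e by measurable
qed

text \<open>An open set is the set where the distance to its complement is positive, and this distance is a
  continuous real function of the image point.\<close>

lemma borel_measurable_act:
  fixes F :: "'a \<Rightarrow> complex ^ 'n ^ 'n"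
  assumes F: "F \<in> borel_measurable M" "G \<in> M \<rightarrow>\<^sub>M borel"
  shows "(\<lambda>z. act (F z) (G z)) \<in> M \<rightarrow>\<^sub>M borel"
proof (rule borel_measurableI)
  fix U :: "'n cproj set" assume U: "open U"
  show "(\<lambda>z. act (F z) (G z)) -` U \<inter> space M \<in> sets M"
  proof (cases "U = UNIV")
    case False
    have "(\<lambda>z. infdist (act (F z) (G z)) (- U)) \<in> borel_measurable M"
      by (rule borel_measurable_continuous_act[OF _ F]) (intro continuous_intros)
    then have "{z \<in> space M. infdist (act (F z) (G z)) (- U) \<noteq> 0} \<in> sets M" by measurable
    also have "{z \<in> space M. infdist (act (F z) (G z)) (- U) \<noteq> 0} = (\<lambda>z. act (F z) (G z)) -` U \<inter> space M"
      using in_closed_iff_infdist_zero[of "- U"] U False by auto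
    finally show ?thesis .
  qed simp
qed

section \<open>Invariant measures\<close>

context kraus_measure
begin

lemma nn_integral_hom2:
  assumes "continuous_on UNIV f" "\<And>p. f p \<ge> 0"
  shows "(\<integral>\<^sup>+v. ennreal (hom2 f (v *v x)) \<partial>\<mu>) = ennreal (hom2 (markov f) x)"
  unfolding hom2_markov transfer_def
  by (intro nn_integral_eq_integral integrable_action[OF matrix_action_vec quad_growth_hom2] assms AE_I2)
     (simp add: hom2_def assms)

lemma markov_add_const:
  assumes "continuous_on UNIV f"
  shows "markov (\<lambda>p. f p + c) p = markov f p + c"
proof -
  have "hom2 (\<lambda>p. f p + c) = (\<lambda>z. hom2 f z + c * (norm z)\<^sup>2)"
    by (simp add: hom2_def fun_eq_iff algebra_simps)
  then show ?thesis
    using integrable_action[OF matrix_action_vec quad_growth_hom2[OF assms], of "unit_rep p"]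
      integrable_action[OF matrix_action_vec quad_growth_norm_sq, of "unit_rep p"]
    by (simp add: markov_def transfer_def integral_norm_sq unit_rep)
qed

lemma markov_nonneg: "(\<And>p. f p \<ge> 0) \<Longrightarrow> markov f p \<ge> 0"
  unfolding markov_def transfer_def by (intro integral_nonneg_AE AE_I2) (simp add: hom2_def)

text \<open>Invariance is stated for sets. It says that \<open>\<nu>\<close> is the image under \<open>act\<close> of \<open>\<nu> \<otimes> \<mu>\<close> with density
  \<open>(norm (v *v unit_rep p))\<^sup>2\<close>, and equality of the two measures gives equality of all integrals.\<close>

lemma nn_integral_invariant:
  assumes inv: "invariant_prob \<mu> \<nu>" and f: "continuous_on UNIV f" "\<And>p. f p \<ge> 0"
  shows "(\<integral>\<^sup>+p. ennreal (markov f p) \<partial>\<nu>) = (\<integral>\<^sup>+p. ennreal (f p) \<partial>\<nu>)"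
proof -
  have sets_\<nu> [measurable_cong]: "sets \<nu> = sets borel" using inv by (simp add: invariant_prob_def borel_prob_def)
  define w where "w = (\<lambda>(p, v :: complex ^ 'n ^ 'n). ennreal ((norm (v *v unit_rep p))\<^sup>2))"
  have w [measurable]: "w \<in> borel_measurable (\<nu> \<Otimes>\<^sub>M \<mu>\<^sub>0)"
    unfolding w_def case_prod_beta
    by (intro measurable_compose[OF _ measurable_ennreal] borel_measurable_norm_unit_rep) measurable
  define \<alpha> where "\<alpha> = (\<lambda>(p :: 'n cproj, v :: complex ^ 'n ^ 'n). act v p)"
  have \<alpha> [measurable]: "\<alpha> \<in> (\<nu> \<Otimes>\<^sub>M \<mu>\<^sub>0) \<rightarrow>\<^sub>M borel"
    unfolding \<alpha>_def case_prod_beta by (intro borel_measurable_act) measurable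
  have act_p [measurable]: "(\<lambda>v. act v p) \<in> borel \<rightarrow>\<^sub>M borel" for p :: "'n cproj"
    by (intro borel_measurable_act) measurable
  have w_p [measurable]: "(\<lambda>v :: complex ^ 'n ^ 'n. ennreal ((norm (v *v unit_rep p))\<^sup>2)) \<in> borel_measurable borel" for p
    by (intro measurable_compose[OF _ measurable_ennreal] borel_measurable_norm_unit_rep) measurable
  have push: "(\<integral>\<^sup>+z. w z * h (\<alpha> z) \<partial>(\<nu> \<Otimes>\<^sub>M \<mu>\<^sub>0))
      = (\<integral>\<^sup>+p. (\<integral>\<^sup>+v. h (act v p) * ennreal ((norm (v *v unit_rep p))\<^sup>2) \<partial>\<mu>) \<partial>\<nu>)"
    if [measurable]: "h \<in> borel_measurable borel" for h :: "'n cproj \<Rightarrow> ennreal"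
  proof -
    have "(\<integral>\<^sup>+z. w z * h (\<alpha> z) \<partial>(\<nu> \<Otimes>\<^sub>M \<mu>\<^sub>0))
      = (\<integral>\<^sup>+p. (\<integral>\<^sup>+v. w (p, v) * h (act v p) \<partial>\<mu>\<^sub>0) \<partial>\<nu>)"
      by (subst sigma_finite_measure.nn_integral_fst[OF sigma_finite_\<mu>\<^sub>0, symmetric]) (measurable, simp add: \<alpha>_def)
    also have "\<dots> = (\<integral>\<^sup>+p. (\<integral>\<^sup>+v. h (act v p) * ennreal ((norm (v *v unit_rep p))\<^sup>2) \<partial>\<mu>) \<partial>\<nu>)"
    proof (rule nn_integral_cong)
      fix p
      show "(\<integral>\<^sup>+v. w (p, v) * h (act v p) \<partial>\<mu>\<^sub>0) = (\<integral>\<^sup>+v. h (act v p) * ennreal ((norm (v *v unit_rep p))\<^sup>2) \<partial>\<mu>)"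
        unfolding w_def case_prod_conv
        by (subst nn_integral_\<mu>\<^sub>0) (measurable, simp_all add: mult.commute)
    qed
    finally show ?thesis .
  qed
  have N_int: "(\<integral>\<^sup>+x. h x \<partial>distr (density (\<nu> \<Otimes>\<^sub>M \<mu>\<^sub>0) w) borel \<alpha>)
      = (\<integral>\<^sup>+z. w z * h (\<alpha> z) \<partial>(\<nu> \<Otimes>\<^sub>M \<mu>\<^sub>0))"
    if h [measurable]: "h \<in> borel_measurable borel" for h :: "'n cproj \<Rightarrow> ennreal"
  proof -
    have "(\<integral>\<^sup>+x. h x \<partial>distr (density (\<nu> \<Otimes>\<^sub>M \<mu>\<^sub>0) w) borel \<alpha>)
        = (\<integral>\<^sup>+z. h (\<alpha> z) \<partial>density (\<nu> \<Otimes>\<^sub>M \<mu>\<^sub>0) w)"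
      by (rule nn_integral_distr) measurable
    also have "\<dots> = (\<integral>\<^sup>+z. w z * h (\<alpha> z) \<partial>(\<nu> \<Otimes>\<^sub>M \<mu>\<^sub>0))"
      by (rule nn_integral_density) measurable
    finally show ?thesis .
  qed
  define N where "N = distr (density (\<nu> \<Otimes>\<^sub>M \<mu>\<^sub>0) w) borel \<alpha>"
  have "N = \<nu>"
  proof (rule measure_eqI)
    fix S assume "S \<in> sets N"
    then have S [measurable]: "S \<in> sets borel" by (simp add: N_def)
    have "emeasure N S = (\<integral>\<^sup>+x. indicator S x \<partial>N)"
      by (rule nn_integral_indicator[symmetric]) (simp add: N_def)
    also have "\<dots> = (\<integral>\<^sup>+z. w z * indicator S (\<alpha> z) \<partial>(\<nu> \<Otimes>\<^sub>M \<mu>\<^sub>0))"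
      unfolding N_def by (rule N_int) measurable
    also have "\<dots> = (\<integral>\<^sup>+p. kernel \<mu> p S \<partial>\<nu>)"
      by (subst push) (simp_all add: kernel_def)
    also have "\<dots> = emeasure \<nu> S" using inv S by (simp add: invariant_prob_def)
    finally show "emeasure N S = emeasure \<nu> S" .
  qed (simp add: N_def sets_\<nu>)
  have [measurable]: "f \<in> borel_measurable borel"
    by (rule borel_measurable_continuous_onI[OF f(1)])
  have "(\<integral>\<^sup>+p. ennreal (f p) \<partial>\<nu>) = (\<integral>\<^sup>+p. ennreal (f p) \<partial>N)" by (simp add: \<open>N = \<nu>\<close>)
  also have "\<dots> = (\<integral>\<^sup>+z. w z * ennreal (f (\<alpha> z)) \<partial>(\<nu> \<Otimes>\<^sub>M \<mu>\<^sub>0))"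
    unfolding N_def by (rule N_int) measurable
  also have "\<dots> = (\<integral>\<^sup>+p. (\<integral>\<^sup>+v. ennreal (f (act v p)) * ennreal ((norm (v *v unit_rep p))\<^sup>2) \<partial>\<mu>) \<partial>\<nu>)"
    by (subst push) simp_all
  also have "\<dots> = (\<integral>\<^sup>+p. (\<integral>\<^sup>+v. ennreal (hom2 f (v *v unit_rep p)) \<partial>\<mu>) \<partial>\<nu>)"
    by (intro nn_integral_cong) (simp add: hom2_def act_def ennreal_mult f(2) mult.commute)
  also have "\<dots> = (\<integral>\<^sup>+p. ennreal (markov f p) \<partial>\<nu>)"
    by (simp add: nn_integral_hom2[OF f])
  finally show ?thesis by simp
qed

lemma integral_invariant:
  assumes inv: "invariant_prob \<mu> \<nu>" and f: "continuous_on UNIV f"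
  shows "(\<integral>p. markov f p \<partial>\<nu>) = (\<integral>p. f p \<partial>\<nu>)"
proof -
  have \<nu>: "borel_prob \<nu>" using inv by (simp add: invariant_prob_def)
  then interpret prob_space \<nu> by (simp add: borel_prob_def)
  obtain C where C: "\<And>p. \<bar>f p\<bar> \<le> C" using continuous_bounded_cproj[OF f] by blast
  let ?g = "\<lambda>p. f p + C"
  have g: "continuous_on UNIV ?g" by (intro continuous_intros f)
  have g0: "?g p \<ge> 0" for p using C[of p] by linarith
  note int = integrable_continuous_cproj[OF \<nu>]
  have m0: "markov ?g p \<ge> 0" for p by (rule markov_nonneg[OF g0])
  have "ennreal (\<integral>p. markov ?g p \<partial>\<nu>) = ennreal (\<integral>p. ?g p \<partial>\<nu>)"
    using nn_integral_invariant[OF inv g g0] g0 m0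
      nn_integral_eq_integral[OF int[OF g]] nn_integral_eq_integral[OF int[OF continuous_on_markov[OF g]]]
    by simp
  then have "(\<integral>p. markov ?g p \<partial>\<nu>) = (\<integral>p. ?g p \<partial>\<nu>)"
    using g0 m0 by (simp add: integral_nonneg_AE)
  then show ?thesis
    by (simp add: markov_add_const[OF f] int f continuous_on_markov prob_space)
qed

end

section \<open>The strong law for bounded orthogonal variables\<close>

text \<open>From the square \<open>s\<^sup>2\<close> to any index before the next square the partial sums move by at most
  \<open>2 * B * s\<close>, which is negligible compared with \<open>s\<^sup>2\<close>.\<close>

lemma average_from_squares:
  fixes d :: "nat \<Rightarrow> real"
  assumes bound: "\<And>k. \<bar>d k\<bar> \<le> B"
    and sq: "(\<lambda>m. (\<Sum>k<(Suc m)\<^sup>2. d k) / real ((Suc m)\<^sup>2)) \<longlonglongrightarrow> 0"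
  shows "(\<lambda>n. (\<Sum>k<n. d k) / real n) \<longlonglongrightarrow> 0"
proof -
  have B: "B \<ge> 0" using bound[of 0] by linarith
  \<comment> \<open>\<open>Suc (m n)\<close> is the integer part of the square root of \<open>Suc n\<close>, which is at least \<open>1\<close>.\<close>
  define m where "m n = nat \<lfloor>sqrt (real (Suc n))\<rfloor> - 1" for n
  have m: "(Suc (m n))\<^sup>2 \<le> Suc n" "Suc n \<le> (Suc (m n))\<^sup>2 + 2 * Suc (m n)" for n
  proof -
    define s where "s = nat \<lfloor>sqrt (real (Suc n))\<rfloor>"
    have s1: "s \<ge> 1" by (simp add: s_def le_nat_floor)
    have "real s \<le> sqrt (real (Suc n))" unfolding s_def by (rule of_nat_floor) simp
    then have "(real s)\<^sup>2 \<le> (sqrt (real (Suc n)))\<^sup>2" by (rule power_mono) simp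
    then have "real (s\<^sup>2) \<le> real (Suc n)" by simp
    then have a: "s\<^sup>2 \<le> Suc n" by (simp only: of_nat_le_iff)
    have "sqrt (real (Suc n)) < real s + 1" unfolding s_def by linarith
    then have "(sqrt (real (Suc n)))\<^sup>2 < (real s + 1)\<^sup>2" by (rule power_strict_mono) auto
    then have "real (Suc n) < real ((s + 1)\<^sup>2)" by (simp add: add.commute)
    then have b: "Suc n < (s + 1)\<^sup>2" by (simp only: of_nat_less_iff)
    have e: "Suc (m n) = s" using s1 by (simp add: m_def s_def)
    show "(Suc (m n))\<^sup>2 \<le> Suc n" "Suc n \<le> (Suc (m n))\<^sup>2 + 2 * Suc (m n)"
      using a b unfolding e by (simp_all add: power2_eq_square algebra_simps)
  qed
  have m_lim: "filterlim m at_top sequentially"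
    unfolding filterlim_at_top eventually_sequentially
  proof (intro allI exI impI)
    fix K n :: nat assume "(K + 1)\<^sup>2 + 2 * (K + 1) \<le> n"
    show "K \<le> m n"
    proof (rule ccontr)
      assume "\<not> K \<le> m n"
      then have "Suc (m n) \<le> K" by simp
      then have "(Suc (m n))\<^sup>2 + 2 * Suc (m n) \<le> K\<^sup>2 + 2 * K" by (intro add_mono power_mono) auto
      also have "\<dots> < (K + 1)\<^sup>2 + 2 * (K + 1)" by (simp add: power2_eq_square)
      finally show False using m(2)[of n] \<open>(K + 1)\<^sup>2 + 2 * (K + 1) \<le> n\<close> by linarith
    qed
  qed
  let ?S = "\<lambda>n. \<Sum>k<n. d k"
  have le: "\<bar>?S (Suc n) / real (Suc n)\<bar> \<le> \<bar>?S ((Suc (m n))\<^sup>2) / real ((Suc (m n))\<^sup>2)\<bar> + 2 * B * inverse (real (Suc (m n)))" for n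
  proof -
    define s where "s = Suc (m n)"
    have s: "s\<^sup>2 \<le> Suc n" "Suc n \<le> s\<^sup>2 + 2 * s" "s > 0" using m[of n] by (simp_all add: s_def)
    have "?S (Suc n) = ?S (s\<^sup>2) + (\<Sum>k=s\<^sup>2..<Suc n. d k)"
      using sum.atLeastLessThan_concat[of 0 "s\<^sup>2" "Suc n" d] s(1) by (simp add: atLeast0LessThan)
    moreover have "\<bar>\<Sum>k=s\<^sup>2..<Suc n. d k\<bar> \<le> B * (2 * real s)"
    proof -
      have "\<bar>\<Sum>k=s\<^sup>2..<Suc n. d k\<bar> \<le> (\<Sum>k=s\<^sup>2..<Suc n. B)"
        by (rule order_trans[OF sum_abs]) (intro sum_mono bound)
      also have "\<dots> = B * real (Suc n - s\<^sup>2)" by simp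
      also have "\<dots> \<le> B * (2 * real s)"
      proof (intro mult_left_mono B)
        have "Suc n - s\<^sup>2 \<le> 2 * s" using s(2) by simp
        then show "real (Suc n - s\<^sup>2) \<le> 2 * real s" by linarith
      qed
      finally show ?thesis .
    qed
    ultimately have "\<bar>?S (Suc n)\<bar> \<le> \<bar>?S (s\<^sup>2)\<bar> + B * (2 * real s)" by linarith
    then have "\<bar>?S (Suc n)\<bar> / real (Suc n) \<le> (\<bar>?S (s\<^sup>2)\<bar> + B * (2 * real s)) / real (Suc n)"
      by (rule divide_right_mono) simp
    also have "\<dots> \<le> (\<bar>?S (s\<^sup>2)\<bar> + B * (2 * real s)) / real (s\<^sup>2)"
    proof (rule divide_left_mono)
      show "real (s\<^sup>2) \<le> real (Suc n)" using s(1) by (simp only: of_nat_le_iff)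
    qed (use B s(3) in auto)
    also have "\<dots> = \<bar>?S (s\<^sup>2)\<bar> / real (s\<^sup>2) + 2 * B * inverse (real s)"
    proof -
      have "(a + B * (2 * t)) / t\<^sup>2 = a / t\<^sup>2 + 2 * B * inverse t" if "t > 0" for a t :: real
      proof -
        have "t / t\<^sup>2 = inverse t" using that by (simp add: power2_eq_square inverse_eq_divide)
        moreover have "(a + B * (2 * t)) / t\<^sup>2 = a / t\<^sup>2 + 2 * B * (t / t\<^sup>2)"
          by (simp add: add_divide_distrib)
        ultimately show ?thesis by simp
      qed
      from this[of "real s"] show ?thesis using s(3) by (simp only: of_nat_power of_nat_0_less_iff)
    qed
    finally show ?thesis by (simp add: s_def[symmetric])
  qed
  have "(\<lambda>n. \<bar>?S ((Suc (m n))\<^sup>2) / real ((Suc (m n))\<^sup>2)\<bar> + 2 * B * inverse (real (Suc (m n)))) \<longlonglongrightarrow> \<bar>0\<bar> + 2 * B * 0"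
    by (intro tendsto_add tendsto_rabs tendsto_mult tendsto_const
        filterlim_compose[OF sq m_lim] filterlim_compose[OF LIMSEQ_inverse_real_of_nat m_lim])
  then have l: "(\<lambda>n. \<bar>?S ((Suc (m n))\<^sup>2) / real ((Suc (m n))\<^sup>2)\<bar> + 2 * B * inverse (real (Suc (m n)))) \<longlonglongrightarrow> 0"
    by simp
  have "(\<lambda>n. ?S (Suc n) / real (Suc n)) \<longlonglongrightarrow> 0"
    by (rule Lim_null_comparison[OF _ l]) (use le in \<open>auto intro!: always_eventually\<close>)
  then show ?thesis by (rule LIMSEQ_imp_Suc)
qed

context prob_space
begin

text \<open>Orthogonality bounds the second moment of the \<open>n\<close>-th average by \<open>B\<^sup>2 / n\<close>, which is summable
  along the squares. Hence the averages tend to \<open>0\<close> almost surely along the squares, and boundedness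
  fills the gaps.\<close>

lemma orthogonal_strong_law:
  fixes D :: "nat \<Rightarrow> 'a \<Rightarrow> real"
  assumes meas [measurable]: "\<And>k. D k \<in> borel_measurable M"
    and bound: "\<And>k \<xi>. \<bar>D k \<xi>\<bar> \<le> B"
    and orth: "\<And>j k. j < k \<Longrightarrow> expectation (\<lambda>\<xi>. D j \<xi> * D k \<xi>) = 0"
  shows "AE \<xi> in M. (\<lambda>n. (\<Sum>k<n. D k \<xi>) / real n) \<longlonglongrightarrow> 0"
proof -
  have B: "B \<ge> 0" using bound[of 0 undefined] by linarith
  have intDD: "integrable M (\<lambda>\<xi>. D j \<xi> * D k \<xi>)" for j k
  proof (rule integrable_const_bound[where B = "B * B"])
    show "AE \<xi> in M. norm (D j \<xi> * D k \<xi>) \<le> B * B"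
      using bound B by (intro AE_I2) (simp add: abs_mult mult_mono)
  qed simp
  have second: "expectation (\<lambda>\<xi>. (\<Sum>k<n. D k \<xi>)\<^sup>2) \<le> B\<^sup>2 * real n" for n
  proof -
    have o: "expectation (\<lambda>\<xi>. D j \<xi> * D k \<xi>) = (if j = k then expectation (\<lambda>\<xi>. D k \<xi> * D k \<xi>) else 0)" for j k
      using orth[of j k] orth[of k j] by (cases j k rule: linorder_cases) (simp_all add: mult.commute)
    have "expectation (\<lambda>\<xi>. (\<Sum>k<n. D k \<xi>)\<^sup>2) = expectation (\<lambda>\<xi>. \<Sum>j<n. \<Sum>k<n. D j \<xi> * D k \<xi>)"
      by (simp add: power2_eq_square sum_product)
    also have "\<dots> = (\<Sum>j<n. \<Sum>k<n. expectation (\<lambda>\<xi>. D j \<xi> * D k \<xi>))"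
      by (simp add: intDD)
    also have "\<dots> = (\<Sum>j<n. expectation (\<lambda>\<xi>. D j \<xi> * D j \<xi>))"
      by (subst o) simp
    also have "\<dots> \<le> (\<Sum>j<n. B\<^sup>2)"
    proof (rule sum_mono)
      fix j
      have "expectation (\<lambda>\<xi>. D j \<xi> * D j \<xi>) \<le> expectation (\<lambda>\<xi>. B * B)"
      proof (rule integral_mono[OF intDD])
        fix \<xi>
        have "\<bar>D j \<xi>\<bar> * \<bar>D j \<xi>\<bar> \<le> B * B" using bound B by (intro mult_mono) auto
        then show "D j \<xi> * D j \<xi> \<le> B * B" by simp
      qed simp
      then show "expectation (\<lambda>\<xi>. D j \<xi> * D j \<xi>) \<le> B\<^sup>2" by (simp add: prob_space power2_eq_square)
    qed
    finally show ?thesis by (simp add: mult.commute)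
  qed
  define Y where "Y m \<xi> = ((\<Sum>k<(Suc m)\<^sup>2. D k \<xi>) / real ((Suc m)\<^sup>2))\<^sup>2" for m \<xi>
  have Y [measurable]: "Y m \<in> borel_measurable M" for m unfolding Y_def by measurable
  have EY: "(\<integral>\<^sup>+\<xi>. ennreal (Y m \<xi>) \<partial>M) \<le> ennreal (B\<^sup>2 * inverse (real (Suc m) ^ 2))" for m
  proof -
    let ?N = "(Suc m)\<^sup>2"
    have int: "integrable M (\<lambda>\<xi>. (\<Sum>k<?N. D k \<xi>)\<^sup>2)"
      by (simp add: power2_eq_square[of "sum _ _"] sum_product intDD)
    have Y_eq: "Y m = (\<lambda>\<xi>. (\<Sum>k<?N. D k \<xi>)\<^sup>2 / (real ?N)\<^sup>2)" by (simp add: Y_def fun_eq_iff power_divide)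
    have "(\<integral>\<^sup>+\<xi>. ennreal (Y m \<xi>) \<partial>M) = ennreal (expectation (Y m))"
      using int by (intro nn_integral_eq_integral) (auto simp: Y_eq)
    also have "\<dots> \<le> ennreal (B\<^sup>2 * inverse (real (Suc m) ^ 2))"
    proof (rule ennreal_leI)
      have "expectation (Y m) = expectation (\<lambda>\<xi>. (\<Sum>k<?N. D k \<xi>)\<^sup>2) / (real ?N)\<^sup>2" by (simp add: Y_eq)
      also have "\<dots> \<le> B\<^sup>2 * real ?N / (real ?N)\<^sup>2" by (intro divide_right_mono second) simp
      also have "\<dots> = B\<^sup>2 * inverse (real (Suc m) ^ 2)"
      proof -
        have "B\<^sup>2 * x / x\<^sup>2 = B\<^sup>2 * inverse x" if "x > 0" for x :: real
          using that by (simp add: power2_eq_square field_simps)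
        from this[of "real ?N"] show ?thesis by (simp only: of_nat_power) simp
      qed
      finally show "expectation (Y m) \<le> B\<^sup>2 * inverse (real (Suc m) ^ 2)" .
    qed
    finally show ?thesis .
  qed
  have "summable (\<lambda>m. inverse (real (Suc m) ^ 2))"
    using inverse_power_summable[of 2, where 'a = real] by (subst summable_Suc_iff) auto
  then have sm: "summable (\<lambda>m. B\<^sup>2 * inverse (real (Suc m) ^ 2))" by (rule summable_mult)
  have "(\<integral>\<^sup>+\<xi>. (\<Sum>m. ennreal (Y m \<xi>)) \<partial>M) = (\<Sum>m. \<integral>\<^sup>+\<xi>. ennreal (Y m \<xi>) \<partial>M)"
    by (rule nn_integral_suminf) measurable
  also have "\<dots> \<le> (\<Sum>m. ennreal (B\<^sup>2 * inverse (real (Suc m) ^ 2)))"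
    by (intro suminf_le EY) auto
  also have "\<dots> = ennreal (\<Sum>m. B\<^sup>2 * inverse (real (Suc m) ^ 2))"
    by (intro suminf_ennreal_eq summable_sums sm) auto
  also have "\<dots> < \<infinity>" by simp
  finally have fin: "(\<integral>\<^sup>+\<xi>. (\<Sum>m. ennreal (Y m \<xi>)) \<partial>M) \<noteq> \<infinity>" by simp
  have "(\<lambda>\<xi>. \<Sum>m. ennreal (Y m \<xi>)) \<in> borel_measurable M" by measurable
  then have "AE \<xi> in M. (\<Sum>m. ennreal (Y m \<xi>)) \<noteq> \<infinity>"
    using fin by (rule nn_integral_PInf_AE)
  then show ?thesis
  proof (rule eventually_mono)
    fix \<xi> assume "(\<Sum>m. ennreal (Y m \<xi>)) \<noteq> \<infinity>"
    then have "summable (\<lambda>m. Y m \<xi>)"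
      by (intro summable_suminf_not_top) (auto simp: Y_def)
    then have "(\<lambda>m. Y m \<xi>) \<longlonglongrightarrow> 0" by (rule summable_LIMSEQ_zero)
    then have "(\<lambda>m. sqrt (Y m \<xi>)) \<longlonglongrightarrow> sqrt 0" by (rule tendsto_real_sqrt)
    then have "(\<lambda>m. \<bar>(\<Sum>k<(Suc m)\<^sup>2. D k \<xi>) / real ((Suc m)\<^sup>2)\<bar>) \<longlonglongrightarrow> 0"
      unfolding Y_def real_sqrt_abs by simp
    then have "(\<lambda>m. (\<Sum>k<(Suc m)\<^sup>2. D k \<xi>) / real ((Suc m)\<^sup>2)) \<longlonglongrightarrow> 0"
      by (rule tendsto_rabs_zero_cancel)
    then show "(\<lambda>n. (\<Sum>k<n. D k \<xi>) / real n) \<longlonglongrightarrow> 0"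
      by (rule average_from_squares[OF bound])
  qed
qed

end

section \<open>The law of the quantum trajectory\<close>

locale quantum_trajectory = kraus_measure \<mu> for \<mu> :: "(complex ^ 'n ^ 'n) measure" +
  fixes \<nu> :: "('n cproj) measure" and P :: "('n cproj \<times> (nat \<Rightarrow> complex ^ 'n ^ 'n)) measure"
  assumes initial: "borel_prob \<nu>" and trajectory: "trajectory_measure \<mu> \<nu> P"
begin

lemma sets_P [measurable_cong]: "sets P = sets (borel \<Otimes>\<^sub>M PiM UNIV (\<lambda>_. borel))"
  using trajectory by (simp add: trajectory_measure_def)

lemma space_P [simp]: "space P = UNIV"
  using sets_eq_imp_space_eq[OF sets_P] by (simp add: space_pair_measure space_PiM)

lemma sets_\<nu> [simp, measurable_cong]: "sets \<nu> = sets borel"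
  using initial by (simp add: borel_prob_def)

lemma space_\<nu> [simp]: "space \<nu> = UNIV"
  using sets_eq_imp_space_eq[OF sets_\<nu>] by simp

lemma emeasure_cylinder:
  assumes "S \<in> sets borel" "B \<in> sets (PiM {..<n} (\<lambda>_. borel))"
  shows "emeasure P (S \<times> prod_emb UNIV (\<lambda>_. borel) {..<n} B) =
    (\<integral>\<^sup>+p\<in>S. (\<integral>\<^sup>+\<omega>\<in>B. ennreal ((norm (W n \<omega> *v unit_rep p))\<^sup>2) \<partial>PiM {..<n} (\<lambda>_. \<mu>)) \<partial>\<nu>)"
  using trajectory assms unfolding trajectory_measure_def by blast

sublocale prob_space P
  using trajectory by (simp add: trajectory_measure_def)

text \<open>The cylinder formula for the whole space expresses the total mass \<open>1\<close> as an integral against the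
  product measure, which therefore cannot vanish.\<close>

sublocale kraus_product \<mu>
proof
  fix n :: nat
  let ?M = "PiM {..<n} (\<lambda>_. \<mu>)"
  show "emeasure ?M (space ?M) \<noteq> 0"
  proof
    assume z: "emeasure ?M (space ?M) = 0"
    have M: "sets ?M = sets (PiM {..<n} (\<lambda>_. borel))" by (intro sets_PiM_cong) auto
    have null: "space ?M \<in> null_sets ?M" using z by (intro null_setsI) auto
    have "emeasure P (UNIV \<times> prod_emb UNIV (\<lambda>_. borel) {..<n} (space ?M))
      = (\<integral>\<^sup>+p\<in>UNIV. (\<integral>\<^sup>+\<omega>\<in>space ?M. ennreal ((norm (W n \<omega> *v unit_rep p))\<^sup>2) \<partial>?M) \<partial>\<nu>)"
      by (rule emeasure_cylinder) (simp_all add: M[symmetric])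
    also have "\<dots> = 0"
      by (simp only: nn_integral_null_set[OF null]) simp
    finally have "emeasure P (UNIV \<times> prod_emb UNIV (\<lambda>_. borel) {..<n} (space ?M)) = 0" .
    moreover have "UNIV \<times> prod_emb UNIV (\<lambda>_. borel) {..<n} (space ?M) = space P"
      by (auto simp: prod_emb_def space_PiM PiE_iff)
    ultimately show False using emeasure_space_1 by simp
  qed
qed

definition history :: "nat \<Rightarrow> 'n cproj \<times> (nat \<Rightarrow> complex ^ 'n ^ 'n) \<Rightarrow> 'n cproj \<times> (nat \<Rightarrow> complex ^ 'n ^ 'n)" where
  "history n \<xi> = (fst \<xi>, restrict (snd \<xi>) {..<n})"

lemma measurable_history [measurable]: "history n \<in> P \<rightarrow>\<^sub>M borel \<Otimes>\<^sub>M PiM {..<n} (\<lambda>_. borel)"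
proof -
  have "history n \<in> borel \<Otimes>\<^sub>M PiM UNIV (\<lambda>_. borel) \<rightarrow>\<^sub>M borel \<Otimes>\<^sub>M PiM {..<n} (\<lambda>_. borel)"
    unfolding history_def[abs_def]
    by (intro measurable_Pair measurable_fst measurable_compose[OF measurable_snd measurable_restrict_subset]) simp
  then show ?thesis by (simp cong: measurable_cong_sets add: sets_P)
qed

lemma measurable_weight [measurable]:
  "(\<lambda>(p, \<omega>). ennreal ((norm (W n \<omega> *v unit_rep p))\<^sup>2)) \<in> borel_measurable (borel \<Otimes>\<^sub>M PiM {..<n} (\<lambda>_. borel :: (complex ^ 'n ^ 'n) measure))"
  unfolding case_prod_beta
  by (intro measurable_compose[OF _ measurable_ennreal] borel_measurable_norm_unit_rep
      measurable_compose[OF measurable_snd measurable_W] measurable_fst order_refl)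

text \<open>The law of the initial state and the first \<open>n\<close> matrices: the density is \<open>\<parallel>W\<^sub>n x\<parallel>\<^sup>2\<close>. The cylinder
  formula gives its values on rectangles, which form a generator stable under intersection.\<close>

lemma nn_integral_history:
  assumes h [measurable]: "h \<in> borel_measurable (borel \<Otimes>\<^sub>M PiM {..<n} (\<lambda>_. borel))"
  shows "(\<integral>\<^sup>+\<xi>. h (history n \<xi>) \<partial>P) = (\<integral>\<^sup>+p. (\<integral>\<^sup>+\<omega>.
      h (p, \<omega>) * ennreal ((norm (W n \<omega> *v unit_rep p))\<^sup>2) \<partial>PiM {..<n} (\<lambda>_. \<mu>)) \<partial>\<nu>)"
proof -
  let ?M = "PiM {..<n} (\<lambda>_. \<mu>)" and ?N = "PiM {..<n} (\<lambda>_. \<mu>\<^sub>0)" and ?B = "PiM {..<n} (\<lambda>_. borel :: (complex ^ 'n ^ 'n) measure)"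
  note [measurable_cong] = sets_PiM_\<mu>\<^sub>0 sets_PiM_\<mu>
  have sf: "sigma_finite_measure ?N" by (rule \<mu>\<^sub>0.sigma_finite) simp
  define w where "w = (\<lambda>(p, \<omega>). ennreal ((norm (W n \<omega> *v unit_rep p :: complex ^ 'n))\<^sup>2))"
  have w [measurable]: "w \<in> borel_measurable (borel \<Otimes>\<^sub>M ?B)"
    unfolding w_def by (rule measurable_weight)
  have w' [measurable]: "w \<in> borel_measurable (\<nu> \<Otimes>\<^sub>M ?N)" by measurable
  have fub: "(\<integral>\<^sup>+z. w z * k z \<partial>(\<nu> \<Otimes>\<^sub>M ?N)) = (\<integral>\<^sup>+p. (\<integral>\<^sup>+\<omega>. k (p, \<omega>) * w (p, \<omega>) \<partial>?M) \<partial>\<nu>)"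
    if k [measurable]: "k \<in> borel_measurable (borel \<Otimes>\<^sub>M ?B)" for k
  proof -
    have "(\<integral>\<^sup>+z. w z * k z \<partial>(\<nu> \<Otimes>\<^sub>M ?N)) = (\<integral>\<^sup>+p. (\<integral>\<^sup>+\<omega>. w (p, \<omega>) * k (p, \<omega>) \<partial>?N) \<partial>\<nu>)"
      by (rule sigma_finite_measure.nn_integral_fst[OF sf, symmetric]) measurable
    also have "\<dots> = (\<integral>\<^sup>+p. (\<integral>\<^sup>+\<omega>. w (p, \<omega>) * k (p, \<omega>) \<partial>?M) \<partial>\<nu>)"
    proof (rule nn_integral_cong)
      fix p :: "'n cproj"
      show "(\<integral>\<^sup>+\<omega>. w (p, \<omega>) * k (p, \<omega>) \<partial>?N) = (\<integral>\<^sup>+\<omega>. w (p, \<omega>) * k (p, \<omega>) \<partial>?M)"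
      proof (rule nn_integral_PiM_\<mu>\<^sub>0[symmetric])
        have "(\<lambda>\<omega>. (p, \<omega>)) \<in> ?B \<rightarrow>\<^sub>M borel \<Otimes>\<^sub>M ?B" by simp
        then show "(\<lambda>\<omega>. w (p, \<omega>) * k (p, \<omega>)) \<in> borel_measurable ?B" by measurable
      next
        fix \<omega> i assume "i < n" "\<omega> i = (0 :: complex ^ 'n ^ 'n)"
        then show "w (p, \<omega>) * k (p, \<omega>) = 0" by (simp add: w_def W_eq_0)
      qed
    qed
    finally show ?thesis by (simp add: mult.commute)
  qed
  define D where "D = density (\<nu> \<Otimes>\<^sub>M ?N) w"
  have sets_D [measurable_cong]: "sets D = sets (borel \<Otimes>\<^sub>M ?B)"
    unfolding D_def sets_density by (rule sets_pair_measure_cong[OF sets_\<nu> sets_PiM_\<mu>\<^sub>0])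
  let ?H = "distr P (borel \<Otimes>\<^sub>M ?B) (history n)"
  have rect: "emeasure ?H (A \<times> C) = emeasure D (A \<times> C)"
    if A: "A \<in> sets borel" and C: "C \<in> sets ?B" for A C
  proof -
    have AC: "A \<times> C \<in> sets (borel \<Otimes>\<^sub>M ?B)" using A C by (rule pair_measureI)
    have CM: "C \<in> sets ?M" using C by (simp add: sets_PiM_\<mu>)
    have "history n -` (A \<times> C) \<inter> space P = A \<times> prod_emb UNIV (\<lambda>_. borel) {..<n} C"
      by (auto simp: history_def prod_emb_def)
    then have "emeasure ?H (A \<times> C) = emeasure P (A \<times> prod_emb UNIV (\<lambda>_. borel) {..<n} C)"
      using AC by (simp add: emeasure_distr)
    also have "\<dots> = (\<integral>\<^sup>+p. (\<integral>\<^sup>+\<omega>. w (p, \<omega>) * indicator C \<omega> \<partial>?M) * indicator A p \<partial>\<nu>)"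
      unfolding w_def case_prod_conv by (rule emeasure_cylinder[OF A C])
    also have "\<dots> = (\<integral>\<^sup>+p. (\<integral>\<^sup>+\<omega>. indicator (A \<times> C) (p, \<omega>) * w (p, \<omega>) \<partial>?M) \<partial>\<nu>)"
      by (intro nn_integral_cong) (auto simp: indicator_def mult.commute intro!: nn_integral_cong)
    also have "\<dots> = (\<integral>\<^sup>+z. w z * indicator (A \<times> C) z \<partial>(\<nu> \<Otimes>\<^sub>M ?N))"
      using AC by (intro fub[symmetric]) simp
    also have "\<dots> = emeasure D (A \<times> C)"
    proof -
      have "A \<times> C \<in> sets (\<nu> \<Otimes>\<^sub>M ?N)" using AC sets_D by (simp add: D_def)
      then show ?thesis unfolding D_def by (subst emeasure_density) (use w' in auto)
    qed
    finally show ?thesis .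
  qed
  have "?H = D"
  proof (rule measure_eqI_generator_eq[OF Int_stable_pair_measure_generator[of borel ?B]])
    let ?\<Omega> = "(UNIV :: 'n cproj set) \<times> space ?B"
    show "{a \<times> b |a b. a \<in> sets borel \<and> b \<in> sets ?B} \<subseteq> Pow ?\<Omega>"
      using sets.sets_into_space by fastforce
    show "emeasure ?H X = emeasure D X" if "X \<in> {a \<times> b |a b. a \<in> sets borel \<and> b \<in> sets ?B}" for X
      using that rect by auto
    show "sets ?H = sigma_sets ?\<Omega> {a \<times> b |a b. a \<in> sets borel \<and> b \<in> sets ?B}"
      by (simp add: sets_pair_measure)
    show "sets D = sigma_sets ?\<Omega> {a \<times> b |a b. a \<in> sets borel \<and> b \<in> sets ?B}"
      by (simp add: sets_D sets_pair_measure)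
    show "range (\<lambda>_ :: nat. ?\<Omega>) \<subseteq> {a \<times> b |a b. a \<in> sets borel \<and> b \<in> sets ?B}"
      by (intro image_subsetI CollectI exI[of _ "UNIV :: 'n cproj set"] exI[of _ "space ?B"]) simp
    show "(\<Union>i :: nat. ?\<Omega>) = ?\<Omega>" by simp
    interpret H: prob_space ?H by (rule prob_space_distr) measurable
    show "emeasure ?H ?\<Omega> \<noteq> \<infinity>" for i :: nat by simp
  qed
  have "(\<integral>\<^sup>+\<xi>. h (history n \<xi>) \<partial>P) = (\<integral>\<^sup>+z. h z \<partial>?H)"
    by (rule nn_integral_distr[symmetric]) measurable
  also have "\<dots> = (\<integral>\<^sup>+z. w z * h z \<partial>(\<nu> \<Otimes>\<^sub>M ?N))"
    unfolding \<open>?H = D\<close> D_def by (rule nn_integral_density) measurable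
  also have "\<dots> = (\<integral>\<^sup>+p. (\<integral>\<^sup>+\<omega>. h (p, \<omega>) * w (p, \<omega>) \<partial>?M) \<partial>\<nu>)"
    by (rule fub[OF h])
  finally show ?thesis by (simp add: w_def)
qed

lemma trajectory_history: "k \<le> n \<Longrightarrow> trajectory k (history n \<xi>) = trajectory k \<xi>"
proof -
  assume "k \<le> n"
  then have "W k (restrict (snd \<xi>) {..<n}) = W k (snd \<xi>)" by (intro W_cong) auto
  then show ?thesis by (simp add: trajectory_def history_def case_prod_beta)
qed

lemma measurable_trajectory_finite:
  assumes "k \<le> n"
  shows "trajectory k \<in> borel \<Otimes>\<^sub>M PiM {..<n} (\<lambda>_. borel :: (complex ^ 'n ^ 'n) measure) \<rightarrow>\<^sub>M borel"
  unfolding trajectory_def case_prod_beta using assms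
  by (intro borel_measurable_act measurable_compose[OF measurable_snd measurable_W] measurable_fst) auto

lemma measurable_trajectory [measurable]: "trajectory k \<in> P \<rightarrow>\<^sub>M borel"
  using measurable_compose[OF measurable_history measurable_trajectory_finite[OF order_refl, of k]]
  by (simp add: trajectory_history)

text \<open>The Markov property: given the first \<open>k\<close> matrices, the next state has mean \<open>markov f\<close>.\<close>

lemma nn_integral_markov_step:
  assumes a [measurable]: "a \<in> borel_measurable (borel \<Otimes>\<^sub>M PiM {..<k} (\<lambda>_. borel))"
    and f: "continuous_on UNIV f" "\<And>p. f p \<ge> 0"
  shows "(\<integral>\<^sup>+\<xi>. a (history k \<xi>) * ennreal (f (trajectory (Suc k) \<xi>)) \<partial>P)
    = (\<integral>\<^sup>+\<xi>. a (history k \<xi>) * ennreal (markov f (trajectory k \<xi>)) \<partial>P)"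
proof -
  let ?B = "\<lambda>n. PiM {..<n :: nat} (\<lambda>_. borel :: (complex ^ 'n ^ 'n) measure)"
  have [measurable]: "f \<in> borel_measurable borel" "markov f \<in> borel_measurable borel"
    by (intro borel_measurable_continuous_onI continuous_on_markov f)+
  note [measurable] = measurable_trajectory_finite[OF order_refl]
  have hist: "(\<lambda>z. (fst z, restrict (snd z) {..<k})) \<in> borel \<Otimes>\<^sub>M ?B (Suc k) \<rightarrow>\<^sub>M borel \<Otimes>\<^sub>M ?B k"
    by (intro measurable_Pair measurable_fst measurable_compose[OF measurable_snd measurable_restrict_subset]) auto
  define h where "h z = a (fst z, restrict (snd z) {..<k}) * ennreal (f (trajectory (Suc k) z))" for z
  have h: "h \<in> borel_measurable (borel \<Otimes>\<^sub>M ?B (Suc k))"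
    unfolding h_def using measurable_compose[OF hist a] by measurable
  have weight: "ennreal (f (trajectory j (p, \<omega>))) * ennreal ((norm (W j \<omega> *v unit_rep p))\<^sup>2)
      = ennreal (hom2 f (W j \<omega> *v unit_rep p))" if "\<And>p. f p \<ge> 0" for f :: "'n cproj \<Rightarrow> real" and j p \<omega>
    using that by (simp add: trajectory_def act_def hom2_def ennreal_mult mult.commute)
  have "(\<integral>\<^sup>+\<xi>. a (history k \<xi>) * ennreal (f (trajectory (Suc k) \<xi>)) \<partial>P) = (\<integral>\<^sup>+\<xi>. h (history (Suc k) \<xi>) \<partial>P)"
  proof (rule nn_integral_cong)
    fix \<xi> :: "'n cproj \<times> (nat \<Rightarrow> complex ^ 'n ^ 'n)"
    have "restrict (restrict (snd \<xi>) {..<Suc k}) {..<k} = restrict (snd \<xi>) {..<k}"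
      by (auto simp: restrict_def)
    then show "a (history k \<xi>) * ennreal (f (trajectory (Suc k) \<xi>)) = h (history (Suc k) \<xi>)"
      unfolding h_def trajectory_history[OF order_refl] by (simp add: history_def)
  qed
  also have "\<dots> = (\<integral>\<^sup>+p. (\<integral>\<^sup>+\<omega>. h (p, \<omega>) * ennreal ((norm (W (Suc k) \<omega> *v unit_rep p))\<^sup>2) \<partial>PiM {..<Suc k} (\<lambda>_. \<mu>)) \<partial>\<nu>)"
    by (rule nn_integral_history[OF h])
  also have "\<dots> = (\<integral>\<^sup>+p. (\<integral>\<^sup>+\<omega>. a (p, \<omega>) * ennreal (markov f (trajectory k (p, \<omega>)))
      * ennreal ((norm (W k \<omega> *v unit_rep p))\<^sup>2) \<partial>PiM {..<k} (\<lambda>_. \<mu>)) \<partial>\<nu>)"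
  proof (rule nn_integral_cong)
    fix p :: "'n cproj"
    define g where "g \<omega> = h (p, \<omega>) * ennreal ((norm (W (Suc k) \<omega> *v unit_rep p))\<^sup>2)" for \<omega>
    have "(\<lambda>\<omega>. (p, \<omega>)) \<in> ?B (Suc k) \<rightarrow>\<^sub>M borel \<Otimes>\<^sub>M ?B (Suc k)" by simp
    from measurable_compose[OF this borel_measurable_times_ennreal[OF h measurable_weight]]
    have g: "g \<in> borel_measurable (?B (Suc k))" by (simp add: g_def[abs_def])
    have "(\<integral>\<^sup>+\<omega>. g \<omega> \<partial>PiM {..<Suc k} (\<lambda>_. \<mu>)) = (\<integral>\<^sup>+\<omega>. (\<integral>\<^sup>+v. g (fun_upd \<omega> k v) \<partial>\<mu>) \<partial>PiM {..<k} (\<lambda>_. \<mu>))"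
    proof (rule nn_integral_PiM_Suc[OF g])
      fix \<omega> i assume "i < Suc k" "\<omega> i = (0 :: complex ^ 'n ^ 'n)"
      then show "g \<omega> = 0" unfolding g_def by (simp only: W_eq_0) simp
    qed
    also have "\<dots> = (\<integral>\<^sup>+\<omega>. a (p, \<omega>) * ennreal (markov f (trajectory k (p, \<omega>)))
      * ennreal ((norm (W k \<omega> *v unit_rep p))\<^sup>2) \<partial>PiM {..<k} (\<lambda>_. \<mu>))"
    proof (rule nn_integral_cong)
      fix \<omega> assume "\<omega> \<in> space (PiM {..<k} (\<lambda>_. \<mu>))"
      then have ext: "restrict (fun_upd \<omega> k v) {..<k} = \<omega>" for v
        by (auto simp: space_PiM PiE_def extensional_def restrict_def fun_eq_iff)
      have "g (fun_upd \<omega> k v) = a (p, \<omega>) * ennreal (hom2 f (v *v (W k \<omega> *v unit_rep p)))" for v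
      proof -
        have "g (fun_upd \<omega> k v) = a (p, \<omega>) * (ennreal (f (trajectory (Suc k) (p, fun_upd \<omega> k v)))
            * ennreal ((norm (W (Suc k) (fun_upd \<omega> k v) *v unit_rep p))\<^sup>2))"
          unfolding g_def h_def fst_conv snd_conv ext by (simp only: mult.assoc)
        also have "\<dots> = a (p, \<omega>) * ennreal (hom2 f (W (Suc k) (fun_upd \<omega> k v) *v unit_rep p))"
          by (simp only: weight[of f "Suc k" p "fun_upd \<omega> k v", OF f(2)])
        also have "W (Suc k) (fun_upd \<omega> k v) *v unit_rep p = v *v (W k \<omega> *v unit_rep p)"
          by (simp add: matrix_vector_mul_assoc)
        finally show ?thesis .
      qed
      then have "(\<integral>\<^sup>+v. g (fun_upd \<omega> k v) \<partial>\<mu>) = (\<integral>\<^sup>+v. a (p, \<omega>) * ennreal (hom2 f (v *v (W k \<omega> *v unit_rep p))) \<partial>\<mu>)"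
        by simp
      also have "\<dots> = a (p, \<omega>) * (\<integral>\<^sup>+v. ennreal (hom2 f (v *v (W k \<omega> *v unit_rep p))) \<partial>\<mu>)"
        by (intro nn_integral_cmult measurable_compose[OF _ measurable_ennreal]
            measurable_action[OF matrix_action_vec quad_growth_hom2[OF f(1)]])
      also have "\<dots> = a (p, \<omega>) * ennreal (hom2 (markov f) (W k \<omega> *v unit_rep p))"
        by (simp only: nn_integral_hom2[OF f])
      also have "\<dots> = a (p, \<omega>) * ennreal (markov f (trajectory k (p, \<omega>)))
          * ennreal ((norm (W k \<omega> *v unit_rep p))\<^sup>2)"
        unfolding weight[OF markov_nonneg[OF f(2)], symmetric] by (simp only: mult.assoc)
      finally show "(\<integral>\<^sup>+v. g (fun_upd \<omega> k v) \<partial>\<mu>) = a (p, \<omega>) * ennreal (markov f (trajectory k (p, \<omega>)))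
          * ennreal ((norm (W k \<omega> *v unit_rep p))\<^sup>2)" .
    qed
    finally show "(\<integral>\<^sup>+\<omega>. h (p, \<omega>) * ennreal ((norm (W (Suc k) \<omega> *v unit_rep p))\<^sup>2) \<partial>PiM {..<Suc k} (\<lambda>_. \<mu>))
      = (\<integral>\<^sup>+\<omega>. a (p, \<omega>) * ennreal (markov f (trajectory k (p, \<omega>)))
      * ennreal ((norm (W k \<omega> *v unit_rep p))\<^sup>2) \<partial>PiM {..<k} (\<lambda>_. \<mu>))" unfolding g_def .
  qed
  also have "\<dots> = (\<integral>\<^sup>+\<xi>. a (history k \<xi>) * ennreal (markov f (trajectory k (history k \<xi>))) \<partial>P)"
  proof (rule nn_integral_history[symmetric])
    show "(\<lambda>z. a z * ennreal (markov f (trajectory k z))) \<in> borel_measurable (borel \<Otimes>\<^sub>M ?B k)"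
      by (intro borel_measurable_times_ennreal a measurable_compose[OF _ measurable_ennreal]
          measurable_compose[OF measurable_trajectory_finite[OF order_refl]]) measurable
  qed
  finally show ?thesis by (simp add: trajectory_history)
qed

text \<open>Both \<open>a\<close> and \<open>f\<close> become nonnegative after adding constants, so the identity follows from the one
  for nonnegative functions.\<close>

lemma expectation_markov_step:
  assumes a [measurable]: "a \<in> borel_measurable (borel \<Otimes>\<^sub>M PiM {..<k} (\<lambda>_. borel))"
    and bound: "\<And>z. \<bar>a z\<bar> \<le> B" and f: "continuous_on UNIV f"
  shows "expectation (\<lambda>\<xi>. a (history k \<xi>) * (f (trajectory (Suc k) \<xi>) - markov f (trajectory k \<xi>))) = 0"
proof -
  obtain C where C: "\<And>p. \<bar>f p\<bar> \<le> C" using continuous_bounded_cproj[OF f] by blast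
  have [measurable]: "f \<in> borel_measurable borel" "markov f \<in> borel_measurable borel"
    by (intro borel_measurable_continuous_onI continuous_on_markov f)+
  have mC: "\<bar>markov f p\<bar> \<le> C" for p by (rule markov_bound[OF f C])
  have B: "B \<ge> 0" and C0: "C \<ge> 0" using bound[of undefined] C[of undefined] by linarith+
  let ?g = "\<lambda>p. f p + C"
  have g: "continuous_on UNIV ?g" by (intro continuous_intros f)
  have g0: "?g p \<ge> 0" for p using C[of p] by linarith
  have g2: "\<bar>f p + C\<bar> \<le> 2 * C" and m2: "\<bar>markov f p + C\<bar> \<le> 2 * C" for p
    using C[of p] mC[of p] by linarith+
  have int: "integrable P (\<lambda>\<xi>. b (history k \<xi>) * u \<xi>)"
    if [measurable]: "b \<in> borel_measurable (borel \<Otimes>\<^sub>M PiM {..<k} (\<lambda>_. borel))" "u \<in> borel_measurable P"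
      and "\<And>z. \<bar>b z\<bar> \<le> K" "\<And>\<xi>. \<bar>u \<xi>\<bar> \<le> L" for b u and K L :: real
  proof (rule integrable_const_bound[where B = "K * L"])
    have "K \<ge> 0" using that(3)[of undefined] by linarith
    then show "AE \<xi> in P. norm (b (history k \<xi>) * u \<xi>) \<le> K * L"
      using that(3,4) by (intro AE_I2) (simp add: abs_mult mult_mono)
  qed measurable
  have diff: "expectation (\<lambda>\<xi>. b (history k \<xi>) * (f (trajectory (Suc k) \<xi>) - markov f (trajectory k \<xi>))) = 0"
    if b [measurable]: "b \<in> borel_measurable (borel \<Otimes>\<^sub>M PiM {..<k} (\<lambda>_. borel))"
      and b0: "\<And>z. b z \<ge> 0" and bK: "\<And>z. \<bar>b z\<bar> \<le> K" for b K
  proof -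
    have m0: "markov f p + C \<ge> 0" for p using mC[of p] by linarith
    have "(\<integral>\<^sup>+\<xi>. ennreal (b (history k \<xi>)) * ennreal (?g (trajectory (Suc k) \<xi>)) \<partial>P)
        = (\<integral>\<^sup>+\<xi>. ennreal (b (history k \<xi>)) * ennreal (markov ?g (trajectory k \<xi>)) \<partial>P)"
      by (rule nn_integral_markov_step[OF _ g g0]) measurable
    then have e: "(\<integral>\<^sup>+\<xi>. ennreal (b (history k \<xi>) * ?g (trajectory (Suc k) \<xi>)) \<partial>P)
        = (\<integral>\<^sup>+\<xi>. ennreal (b (history k \<xi>) * (markov f (trajectory k \<xi>) + C)) \<partial>P)"
      by (simp add: ennreal_mult b0 g0 m0 markov_add_const[OF f])
    have i1: "integrable P (\<lambda>\<xi>. b (history k \<xi>) * ?g (trajectory (Suc k) \<xi>))"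
      by (rule int[of b _ K "2 * C", OF b _ bK]) (measurable, rule g2)
    have i2: "integrable P (\<lambda>\<xi>. b (history k \<xi>) * (markov f (trajectory k \<xi>) + C))"
      by (rule int[of b _ K "2 * C", OF b _ bK]) (measurable, rule m2)
    have "expectation (\<lambda>\<xi>. b (history k \<xi>) * ?g (trajectory (Suc k) \<xi>))
        = expectation (\<lambda>\<xi>. b (history k \<xi>) * (markov f (trajectory k \<xi>) + C))"
      by (simp add: integral_eq_nn_integral b0 g0 m0 e borel_measurable_integrable[OF i1] borel_measurable_integrable[OF i2])
    then have "expectation (\<lambda>\<xi>. b (history k \<xi>) * ?g (trajectory (Suc k) \<xi>)
        - b (history k \<xi>) * (markov f (trajectory k \<xi>) + C)) = 0"
      by (subst Bochner_Integration.integral_diff[OF i1 i2]) simp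
    then show ?thesis by (simp add: algebra_simps)
  qed
  let ?\<delta> = "\<lambda>\<xi>. f (trajectory (Suc k) \<xi>) - markov f (trajectory k \<xi>)"
  have \<delta>: "\<bar>?\<delta> \<xi>\<bar> \<le> 2 * C" for \<xi>
    using C[of "trajectory (Suc k) \<xi>"] mC[of "trajectory k \<xi>"] by linarith
  have "expectation (\<lambda>\<xi>. (a (history k \<xi>) + B) * ?\<delta> \<xi>) = 0"
  proof (rule diff[of "\<lambda>z. a z + B" "2 * B"])
    show "0 \<le> a z + B" "\<bar>a z + B\<bar> \<le> 2 * B" for z using bound[of z] by linarith+
  qed measurable
  moreover have "expectation (\<lambda>\<xi>. B * ?\<delta> \<xi>) = 0"
    by (rule diff[of "\<lambda>_. B" B]) (use B in auto)
  moreover have "expectation (\<lambda>\<xi>. a (history k \<xi>) * ?\<delta> \<xi>)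
      = expectation (\<lambda>\<xi>. (a (history k \<xi>) + B) * ?\<delta> \<xi> - B * ?\<delta> \<xi>)"
    by (simp add: algebra_simps)
  moreover have "integrable P (\<lambda>\<xi>. (a (history k \<xi>) + B) * ?\<delta> \<xi>)"
  proof (rule int[of "\<lambda>z. a z + B" ?\<delta> "2 * B" "2 * C"])
    show "\<bar>a z + B\<bar> \<le> 2 * B" for z using bound[of z] by linarith
  qed (measurable, use \<delta> in auto)
  moreover have "integrable P (\<lambda>\<xi>. B * ?\<delta> \<xi>)"
    by (rule int[of "\<lambda>z. B" ?\<delta> B "2 * C"]) (measurable, use B \<delta> in auto)
  ultimately show ?thesis by (simp only: Bochner_Integration.integral_diff)
qed

text \<open>For \<open>j < k\<close> the \<open>j\<close>-th increment is determined by the history up to time \<open>k\<close>, so it is orthogonal to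
  the \<open>k\<close>-th one by the Markov property.\<close>

lemma markov_step_strong_law:
  assumes f: "continuous_on UNIV f"
  shows "AE \<xi> in P. (\<lambda>n. (\<Sum>k<n. f (trajectory (Suc k) \<xi>) - markov f (trajectory k \<xi>)) / real n) \<longlonglongrightarrow> 0"
proof -
  obtain C where C: "\<And>p. \<bar>f p\<bar> \<le> C" using continuous_bounded_cproj[OF f] by blast
  have [measurable]: "f \<in> borel_measurable borel" "markov f \<in> borel_measurable borel"
    by (intro borel_measurable_continuous_onI continuous_on_markov f)+
  define D where "D k z = f (trajectory (Suc k) z) - markov f (trajectory k z)" for k z
  have bound: "\<bar>D k z\<bar> \<le> 2 * C" for k z
    unfolding D_def using C[of "trajectory (Suc k) z"] markov_bound[OF f C, of "trajectory k z"] by linarith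
  have "AE \<xi> in P. (\<lambda>n. (\<Sum>k<n. D k \<xi>) / real n) \<longlonglongrightarrow> 0"
  proof (rule orthogonal_strong_law[where B = "2 * C"])
    show "D k \<in> borel_measurable P" for k unfolding D_def by measurable
    show "\<bar>D k \<xi>\<bar> \<le> 2 * C" for k \<xi> by (rule bound)
    fix j k :: nat assume jk: "j < k"
    have "D j \<in> borel_measurable (borel \<Otimes>\<^sub>M PiM {..<k} (\<lambda>_. borel))"
    proof -
      show ?thesis
        using jk unfolding D_def
        by (intro borel_measurable_diff measurable_compose[OF measurable_trajectory_finite]) auto
    qed
    from expectation_markov_step[OF this bound f]
    have "expectation (\<lambda>\<xi>. D j (history k \<xi>) * D k \<xi>) = 0" by (simp add: D_def)
    then show "expectation (\<lambda>\<xi>. D j \<xi> * D k \<xi>) = 0"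
      using jk by (simp add: D_def trajectory_history)
  qed
  then show ?thesis by (simp add: D_def)
qed

end

section \<open>The ergodic theorem\<close>

text \<open>A statement about a single path. Time shifts change the sums by bounded amounts, so the time
  averages of \<open>g\<close>, of all \<open>(markov ^^ j) g\<close>, and of \<open>cesaro g m\<close> have the same limit behaviour; the
  last ones are within \<open>\<epsilon>\<close> of \<open>c\<close>.\<close>

lemma (in kraus_product) trajectory_average_limit:
  fixes y :: "nat \<Rightarrow> 'n cproj"
  assumes g: "continuous_on UNIV g"
    and unif: "\<And>\<epsilon>. \<epsilon> > 0 \<Longrightarrow> \<exists>m > 0. \<forall>p. \<bar>cesaro g m p - c\<bar> \<le> \<epsilon>"
    and steps: "\<And>j. (\<lambda>n. (\<Sum>k<n. (markov ^^ j) g (y (Suc k)) - markov ((markov ^^ j) g) (y k)) / real n) \<longlonglongrightarrow> 0"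
  shows "(\<lambda>n. (\<Sum>k<n. g (y k)) / real n) \<longlonglongrightarrow> c"
proof -
  let ?f = "\<lambda>j. (markov ^^ j) g"
  obtain C where C: "\<And>p. \<bar>g p\<bar> \<le> C" using continuous_bounded_cproj[OF g] by blast
  have shift: "(\<lambda>n. (\<Sum>k<n. ?f j (y k) - ?f (Suc j) (y k)) / real n) \<longlonglongrightarrow> 0" for j
  proof -
    have b: "\<bar>?f j p\<bar> \<le> C" for p by (rule markov_pow_bound[OF g C])
    have "(\<lambda>n. 2 * C * inverse (real n)) \<longlonglongrightarrow> 2 * C * 0"
      by (intro tendsto_mult tendsto_const lim_inverse_n)
    then have z: "(\<lambda>n. 2 * C * inverse (real n)) \<longlonglongrightarrow> 0" by simp
    have "(\<lambda>n. (?f j (y n) - ?f j (y 0)) / real n) \<longlonglongrightarrow> 0"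
    proof (rule Lim_null_comparison[OF _ z], intro always_eventually allI)
      fix n
      have "\<bar>?f j (y n) - ?f j (y 0)\<bar> \<le> 2 * C" using b[of "y n"] b[of "y 0"] by linarith
      then have "\<bar>?f j (y n) - ?f j (y 0)\<bar> / real n \<le> 2 * C / real n" by (rule divide_right_mono) simp
      then show "norm ((?f j (y n) - ?f j (y 0)) / real n) \<le> 2 * C * inverse (real n)"
        by (simp add: divide_inverse abs_mult)
    qed
    from tendsto_diff[OF steps[of j] this]
    have "(\<lambda>n. (\<Sum>k<n. ?f j (y (Suc k)) - ?f (Suc j) (y k)) / real n - (?f j (y n) - ?f j (y 0)) / real n) \<longlonglongrightarrow> 0"
      by simp
    moreover have "(\<Sum>k<n. ?f j (y (Suc k)) - ?f (Suc j) (y k)) / real n - (?f j (y n) - ?f j (y 0)) / real n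
        = (\<Sum>k<n. ?f j (y k) - ?f (Suc j) (y k)) / real n" for n
      by (subst sum_lessThan_telescope[symmetric])
         (simp add: diff_divide_distrib[symmetric] sum_subtractf[symmetric])
    ultimately show ?thesis by (simp only:)
  qed
  have pow: "(\<lambda>n. (\<Sum>k<n. g (y k) - ?f j (y k)) / real n) \<longlonglongrightarrow> 0" for j
  proof (induction j)
    case (Suc j)
    from tendsto_add[OF this shift[of j]]
    show ?case by (simp add: add_divide_distrib[symmetric] sum.distrib[symmetric])
  qed simp
  have avg: "(\<lambda>n. (\<Sum>k<n. g (y k) - cesaro g m (y k)) / real n) \<longlonglongrightarrow> 0" if m: "m > 0" for m
  proof -
    have "(\<lambda>n. (\<Sum>j<m. (\<Sum>k<n. g (y k) - ?f j (y k)) / real n) / real m) \<longlonglongrightarrow> (\<Sum>j<m. 0) / real m"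
      by (intro tendsto_divide tendsto_sum pow tendsto_const) (use m in auto)
    moreover have "(\<Sum>j<m. (\<Sum>k<n. g (y k) - ?f j (y k)) / real n) / real m
        = (\<Sum>k<n. g (y k) - cesaro g m (y k)) / real n" for n
    proof -
      have "g (y k) - cesaro g m (y k) = (\<Sum>j<m. g (y k) - ?f j (y k)) / real m" for k
        using m by (simp add: cesaro_def sum_subtractf diff_divide_distrib)
      then have "(\<Sum>k<n. g (y k) - cesaro g m (y k)) = (\<Sum>k<n. \<Sum>j<m. g (y k) - ?f j (y k)) / real m"
        by (simp add: sum_divide_distrib)
      also have "(\<Sum>k<n. \<Sum>j<m. g (y k) - ?f j (y k)) = (\<Sum>j<m. \<Sum>k<n. g (y k) - ?f j (y k))"
        by (rule sum.swap)
      finally show ?thesis by (simp add: sum_divide_distrib[symmetric] mult.commute)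
    qed
    ultimately show ?thesis by simp
  qed
  show ?thesis
  proof (rule LIMSEQ_I)
    fix r :: real assume r: "r > 0"
    obtain m where m: "m > 0" "\<And>p. \<bar>cesaro g m p - c\<bar> \<le> r / 2"
      using unif[of "r / 2"] r by auto
    obtain N where N: "\<And>n. n \<ge> N \<Longrightarrow> \<bar>(\<Sum>k<n. g (y k) - cesaro g m (y k)) / real n\<bar> < r / 2"
      using LIMSEQ_D[OF avg[OF m(1)], of "r / 2"] r by auto
    show "\<exists>N. \<forall>n\<ge>N. norm ((\<Sum>k<n. g (y k)) / real n - c) < r"
    proof (intro exI[of _ "Suc N"] allI impI)
      fix n assume n: "Suc N \<le> n"
      have "\<bar>\<Sum>k<n. cesaro g m (y k) - c\<bar> \<le> (\<Sum>k<n. r / 2)"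
        by (rule order_trans[OF sum_abs]) (intro sum_mono m)
      then have "\<bar>\<Sum>k<n. cesaro g m (y k) - c\<bar> / real n \<le> real n * (r / 2) / real n"
        by (intro divide_right_mono) simp_all
      then have a: "\<bar>(\<Sum>k<n. cesaro g m (y k) - c) / real n\<bar> \<le> r / 2"
        using n by simp
      have e: "(\<Sum>k<n. g (y k)) / real n - c
          = (\<Sum>k<n. g (y k) - cesaro g m (y k)) / real n + (\<Sum>k<n. cesaro g m (y k) - c) / real n"
        using n by (simp add: add_divide_distrib[symmetric] sum.distrib[symmetric] sum_subtractf diff_divide_distrib)
      show "norm ((\<Sum>k<n. g (y k)) / real n - c) < r"
        using N[of n] a n unfolding e real_norm_def by linarith
    qed
  qed
qed

lemma (in quantum_trajectory) real_ergodic_theorem: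
  assumes pur: "purifying \<mu>" and erg: "ergodic \<mu>" and inv: "invariant_prob \<mu> \<nu>_inv"
    and g: "continuous_on UNIV g"
  shows "AE \<xi> in P. (\<lambda>n. (\<Sum>k<n. g (trajectory k \<xi>)) / real n) \<longlonglongrightarrow> (\<integral>p. g p \<partial>\<nu>_inv)"
proof -
  have \<nu>: "prob_space \<nu>_inv" "sets \<nu>_inv = sets borel"
    using inv by (simp_all add: invariant_prob_def borel_prob_def)
  have unif: "\<exists>m > 0. \<forall>p. \<bar>cesaro g m p - (\<integral>p. g p \<partial>\<nu>_inv)\<bar> \<le> \<epsilon>" if "\<epsilon> > 0" for \<epsilon>
  proof -
    obtain M where "\<forall>m\<ge>M. \<forall>p. \<bar>cesaro g m p - (\<integral>p. g p \<partial>\<nu>_inv)\<bar> \<le> \<epsilon>"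
      using cesaro_uniform_limit[OF pur erg g \<nu> integral_invariant[OF inv] \<open>\<epsilon> > 0\<close>] by blast
    then show ?thesis by (intro exI[of _ "Suc M"]) auto
  qed
  have "AE \<xi> in P. \<forall>j. (\<lambda>n. (\<Sum>k<n. (markov ^^ j) g (trajectory (Suc k) \<xi>)
      - markov ((markov ^^ j) g) (trajectory k \<xi>)) / real n) \<longlonglongrightarrow> 0"
    unfolding AE_all_countable by (intro allI markov_step_strong_law continuous_on_markov_pow g)
  then show ?thesis
  proof (rule eventually_mono)
    fix \<xi> assume steps: "\<forall>j. (\<lambda>n. (\<Sum>k<n. (markov ^^ j) g (trajectory (Suc k) \<xi>)
      - markov ((markov ^^ j) g) (trajectory k \<xi>)) / real n) \<longlonglongrightarrow> 0"
    show "(\<lambda>n. (\<Sum>k<n. g (trajectory k \<xi>)) / real n) \<longlonglongrightarrow> (\<integral>p. g p \<partial>\<nu>_inv)"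
      by (rule trajectory_average_limit[OF g unif]) (use steps in blast)+
  qed
qed

theorem theorem3p1:
  fixes \<mu> :: "(complex ^ 'n ^ 'n) measure"
    and \<nu> \<nu>_inv :: "('n cproj) measure"
    and P :: "('n cproj \<times> (nat \<Rightarrow> complex ^ 'n ^ 'n)) measure"
    and g :: "'n cproj \<Rightarrow> complex"
  assumes "sets \<mu> = sets borel"
    and "integrable \<mu> (\<lambda>v. (opnorm v)\<^sup>2)"
    and "(\<integral>v. cadjoint v ** v \<partial>\<mu>) = mat 1"
    and "purifying \<mu>"
    and "ergodic \<mu>"
    and "invariant_prob \<mu> \<nu>_inv"
    and "borel_prob \<nu>"
    and "trajectory_measure \<mu> \<nu> P"
    and "continuous_on UNIV g"
  shows "AE \<xi> in P. (\<lambda>n. 1 / of_nat n * (\<Sum>k<n. g (trajectory k \<xi>)))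
           \<longlonglongrightarrow> (\<integral>p. g p \<partial>\<nu>_inv)"
proof -
  interpret quantum_trajectory \<mu> \<nu> P
    by unfold_locales (rule assms)+
  have R: "continuous_on UNIV (\<lambda>p. Re (g p))" and I: "continuous_on UNIV (\<lambda>p. Im (g p))"
    using assms(9) by (auto intro!: continuous_intros)
  have \<nu>: "borel_prob \<nu>_inv" using assms(6) by (simp add: invariant_prob_def)
  have int: "integrable \<nu>_inv g"
    using Bochner_Integration.integrable_add[OF integrable_of_real[OF integrable_continuous_cproj[OF \<nu> R]]
        integrable_mult_right[OF integrable_of_real[OF integrable_continuous_cproj[OF \<nu> I]], of "\<i>"]]
    by (simp add: complex_eq[symmetric])
  show ?thesis
    using real_ergodic_theorem[OF assms(4,5,6) R] real_ergodic_theorem[OF assms(4,5,6) I]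
  proof eventually_elim
    case (elim \<xi>)
    let ?S = "\<lambda>n. 1 / of_nat n * (\<Sum>k<n. g (trajectory k \<xi>))"
    have "Re (?S n) = (\<Sum>k<n. Re (g (trajectory k \<xi>))) / real n"
      "Im (?S n) = (\<Sum>k<n. Im (g (trajectory k \<xi>))) / real n" for n
      by (simp_all add: Re_divide_of_nat Im_divide_of_nat)
    then show ?case
      unfolding tendsto_complex_iff using elim int by simp
  qed
qed

end
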